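(* Let $(X,d_X,m_X)$ be a metric measure space with $\operatorname{supp}m_X=X$ that satisfies $CD(k,N)$ for an admissible function $k:X\to\mathbb R$. If $N>1$, then for each $x\in X$ and all $0<r<R$ with $R\le\pi_{\underline k_x/(N-1)}$, $$\frac{s(r)}{s(R)}\ge\frac{\mathfrak s_{\underline k_x/(N-1)}(r)^{N-1}}{\mathfrak s_{\underline k_x/(N-1)}(R)^{N-1}}\quad\text{and}\quad\frac{v(r)}{v(R)}\ge\frac{\int_0^r\mathfrak s_{\underline k_x/(N-1)}(t)^{N-1}dt}{\int_0^R\mathfrak s_{\underline k_x/(N-1)}(t)^{N-1}dt},$$ where $v(r)=m_X(\bar B_r(x))$ and $s(r)=\limsup_{\delta\downarrow0}\frac1\delta m_X(\bar B_{r+\delta}(x)\setminus B_r(x))$.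
   Context: A function $k:X\to\mathbb R$ is admissible if it is lower semicontinuous and locally bounded from below. Under $CD(k,N)$ and $\operatorname{supp}m_X=X$ the space $X$ is proper and geodesic, so for $x\in X$ and every $r\ge0$ with nonempty sphere $\{y:d_X(x,y)=r\}$ one can set $k_x(r)=\min\{k(y):d_X(x,y)=r\}$; these $r$ form an interval $I_x$ starting at $0$. $\underline k_x:I_x\to\mathbb R$ denotes the lower semicontinuous envelope of $k_x$. Generalized sine for lower semicontinuous $\kappa$ on an interval $I\ni0$ in $[0,\infty)$: for $T\in I$, $T>0$, put $\kappa_n^T(s)=\inf_{r\in[0,T]}\{\kappa(r)+n|s-r|\}$ on $[0,T]$, and let $\mathfrak s_{\kappa_n^T}$ solve $u''+\kappa_n^Tu=0$, $u(0)=0$, $u'(0)=1$. If $\mathfrak s_{\kappa_n^T}>0$ on $(0,T)$ for all $n$, set $\mathfrak s_\kappa=\lim_{n\to\infty}\mathfrak s_{\kappa_n^T}$ on $[0,T]$ (a decreasing limit, not depending on $T$). $\pi_\kappa$ is the supremum of all $T$ such that $\mathfrak s_{\kappa_n^T}>0$ on $(0,T)$ for all $n$ and $\mathfrak s_\kappa>0$ on $(0,T)$. A metric measure space $(X,d_X,m_X)$ is a complete separable metric space $(X,d_X)$ with a Borel measure $m_X$ such that for every $x\in X$ there is $r>0$ with $m_X(B_r(x))\in(0,\infty)$; also $m_X(X)\ne 0$. A geodesic is a distance-minimizing curve $\gamma:[0,1]\to X$ of constant speed; $|\dot\gamma|$ denotes its speed, i.e. its length. $\mathcal G(X)$ is the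 set of geodesics with the sup-distance, and $e_t(\gamma)=\gamma(t)$. $\mathcal P_2(X)$ is the set of Borel probability measures with finite second moment, with the $L^2$-Wasserstein distance, and $\mathcal P_2(X,m_X)$ is the subset of $m_X$-absolutely continuous ones. A dynamical optimal coupling of $\mu_0,\mu_1$ is a probability measure $\Pi$ on $\mathcal G(X)$ such that $(e_0,e_1)_*\Pi$ is an optimal coupling (for the cost $d_X^2$) of $\mu_0,\mu_1$. Distortion coefficients. For $\theta>0$ and continuous $\kappa:[0,\theta]\to\mathbb R$, with $\mathfrak s_\kappa$ the solution of $u''+\kappa u=0$, $u(0)=0$, $u'(0)=1$, and $t\in[0,1]$ put $\sigma^{(t)}_\kappa(\theta)=\mathfrak s_\kappa(t\theta)/\mathfrak s_\kappa(\theta)$ if $\mathfrak s_\kappa>0$ on $(0,\theta]$, and $\sigma^{(t)}_\kappa(\theta)=\infty$ otherwise. For lower semicontinuous $\kappa:[0,\theta]\to\mathbb R$ put $\kappa_n(s)=\inf_{r\in[0,\theta]}\{\kappa(r)+n|s-r|\}$ and $\sigma^{(t)}_\kappa(\theta)=\lim_{n\to\infty}\sigma^{(t)}_{\kappa_n}(\theta)\in[0,\infty]$ (consistent for continuous $\kappa$). Put $\sigma_\kappa^{(t)}(0)=t$. For lower semicontinuous $k:X\to\mathbb R$ and a geodesic $\gamma$ with $\theta=|\dot\gamma|$ let $\bar\gamma:[0,\theta]\to X$ be its unit speed reparametrization, $k^+_\gamma=k_\gamma=k\circ\bar\gamma$ and $k^-_\gamma(s)=k_\gamma(\theta-s)$.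 For $N>0$ set $\sigma^{(t)}_{k^\pm_\gamma,N}(\theta)=\sigma^{(t)}_{k^\pm_\gamma/N}(\theta)$. For $N>1$ set $\tau^{(t)}_{k^\pm_\gamma,N}(\theta)=t^{1/N}\big[\sigma^{(t)}_{k^\pm_\gamma,N-1}(\theta)\big]^{(N-1)/N}$. Conventions: $r\cdot\infty=\infty$ for $r>0$, $0\cdot\infty=0$, $\infty^\alpha=\infty$ for $\alpha>0$. Condition $CD(k,N)$. For $\nu=\varrho m_X+\nu^s$ (Lebesgue decomposition) let $S_N(\nu)=-\int_X\varrho^{1-1/N}\,dm_X$. $(X,d_X,m_X)$ satisfies $CD(k,N)$ if for each pair $\nu_0=\varrho_0m_X,\nu_1=\varrho_1m_X\in\mathcal P_2(X,m_X)$ with bounded support there exist a dynamical optimal coupling $\Pi$ of $\nu_0,\nu_1$ and a geodesic $(\nu_t)_{t\in[0,1]}\subset\mathcal P_2(X,m_X)$ from $\nu_0$ to $\nu_1$ such that $$S_{N'}(\nu_t)\le-\int\Big[\tau^{(1-t)}_{k^-_\gamma,N'}(|\dot\gamma|)\varrho_0(\gamma(0))^{-1/N'}+\tau^{(t)}_{k^+_\gamma,N'}(|\dot\gamma|)\varrho_1(\gamma(1))^{-1/N'}\Big]d\Pi(\gamma)$$ for all $t\in[0,1]$ and all $N'\ge N$. *)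

theory Defs
  imports "HOL-Probability.Probability"
begin

section \<open>Lower semicontinuity\<close>

definition lsc_on :: "'a::topological_space set \<Rightarrow> ('a \<Rightarrow> real) \<Rightarrow> bool" where
  "lsc_on S f \<longleftrightarrow> (\<forall>x\<in>S. \<forall>a<f x. \<forall>\<^sub>F y in at x within S. a < f y)"

definition admissible :: "('a::topological_space \<Rightarrow> real) \<Rightarrow> bool" where
  "admissible k \<longleftrightarrow> lsc_on UNIV k \<and> (\<forall>x. \<exists>U. open U \<and> x \<in> U \<and> bdd_below (k ` U))"

text \<open>The lower semicontinuous envelope: the largest lower semicontinuous minorant on \<open>S\<close>.\<close>

definition lsc_envelope :: "'a::topological_space set \<Rightarrow> ('a \<Rightarrow> real) \<Rightarrow> 'a \<Rightarrow> real" where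
  "lsc_envelope S f x = Sup {g x |g. lsc_on S g \<and> (\<forall>y\<in>S. g y \<le> f y)}"


section \<open>Generalized sine functions\<close>

definition sine_solution :: "(real \<Rightarrow> real) \<Rightarrow> real \<Rightarrow> (real \<Rightarrow> real) \<Rightarrow> bool" where
  "sine_solution \<kappa> T u \<longleftrightarrow> (\<exists>u'. u 0 = 0 \<and> u' 0 = 1 \<and>
     (\<forall>s\<in>{0..T}. (u has_real_derivative u' s) (at s within {0..T}) \<and>
                 (u' has_real_derivative - (\<kappa> s * u s)) (at s within {0..T})))"

text \<open>For continuous \<open>\<kappa>\<close> on \<open>{0..T}\<close> with \<open>T > 0\<close> the solution exists and is unique on \<open>{0..T}\<close>;
  outside that interval the value of \<open>sine\<close> is unspecified and never used.\<close>

definition sine :: "(real \<Rightarrow> real) \<Rightarrow> real \<Rightarrow> real \<Rightarrow> real" where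
  "sine \<kappa> T = (SOME u. sine_solution \<kappa> T u)"

definition lip_approx :: "(real \<Rightarrow> real) \<Rightarrow> real \<Rightarrow> nat \<Rightarrow> real \<Rightarrow> real" where
  "lip_approx \<kappa> T n s = (INF r\<in>{0..T}. \<kappa> r + real n * \<bar>s - r\<bar>)"

definition gsine_domain :: "real set \<Rightarrow> (real \<Rightarrow> real) \<Rightarrow> real \<Rightarrow> bool" where
  "gsine_domain I \<kappa> T \<longleftrightarrow> T \<in> I \<and> 0 < T \<and>
     (\<forall>n. \<forall>s\<in>{0<..<T}. 0 < sine (lip_approx \<kappa> T n) T s)"

definition gsine_on :: "(real \<Rightarrow> real) \<Rightarrow> real \<Rightarrow> real \<Rightarrow> real" where
  "gsine_on \<kappa> T s = lim (\<lambda>n. sine (lip_approx \<kappa> T n) T s)"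

text \<open>The limit does not depend on the choice of the interval \<open>{0..T}\<close> containing \<open>s\<close>, so
  the generalized sine at \<open>s\<close> is evaluated with an arbitrary one.\<close>

definition gsine :: "real set \<Rightarrow> (real \<Rightarrow> real) \<Rightarrow> real \<Rightarrow> real" where
  "gsine I \<kappa> s = gsine_on \<kappa> (SOME T. gsine_domain I \<kappa> T \<and> s \<le> T) s"

definition gpi :: "real set \<Rightarrow> (real \<Rightarrow> real) \<Rightarrow> ennreal" where
  "gpi I \<kappa> = Sup {ennreal T |T. gsine_domain I \<kappa> T \<and> (\<forall>s\<in>{0<..<T}. 0 < gsine_on \<kappa> T s)}"


section \<open>Distortion coefficients\<close>

text \<open>Powers of extended nonnegative reals. In particular \<open>\<infinity>\<close> to a positive power is \<open>\<infinity>\<close>, and \<open>0\<close>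
  to a negative power is \<open>\<infinity>\<close>. The multiplication of \<^typ>\<open>ennreal\<close> already satisfies
  \<open>0 * \<infinity> = 0\<close> and \<open>r * \<infinity> = \<infinity>\<close> for \<open>r > 0\<close>.\<close>

definition ennpowr :: "ennreal \<Rightarrow> real \<Rightarrow> ennreal" where
  "ennpowr x a =
    (if a = 0 then 1
     else if x = 0 then (if a < 0 then \<infinity> else 0)
     else if x = \<infinity> then (if a < 0 then 0 else \<infinity>)
     else ennreal (enn2real x powr a))"

definition sigma_cont :: "(real \<Rightarrow> real) \<Rightarrow> real \<Rightarrow> real \<Rightarrow> ennreal" where
  "sigma_cont \<kappa> t \<theta> =
    (if \<forall>s\<in>{0<..\<theta>}. 0 < sine \<kappa> \<theta> s then ennreal (sine \<kappa> \<theta> (t * \<theta>) / sine \<kappa> \<theta> \<theta>) else \<infinity>)"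

definition sigma_coeff :: "(real \<Rightarrow> real) \<Rightarrow> real \<Rightarrow> real \<Rightarrow> ennreal" where
  "sigma_coeff \<kappa> t \<theta> =
    (if \<theta> = 0 then ennreal t else lim (\<lambda>n. sigma_cont (lip_approx \<kappa> \<theta> n) t \<theta>))"

definition sigma_coeff_N :: "(real \<Rightarrow> real) \<Rightarrow> real \<Rightarrow> real \<Rightarrow> real \<Rightarrow> ennreal" where
  "sigma_coeff_N \<kappa> N t \<theta> = sigma_coeff (\<lambda>s. \<kappa> s / N) t \<theta>"

definition tau_coeff :: "(real \<Rightarrow> real) \<Rightarrow> real \<Rightarrow> real \<Rightarrow> real \<Rightarrow> ennreal" where
  "tau_coeff \<kappa> N t \<theta> =
     ennpowr (ennreal t) (1 / N) * ennpowr (sigma_coeff_N \<kappa> (N - 1) t \<theta>) ((N - 1) / N)"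


section \<open>Geodesics\<close>

definition const_speed_geodesic :: "('b \<Rightarrow> 'b \<Rightarrow> real) \<Rightarrow> (real \<Rightarrow> 'b) \<Rightarrow> bool" where
  "const_speed_geodesic d \<gamma> \<longleftrightarrow>
     (\<forall>s\<in>{0..1}. \<forall>t\<in>{0..1}. d (\<gamma> s) (\<gamma> t) = \<bar>s - t\<bar> * d (\<gamma> 0) (\<gamma> 1))"

definition speed :: "(real \<Rightarrow> 'a::metric_space) \<Rightarrow> real" where
  "speed \<gamma> = dist (\<gamma> 0) (\<gamma> 1)"

text \<open>The space of geodesics as a subspace of the continuous curves on \<open>{0..1}\<close> (extended by
  \<^term>\<open>undefined\<close> outside \<open>{0..1}\<close>) with the supremum distance.\<close>

definition geodesic_space :: "(real \<Rightarrow> 'a::metric_space) metric" where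
  "geodesic_space =
     submetric (cfunspace (top_of_set {0..1}) euclidean_metric) {\<gamma>. const_speed_geodesic dist \<gamma>}"

definition geodesic_borel :: "(real \<Rightarrow> 'a::metric_space) measure" where
  "geodesic_borel = sigma (mspace geodesic_space) {U. openin (mtopology_of geodesic_space) U}"

definition along_fwd :: "('a::metric_space \<Rightarrow> real) \<Rightarrow> (real \<Rightarrow> 'a) \<Rightarrow> real \<Rightarrow> real" where
  "along_fwd k \<gamma> s = k (\<gamma> (s / speed \<gamma>))"

definition along_bwd :: "('a::metric_space \<Rightarrow> real) \<Rightarrow> (real \<Rightarrow> 'a) \<Rightarrow> real \<Rightarrow> real" where
  "along_bwd k \<gamma> s = along_fwd k \<gamma> (speed \<gamma> - s)"


section \<open>Metric measure spaces and optimal transport\<close>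

definition metric_measure_space :: "'a::polish_space measure \<Rightarrow> bool" where
  "metric_measure_space m \<longleftrightarrow> sets m = sets borel \<and>
     (\<forall>x. \<exists>r>0. 0 < emeasure m (ball x r) \<and> emeasure m (ball x r) < \<infinity>) \<and>
     emeasure m UNIV \<noteq> 0"

definition msupport :: "'a::topological_space measure \<Rightarrow> 'a set" where
  "msupport m = {x. \<forall>U. open U \<longrightarrow> x \<in> U \<longrightarrow> 0 < emeasure m U}"

definition P2 :: "'a::polish_space measure set" where
  "P2 = {\<mu>. sets \<mu> = sets borel \<and> prob_space \<mu> \<and>
            (\<exists>x. (\<integral>\<^sup>+ y. ennreal ((dist x y)\<^sup>2) \<partial>\<mu>) < \<infinity>)}"

definition P2_ac :: "'a::polish_space measure \<Rightarrow> 'a measure set" where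
  "P2_ac m = {\<mu>\<in>P2. absolutely_continuous m \<mu>}"

definition couplings :: "'a::polish_space measure \<Rightarrow> 'a measure \<Rightarrow> ('a \<times> 'a) measure set" where
  "couplings \<mu> \<nu> = {q. sets q = sets borel \<and> prob_space q \<and>
                       distr q borel fst = \<mu> \<and> distr q borel snd = \<nu>}"

definition transport_cost :: "('a::polish_space \<times> 'a) measure \<Rightarrow> ennreal" where
  "transport_cost q = (\<integral>\<^sup>+ z. ennreal ((dist (fst z) (snd z))\<^sup>2) \<partial>q)"

definition optimal_coupling ::
    "'a::polish_space measure \<Rightarrow> 'a measure \<Rightarrow> ('a \<times> 'a) measure \<Rightarrow> bool" where
  "optimal_coupling \<mu> \<nu> q \<longleftrightarrow> q \<in> couplings \<mu> \<nu> \<and>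
     (\<forall>q'\<in>couplings \<mu> \<nu>. transport_cost q \<le> transport_cost q')"

definition W2 :: "'a::polish_space measure \<Rightarrow> 'a measure \<Rightarrow> real" where
  "W2 \<mu> \<nu> = sqrt (enn2real (INF q\<in>couplings \<mu> \<nu>. transport_cost q))"

definition dynamical_optimal_coupling ::
    "'a::polish_space measure \<Rightarrow> 'a measure \<Rightarrow> (real \<Rightarrow> 'a) measure \<Rightarrow> bool" where
  "dynamical_optimal_coupling \<mu> \<nu> Q \<longleftrightarrow> sets Q = sets geodesic_borel \<and> prob_space Q \<and>
     optimal_coupling \<mu> \<nu> (distr Q borel (\<lambda>\<gamma>. (\<gamma> 0, \<gamma> 1)))"


section \<open>The curvature-dimension condition\<close>

definition lebesgue_decomposition ::
    "'a measure \<Rightarrow> 'a measure \<Rightarrow> ('a \<Rightarrow> ennreal) \<Rightarrow> 'a measure \<Rightarrow> bool" where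
  "lebesgue_decomposition m \<nu> \<rho> \<nu>s \<longleftrightarrow> \<rho> \<in> borel_measurable m \<and> sets \<nu>s = sets m \<and>
     (\<forall>A\<in>sets m. emeasure \<nu> A = emeasure (density m \<rho>) A + emeasure \<nu>s A) \<and>
     (\<exists>A\<in>sets m. emeasure m A = 0 \<and> emeasure \<nu>s (space m - A) = 0)"

definition ac_density :: "'a measure \<Rightarrow> 'a measure \<Rightarrow> 'a \<Rightarrow> ennreal" where
  "ac_density m \<nu> = (SOME \<rho>. \<exists>\<nu>s. lebesgue_decomposition m \<nu> \<rho> \<nu>s)"

definition renyi_entropy :: "'a measure \<Rightarrow> real \<Rightarrow> 'a measure \<Rightarrow> ereal" where
  "renyi_entropy m N \<nu> = - enn2ereal (\<integral>\<^sup>+ x. ennpowr (ac_density m \<nu> x) (1 - 1 / N) \<partial>m)"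

definition CD_integral ::
    "('a::polish_space \<Rightarrow> real) \<Rightarrow> real \<Rightarrow> real \<Rightarrow> ('a \<Rightarrow> ennreal) \<Rightarrow> ('a \<Rightarrow> ennreal) \<Rightarrow>
     (real \<Rightarrow> 'a) measure \<Rightarrow> ennreal" where
  "CD_integral k N t \<rho>0 \<rho>1 Q =
     (\<integral>\<^sup>+ \<gamma>. tau_coeff (along_bwd k \<gamma>) N (1 - t) (speed \<gamma>) * ennpowr (\<rho>0 (\<gamma> 0)) (- 1 / N)
           + tau_coeff (along_fwd k \<gamma>) N t (speed \<gamma>) * ennpowr (\<rho>1 (\<gamma> 1)) (- 1 / N) \<partial>Q)"

text \<open>Both sides of the entropy inequality are negatives of integrals of nonnegative functions, which
  may be infinite; hence the comparison takes place in \<^typ>\<open>ereal\<close>.\<close>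

definition CD :: "'a::polish_space measure \<Rightarrow> ('a \<Rightarrow> real) \<Rightarrow> real \<Rightarrow> bool" where
  "CD m k N \<longleftrightarrow>
    (\<forall>\<nu>0\<in>P2_ac m. \<forall>\<nu>1\<in>P2_ac m. \<forall>\<rho>0\<in>borel_measurable m. \<forall>\<rho>1\<in>borel_measurable m.
       \<nu>0 = density m \<rho>0 \<longrightarrow> \<nu>1 = density m \<rho>1 \<longrightarrow>
       bounded (msupport \<nu>0) \<longrightarrow> bounded (msupport \<nu>1) \<longrightarrow>
       (\<exists>Q \<nu>. dynamical_optimal_coupling \<nu>0 \<nu>1 Q \<and>
          const_speed_geodesic W2 \<nu> \<and> (\<forall>t\<in>{0..1}. \<nu> t \<in> P2_ac m) \<and> \<nu> 0 = \<nu>0 \<and> \<nu> 1 = \<nu>1 \<and>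
          (\<forall>t\<in>{0..1}. \<forall>N'\<ge>N.
             renyi_entropy m N' (\<nu> t) \<le> - enn2ereal (CD_integral k N' t \<rho>0 \<rho>1 Q))))"


section \<open>Radial lower bound, sphere and ball volumes\<close>

definition radii :: "'a::metric_space \<Rightarrow> real set" where
  "radii x = {r. 0 \<le> r \<and> sphere x r \<noteq> {}}"

text \<open>For admissible \<open>k\<close> on a proper space the infimum over a nonempty sphere is a minimum.\<close>

definition radial_min :: "('a::metric_space \<Rightarrow> real) \<Rightarrow> 'a \<Rightarrow> real \<Rightarrow> real" where
  "radial_min k x r = (INF y\<in>sphere x r. k y)"

definition radial_lsc :: "('a::metric_space \<Rightarrow> real) \<Rightarrow> 'a \<Rightarrow> real \<Rightarrow> real" where
  "radial_lsc k x = lsc_envelope (radii x) (radial_min k x)"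

definition ball_volume :: "'a::metric_space measure \<Rightarrow> 'a \<Rightarrow> real \<Rightarrow> ennreal" where
  "ball_volume m x r = emeasure m (cball x r)"

definition sphere_volume :: "'a::metric_space measure \<Rightarrow> 'a \<Rightarrow> real \<Rightarrow> ennreal" where
  "sphere_volume m x r =
     Limsup (at_right 0) (\<lambda>\<delta>. emeasure m (cball x (r + \<delta>) - ball x r) / ennreal \<delta>)"

definition model_sine :: "('a::metric_space \<Rightarrow> real) \<Rightarrow> real \<Rightarrow> 'a \<Rightarrow> real \<Rightarrow> real" where
  "model_sine k N x = gsine (radii x) (\<lambda>r. radial_lsc k x r / (N - 1))"

definition model_pi :: "('a::metric_space \<Rightarrow> real) \<Rightarrow> real \<Rightarrow> 'a \<Rightarrow> ennreal" where
  "model_pi k N x = gpi (radii x) (\<lambda>r. radial_lsc k x r / (N - 1))"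

end

theory Submission
  imports Defs
begin

text \<open>
Only the radial function \<open>\<kappa> = k\<^sub>x / (N - 1)\<close> (in its lower semicontinuous form) is known about the
curvature, so the proof compares the measure of thin annuli around \<open>x\<close> by transporting a small
ball around \<open>x\<close> to an annulus. Let \<open>A\<close> be the annulus of radii \<open>R1\<close> and \<open>R2\<close>, and let \<open>\<nu>0\<close>, \<open>\<nu>1\<close> be
the uniform distributions on a ball of radius \<open>\<epsilon>\<close> around \<open>x\<close> and on \<open>A\<close>. A geodesic of the transport
starts at distance at most \<open>\<epsilon>\<close> from \<open>x\<close>, hence after running a length \<open>s\<close> it is at distance about \<open>s\<close>
from \<open>x\<close>, where the curvature is at least about \<open>(N - 1) \<kappa>(s)\<close>. So the distortion coefficients along
it are at least those of \<open>\<kappa>\<close>, and as \<open>\<epsilon> \<rightarrow> 0\<close> the entropy inequality becomes a Brunn-Minkowski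
inequality: the annulus scaled by \<open>t\<close> has measure at least \<open>t c\<^sup>N\<^sup>-\<^sup>1 m(A)\<close> whenever \<open>c\<close> is below the
ratio \<open>s\<^sub>\<kappa>(t \<theta>) / s\<^sub>\<kappa>(\<theta>)\<close> for all radii \<open>\<theta>\<close> of \<open>A\<close>. This is \<open>brunn_minkowski_annuli\<close>. Applied to
very thin annuli at radius \<open>R\<close> it gives the inequality for spheres. For balls, \<open>(0,r)\<close> and \<open>(r,R)\<close>
are cut into small pieces that are scaled copies of each other, and the inequalities for all pairs
of pieces are summed (\<open>comparison_multiplicative\<close>).

Four points carry the technical weight.

\<^item> The coefficient \<open>\<kappa>\<close> is merely lower semicontinuous. Everything is done with its Lipschitz
  approximations \<open>\<kappa>\<^sub>n \<le> \<kappa>\<close>, whose sines are classical solutions that can be compared by Sturm's theorem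
  (\<open>sturm_comparison\<close>), and \<open>n \<rightarrow> \<infinity>\<close> is taken in the final inequalities. The limit does
  not depend on the interval on which it is formed (\<open>gsine_on_independent\<close>), and the radius
  \<open>\<pi>\<^sub>\<kappa>\<close> itself may be used (\<open>gsine_up_to_gpi\<close>).

\<^item> The condition \<open>CD\<close> provides a Wasserstein geodesic \<open>\<nu>\<^sub>t\<close> and a coupling \<open>\<Pi>\<close> that are not tied to each
  other. That \<open>\<nu>\<^sub>t\<close> lives on the scaled annulus therefore has to be deduced from the distances
  \<open>W\<^sub>2(\<nu>0,\<nu>\<^sub>t)\<close> and \<open>W\<^sub>2(\<nu>\<^sub>t,\<nu>1)\<close> alone: almost optimal couplings are glued along a fine partition
  of the space in the middle, and the strict convexity of the square forces the middle point to be at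
  the right distance (\<open>W2_geodesic_localization\<close>).

\<^item> The radial minimum of \<open>k\<close> makes sense because the space is proper. Locally, where \<open>k\<close> is bounded
  below, the Brunn-Minkowski inequality bounds the measure of small balls from below, which gives
  local compactness; the transports give approximate intermediate points; then the argument of Hopf
  and Rinow applies (\<open>CD_proper\<close>).

\<^item> At \<open>R = \<pi>\<^sub>\<kappa>\<close> the model sine may vanish. The ratios \<open>c\<close> are then arbitrarily large, which forces the
  sphere of radius \<open>R\<close> to have zero volume, while spheres of smaller radius have positive
  and finite volume (\<open>sphere_volume_positive\<close>, \<open>sphere_volume_finite\<close>).
\<close>

section \<open>Linear second order equations and Sturm comparison\<close>

lemma nonneg_deriv_within_mono:
  fixes f f' :: "real \<Rightarrow> real"
  assumes der: "\<And>s. s \<in> {a..b} \<Longrightarrow> (f has_real_derivative f' s) (at s within {a..b})"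
    and nn: "\<And>s. s \<in> {a<..<b} \<Longrightarrow> 0 \<le> f' s" and "a \<le> p" "p \<le> q" "q \<le> b"
  shows "f p \<le> f q"
proof (rule DERIV_nonneg_imp_increasing_open[OF \<open>p \<le> q\<close>])
  have "continuous_on {a..b} f" using der DERIV_continuous_on by blast
  then show "continuous_on {p..q} f" by (rule continuous_on_subset) (use assms in auto)
  fix s assume s: "p < s" "s < q"
  then have "s \<in> interior {a..b}" using assms by auto
  then have "(f has_real_derivative f' s) (at s)"
    using der[of s] at_within_interior interior_subset by (metis subsetD)
  then show "\<exists>y. (f has_real_derivative y) (at s) \<and> 0 \<le> y"
    using nn[of s] s assms by auto
qed

text \<open>The function \<open>E s * exp (- a * s) - b * s\<close> is nonincreasing.\<close>

lemma gronwall_affine: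
  fixes E E' :: "real \<Rightarrow> real"
  assumes der: "\<And>s. s \<in> {0..T} \<Longrightarrow> (E has_real_derivative E' s) (at s within {0..T})"
    and le: "\<And>s. s \<in> {0..T} \<Longrightarrow> E' s \<le> a * E s + b"
    and "0 \<le> a" "0 \<le> b" and s: "s \<in> {0..T}"
  shows "E s \<le> (E 0 + b * s) * exp (a * s)"
proof -
  define F where "F = (\<lambda>s. b * s - E s * exp (- a * s))"
  have dF: "(F has_real_derivative b - (E' s - a * E s) * exp (- a * s)) (at s within {0..T})"
    if "s \<in> {0..T}" for s
    unfolding F_def by (rule derivative_eq_intros der that refl | simp add: algebra_simps)+
  have neg: "0 \<le> b - (E' s - a * E s) * exp (- a * s)" if "s \<in> {0<..<T}" for s
  proof -
    have "(E' s - a * E s) * exp (- a * s) \<le> b * exp (- a * s)"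
      using le[of s] that by (intro mult_right_mono) auto
    also have "\<dots> \<le> b * 1" using assms that by (intro mult_left_mono) (auto simp: )
    finally show ?thesis by simp
  qed
  have "F 0 \<le> F s"
    using nonneg_deriv_within_mono[OF dF neg, of 0 s] s by auto
  then have "E s * exp (- a * s) \<le> E 0 + b * s" by (simp add: F_def)
  then have "E s * exp (- a * s) * exp (a * s) \<le> (E 0 + b * s) * exp (a * s)"
    by (intro mult_right_mono) auto
  then show ?thesis by (simp add: mult.assoc flip: exp_add)
qed

lemma abs_le_by_deriv:
  fixes f f' g g' :: "real \<Rightarrow> real"
  assumes f: "\<And>s. s \<in> {0..T} \<Longrightarrow> (f has_real_derivative f' s) (at s within {0..T})"
    and g: "\<And>s. s \<in> {0..T} \<Longrightarrow> (g has_real_derivative g' s) (at s within {0..T})"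
    and le: "\<And>s. s \<in> {0..T} \<Longrightarrow> \<bar>f' s\<bar> \<le> g' s"
    and "f 0 = 0" "g 0 = 0" and s: "s \<in> {0..T}"
  shows "\<bar>f s\<bar> \<le> g s"
proof -
  have "0 \<le> g' s - f' s" "0 \<le> g' s + f' s" if "s \<in> {0..T}" for s
    using le[OF that] by (auto simp: abs_le_iff)
  then have nn: "0 \<le> g' s - f' s" "0 \<le> g' s + f' s" if "s \<in> {0<..<T}" for s
    using that by auto
  have "(\<lambda>s. g s - f s) 0 \<le> (\<lambda>s. g s - f s) s"
    by (rule nonneg_deriv_within_mono[OF DERIV_diff[OF g f] nn(1)]) (use s in auto)
  moreover have "(\<lambda>s. g s + f s) 0 \<le> (\<lambda>s. g s + f s) s"
    by (rule nonneg_deriv_within_mono[OF DERIV_add[OF g f] nn(2)]) (use s in auto)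
  ultimately show ?thesis using assms by auto
qed

text \<open>The solution is built as a Picard series: \<open>picard \<kappa> j\<close> is the \<open>j\<close>-th iterate of the operator
  \<open>f \<mapsto> - \<integral>\<integral> \<kappa> f\<close> on the identity. The first derivatives are iterated along with
  it because the series has to be differentiated termwise twice.\<close>

fun picard_deriv :: "(real \<Rightarrow> real) \<Rightarrow> nat \<Rightarrow> real \<Rightarrow> real"
  and picard :: "(real \<Rightarrow> real) \<Rightarrow> nat \<Rightarrow> real \<Rightarrow> real" where
  "picard_deriv \<kappa> 0 s = 1"
| "picard_deriv \<kappa> (Suc j) s = integral {0..s} (\<lambda>r. - (\<kappa> r * picard \<kappa> j r))"
| "picard \<kappa> 0 s = s"
| "picard \<kappa> (Suc j) s = integral {0..s} (picard_deriv \<kappa> (Suc j))"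

lemma picard_derivatives:
  assumes \<kappa>: "continuous_on {0..T} \<kappa>"
  shows "(\<forall>s\<in>{0..T}. (picard \<kappa> j has_real_derivative picard_deriv \<kappa> j s) (at s within {0..T})) \<and>
    (\<forall>s\<in>{0..T}. (picard_deriv \<kappa> (Suc j) has_real_derivative - (\<kappa> s * picard \<kappa> j s)) (at s within {0..T}))"
proof (induction j)
  case 0
  have "(picard \<kappa> 0 has_real_derivative 1) (at s within {0..T})" for s
  proof -
    have "picard \<kappa> 0 = (\<lambda>s. s)" by (rule ext) simp
    then show ?thesis by (simp only: DERIV_ident)
  qed
  moreover have "picard_deriv \<kappa> (Suc 0) = (\<lambda>s. integral {0..s} (\<lambda>r. - (\<kappa> r * picard \<kappa> 0 r)))"
    by (rule ext) (simp only: picard_deriv.simps)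
  moreover have "continuous_on {0..T} (\<lambda>r. - (\<kappa> r * picard \<kappa> 0 r))"
    by (simp, intro continuous_intros \<kappa>)
  ultimately show ?case
    by (simp only: picard_deriv.simps) (blast intro: integral_has_real_derivative)
next
  case (Suc j)
  have 1: "picard \<kappa> (Suc j) = (\<lambda>s. integral {0..s} (picard_deriv \<kappa> (Suc j)))"
    by (rule ext, rule picard.simps)
  have 2: "picard_deriv \<kappa> (Suc (Suc j)) = (\<lambda>s. integral {0..s} (\<lambda>r. - (\<kappa> r * picard \<kappa> (Suc j) r)))"
    by (rule ext, rule picard_deriv.simps)
  have c: "continuous_on {0..T} (picard_deriv \<kappa> (Suc j))"
    using Suc by (intro DERIV_continuous_on[where D = "\<lambda>s. - (\<kappa> s * picard \<kappa> j s)"]) blast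
  have a: "\<forall>s\<in>{0..T}. (picard \<kappa> (Suc j) has_real_derivative picard_deriv \<kappa> (Suc j) s) (at s within {0..T})"
    unfolding 1 by (intro ballI integral_has_real_derivative c)
  then have "continuous_on {0..T} (picard \<kappa> (Suc j))"
    by (intro DERIV_continuous_on[where D = "picard_deriv \<kappa> (Suc j)"]) blast
  then have "continuous_on {0..T} (\<lambda>s. - (\<kappa> s * picard \<kappa> (Suc j) s))"
    by (intro continuous_on_minus continuous_on_mult \<kappa>)
  then have "\<forall>s\<in>{0..T}. (picard_deriv \<kappa> (Suc (Suc j)) has_real_derivative
      - (\<kappa> s * picard \<kappa> (Suc j) s)) (at s within {0..T})"
    unfolding 2 by (intro ballI integral_has_real_derivative)
  with a show ?case by (rule conjI)
qed

text \<open>The majorants are the terms of the power series of \<open>sinh (sqrt c * s) / sqrt c\<close> and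
  \<open>cosh (sqrt c * s)\<close>, the solution for the constant coefficient \<open>- c\<close> and its derivative; one step of the
  iteration maps the majorants to the next ones.\<close>

lemma picard_bounds:
  assumes \<kappa>: "continuous_on {0..T} \<kappa>" and c: "\<And>s. s \<in> {0..T} \<Longrightarrow> \<bar>\<kappa> s\<bar> \<le> c"
  shows "(\<forall>s\<in>{0..T}. \<bar>picard \<kappa> j s\<bar> \<le> c ^ j * (s ^ (2*j+1) / fact (2*j+1))) \<and>
    (\<forall>s\<in>{0..T}. \<bar>picard_deriv \<kappa> j s\<bar> \<le> c ^ j * (s ^ (2*j) / fact (2*j)))"
proof (induction j)
  case 0
  show ?case by auto
next
  case (Suc j)
  have e: "2 * Suc j = Suc (2 * j + 1)" by simp
  have pw: "((\<lambda>s. d * (s ^ Suc n / fact (Suc n))) has_real_derivative d * (s ^ n / fact n)) (at s within {0..T})"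
    for d s :: real and n
  proof -
    have "real (Suc n) * s ^ n / fact (Suc n) = s ^ n / fact n"
      by (simp add: fact_Suc field_simps del: of_nat_Suc)
    then have "d * (real (Suc n) * s ^ n / fact (Suc n)) = d * (s ^ n / fact n)" by (simp only:)
    then show ?thesis
      by (auto intro!: derivative_eq_intros simp del: fact_Suc of_nat_Suc power_Suc simp: mult_ac)
  qed
  have a: "\<bar>picard_deriv \<kappa> (Suc j) s\<bar> \<le> c ^ Suc j * (s ^ Suc (2*j+1) / fact (Suc (2*j+1)))" if "s \<in> {0..T}" for s
  proof (rule abs_le_by_deriv[OF _ pw _ _ _ that])
    fix s assume s: "s \<in> {0..T}"
    show "(picard_deriv \<kappa> (Suc j) has_real_derivative - (\<kappa> s * picard \<kappa> j s)) (at s within {0..T})"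
      using picard_derivatives[OF \<kappa>] s by blast
    have "\<bar>\<kappa> s\<bar> * \<bar>picard \<kappa> j s\<bar> \<le> c * (c ^ j * (s ^ (2*j+1) / fact (2*j+1)))"
      using Suc s c[OF s] by (intro mult_mono) auto
    then show "\<bar>- (\<kappa> s * picard \<kappa> j s)\<bar> \<le> c ^ Suc j * (s ^ (2*j+1) / fact (2*j+1))"
      by (simp add: abs_mult mult.assoc)
  qed (simp_all del: fact_Suc)
  have "\<bar>picard \<kappa> (Suc j) s\<bar> \<le> c ^ Suc j * (s ^ Suc (2 * Suc j) / fact (Suc (2 * Suc j)))" if "s \<in> {0..T}" for s
  proof (rule abs_le_by_deriv[OF _ pw _ _ _ that])
    fix s assume s: "s \<in> {0..T}"
    show "(picard \<kappa> (Suc j) has_real_derivative picard_deriv \<kappa> (Suc j) s) (at s within {0..T})"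
      using picard_derivatives[OF \<kappa>] s by blast
    show "\<bar>picard_deriv \<kappa> (Suc j) s\<bar> \<le> c ^ Suc j * (s ^ (2 * Suc j) / fact (2 * Suc j))"
      using a[OF s] unfolding e .
  qed (simp_all del: fact_Suc)
  then have "\<forall>s\<in>{0..T}. \<bar>picard \<kappa> (Suc j) s\<bar> \<le> c ^ Suc j * (s ^ (2 * Suc j + 1) / fact (2 * Suc j + 1))"
    unfolding Suc_eq_plus1 by blast
  moreover have "\<forall>s\<in>{0..T}. \<bar>picard_deriv \<kappa> (Suc j) s\<bar> \<le> c ^ Suc j * (s ^ (2 * Suc j) / fact (2 * Suc j))"
    unfolding e by (intro ballI a)
  ultimately show ?case by (rule conjI)
qed

text \<open>The Picard series and the series of its first and second derivatives are dominated by an exponential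
  series, so they converge uniformly and may be differentiated termwise; the second derivatives add
  up to \<open>- \<kappa>\<close> times the sum.\<close>

lemma sine_solution_exists:
  assumes \<kappa>: "continuous_on {0..T} \<kappa>" and T: "0 \<le> T"
  shows "\<exists>u. sine_solution \<kappa> T u"
proof -
  have "compact (\<kappa> ` {0..T})" using \<kappa> by (intro compact_continuous_image) auto
  then obtain c where c: "\<And>s. s \<in> {0..T} \<Longrightarrow> \<bar>\<kappa> s\<bar> \<le> c"
    using compact_imp_bounded[of "\<kappa> ` {0..T}"] by (force simp: bounded_iff)
  have c0: "0 \<le> c" using c[of 0] T by auto
  define b where "b = (\<lambda>j. (c * T\<^sup>2) ^ j / fact j)"
  have sb: "summable b" unfolding b_def using summable_exp[of "c * T\<^sup>2"] by (simp add: divide_inverse mult.commute)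
  have pw: "c ^ j * (s ^ (2*j) / fact (2*j)) \<le> b j" if "s \<in> {0..T}" for s j
  proof -
    have "s ^ (2*j) / fact (2*j) \<le> T ^ (2*j) / fact j"
      using that T by (intro frac_le power_mono fact_mono) auto
    then show ?thesis using c0 unfolding b_def power_mult_distrib power_mult[symmetric]
      by (simp add: mult_left_mono flip: times_divide_eq_right)
  qed
  have w: "\<bar>picard_deriv \<kappa> j s\<bar> \<le> b j" if "s \<in> {0..T}" for s j
    using picard_bounds[OF \<kappa> c] pw[OF that] that order_trans by blast
  have v: "\<bar>picard \<kappa> j s\<bar> \<le> T * b j" if s: "s \<in> {0..T}" for s j
  proof -
    have "c ^ j * (s ^ (2*j+1) / fact (2*j+1)) \<le> c ^ j * (T * (s ^ (2*j) / fact (2*j)))"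
    proof (intro mult_left_mono)
      have "s * s ^ (2*j) / fact (2*j+1) \<le> T * s ^ (2*j) / fact (2*j)"
        using s T by (intro frac_le mult_right_mono fact_mono) auto
      then show "s ^ (2*j+1) / fact (2*j+1) \<le> T * (s ^ (2*j) / fact (2*j))" by simp
    qed (use c0 in auto)
    also have "\<dots> = T * (c ^ j * (s ^ (2*j) / fact (2*j)))" by simp
    also have "\<dots> \<le> T * b j" by (rule mult_left_mono[OF pw[OF s] T])
    finally show ?thesis using picard_bounds[OF \<kappa> c] s order_trans by blast
  qed
  define dw where "dw j s = (case j of 0 \<Rightarrow> 0 | Suc i \<Rightarrow> - (\<kappa> s * picard \<kappa> i s))" for j s
  have dw: "\<bar>dw j s\<bar> \<le> (case j of 0 \<Rightarrow> 0 | Suc i \<Rightarrow> c * (T * b i))" if "s \<in> {0..T}" for s j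
    using mult_mono[OF c[OF that] v[OF that]] c0 by (auto simp: dw_def abs_mult split: nat.split)
  have U1: "uniform_limit {0..T} (\<lambda>n s. \<Sum>i<n. picard_deriv \<kappa> i s) (\<lambda>s. \<Sum>i. picard_deriv \<kappa> i s) sequentially"
    using w sb by (intro Weierstrass_m_test[where M = b]) auto
  have U2: "uniform_limit {0..T} (\<lambda>n s. \<Sum>i<n. dw i s) (\<lambda>s. \<Sum>i. dw i s) sequentially"
  proof (intro Weierstrass_m_test[where M = "\<lambda>j. case j of 0 \<Rightarrow> 0 | Suc i \<Rightarrow> c * (T * b i)"])
    show "summable (\<lambda>j. case j of 0 \<Rightarrow> 0 | Suc i \<Rightarrow> c * (T * b i))"
      by (subst summable_Suc_iff[symmetric]) (simp add: sb summable_mult)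
  qed (use dw in auto)
  have s0: "summable (\<lambda>j. picard \<kappa> j 0)" "summable (\<lambda>j. picard_deriv \<kappa> j 0)"
  proof -
    have "(\<lambda>j. picard \<kappa> (Suc j) 0) = (\<lambda>_. 0)" "(\<lambda>j. picard_deriv \<kappa> (Suc j) 0) = (\<lambda>_. 0)"
      by auto
    then show "summable (\<lambda>j. picard \<kappa> j 0)" "summable (\<lambda>j. picard_deriv \<kappa> j 0)"
      using summable_Suc_iff[of "\<lambda>j. picard \<kappa> j 0"] summable_Suc_iff[of "\<lambda>j. picard_deriv \<kappa> j 0"]
      by (simp_all only: summable_zero)
  qed
  have z: "0 \<in> {0..T}" using T by auto
  obtain u where u: "\<And>s. s \<in> {0..T} \<Longrightarrow> (\<lambda>j. picard \<kappa> j s) sums u s"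
    "\<And>s. s \<in> {0..T} \<Longrightarrow> (u has_real_derivative (\<Sum>i. picard_deriv \<kappa> i s)) (at s within {0..T})"
    using has_field_derivative_series[where f = "picard \<kappa>" and f' = "picard_deriv \<kappa>", OF convex_real_interval(5)[of 0 T] _ U1 z s0(1)] picard_derivatives[OF \<kappa>] by blast
  have "(picard_deriv \<kappa> j has_real_derivative dw j s) (at s within {0..T})" if "s \<in> {0..T}" for j s
  proof (cases j)
    case 0
    have "picard_deriv \<kappa> 0 = (\<lambda>_. 1)" by auto
    then show ?thesis by (simp add: 0 dw_def)
  next
    case (Suc i)
    then show ?thesis using picard_derivatives[OF \<kappa>] that by (simp add: dw_def del: picard_deriv.simps)
  qed
  from has_field_derivative_series[where f = "picard_deriv \<kappa>" and f' = dw, OF convex_real_interval(5)[of 0 T] this U2 z s0(2)]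
  obtain w where w: "\<And>s. s \<in> {0..T} \<Longrightarrow> (\<lambda>j. picard_deriv \<kappa> j s) sums w s"
    "\<And>s. s \<in> {0..T} \<Longrightarrow> (w has_real_derivative (\<Sum>i. dw i s)) (at s within {0..T})"
    by blast
  have sdw: "(\<Sum>i. dw i s) = - (\<kappa> s * u s)" if "s \<in> {0..T}" for s
  proof -
    have "(\<lambda>i. dw (Suc i) s) sums (- (\<kappa> s * u s))"
      using sums_minus[OF sums_mult[OF u(1)[OF that], of "\<kappa> s"]] by (simp add: dw_def)
    then have "(\<lambda>i. dw i s) sums (- (\<kappa> s * u s) + dw 0 s)" by (rule sums_Suc)
    then show ?thesis by (simp add: sums_iff dw_def)
  qed
  have "u 0 = 0"
  proof -
    have "(\<lambda>j. picard \<kappa> j 0) = (\<lambda>_. 0)"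
    proof
      fix j show "picard \<kappa> j 0 = 0" by (cases j) auto
    qed
    then show ?thesis using u(1)[OF z] sums_unique2[OF sums_zero] by metis
  qed
  moreover have "w 0 = 1"
  proof -
    have "(\<lambda>j. picard_deriv \<kappa> (Suc j) 0) sums 0" by simp
    from sums_Suc[OF this] show ?thesis using w(1)[OF z] sums_unique2 by fastforce
  qed
  ultimately have "sine_solution \<kappa> T u"
    unfolding sine_solution_def using u(2) w sdw by (intro exI[of _ w]) (auto simp: sums_iff)
  then show "\<exists>u. sine_solution \<kappa> T u" by blast
qed

lemma sine_is_solution:
  assumes "continuous_on {0..T} \<kappa>" "0 \<le> T"
  shows "sine_solution \<kappa> T (sine \<kappa> T)"
  unfolding sine_def by (rule someI_ex[OF sine_solution_exists[OF assms]])


text \<open>The energy \<open>u\<^sup>2 + u'\<^sup>2\<close> starts at \<open>1\<close> and has logarithmic derivative at most \<open>1 + C\<close>.\<close>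

lemma sine_solution_bound:
  assumes sol: "sine_solution \<kappa> T u" and C: "\<And>s. s \<in> {0..T} \<Longrightarrow> \<bar>\<kappa> s\<bar> \<le> C"
    and s: "s \<in> {0..T}"
  shows "\<bar>u s\<bar> \<le> exp ((1 + C) * T)"
proof -
  obtain u' where u': "u 0 = 0" "u' 0 = 1"
    and d: "\<And>s. s \<in> {0..T} \<Longrightarrow> (u has_real_derivative u' s) (at s within {0..T})"
      "\<And>s. s \<in> {0..T} \<Longrightarrow> (u' has_real_derivative - (\<kappa> s * u s)) (at s within {0..T})"
    using sol by (auto simp: sine_solution_def)
  define E where "E = (\<lambda>s. (u s)\<^sup>2 + (u' s)\<^sup>2)"
  have dE: "(E has_real_derivative 2 * u s * u' s * (1 - \<kappa> s)) (at s within {0..T})" if "s \<in> {0..T}" for s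
    unfolding E_def using that
    by (auto intro!: derivative_eq_intros d simp: algebra_simps)
  have "2 * u s * u' s * (1 - \<kappa> s) \<le> (1 + C) * E s + 0" if "s \<in> {0..T}" for s
  proof -
    have "2 * u s * u' s * (1 - \<kappa> s) \<le> \<bar>2 * u s * u' s\<bar> * \<bar>1 - \<kappa> s\<bar>"
      by (metis abs_ge_self abs_mult)
    also have "\<dots> \<le> E s * (1 + C)"
    proof (rule mult_mono)
      show "\<bar>2 * u s * u' s\<bar> \<le> E s"
        using sum_squares_bound[of "u s" "u' s"] sum_squares_bound[of "- u s" "u' s"]
        by (auto simp: E_def abs_if)
    qed (use C[OF that] in \<open>auto simp: E_def\<close>)
    finally show ?thesis by (simp add: mult.commute)
  qed
  moreover have C0: "0 \<le> C" using C[OF s] by auto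
  ultimately have "E s \<le> (E 0 + 0 * s) * exp ((1 + C) * s)"
    by (intro gronwall_affine[OF dE _ _ _ s]) auto
  also have "\<dots> \<le> exp ((1 + C) * T)"
    using s C0 by (auto simp: E_def u' mult_left_mono)
  finally have "(u s)\<^sup>2 \<le> exp ((1 + C) * T)" unfolding E_def using zero_le_power2[of "u' s"] by linarith
  also have "\<dots> \<le> (exp ((1 + C) * T))\<^sup>2"
    using C0 s by (simp add: power2_eq_square)
  finally show ?thesis by (simp add: abs_le_square_iff[symmetric])
qed

text \<open>A Lipschitz constant for the dependence of the solution on the coefficient: the first factor bounds
  the solution itself, the other two come from Gronwall's inequality for the difference, rounded up so
  that no square roots occur.\<close>

definition sine_stability :: "real \<Rightarrow> real \<Rightarrow> real" where
  "sine_stability C T = exp ((1 + C) * T) * (1 + T) * exp ((2 + C) * T)"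

text \<open>The difference of the solutions solves the first equation with the source \<open>(\<kappa>2 - \<kappa>1) * u2\<close>, so
  its energy grows from \<open>0\<close> at a rate controlled by \<open>\<eta>\<^sup>2\<close>.\<close>

lemma sine_solution_stability:
  assumes sol1: "sine_solution \<kappa>1 T u1" and sol2: "sine_solution \<kappa>2 T u2"
    and C1: "\<And>s. s \<in> {0..T} \<Longrightarrow> \<bar>\<kappa>1 s\<bar> \<le> C" and C2: "\<And>s. s \<in> {0..T} \<Longrightarrow> \<bar>\<kappa>2 s\<bar> \<le> C"
    and \<eta>: "\<And>s. s \<in> {0..T} \<Longrightarrow> \<bar>\<kappa>1 s - \<kappa>2 s\<bar> \<le> \<eta>"
    and s: "s \<in> {0..T}"
  shows "\<bar>u1 s - u2 s\<bar> \<le> \<eta> * sine_stability C T"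
proof -
  obtain u1' where u1': "u1 0 = 0" "u1' 0 = 1"
    and d1: "\<And>s. s \<in> {0..T} \<Longrightarrow> (u1 has_real_derivative u1' s) (at s within {0..T})"
      "\<And>s. s \<in> {0..T} \<Longrightarrow> (u1' has_real_derivative - (\<kappa>1 s * u1 s)) (at s within {0..T})"
    using sol1 by (auto simp: sine_solution_def)
  obtain u2' where u2': "u2 0 = 0" "u2' 0 = 1"
    and d2: "\<And>s. s \<in> {0..T} \<Longrightarrow> (u2 has_real_derivative u2' s) (at s within {0..T})"
      "\<And>s. s \<in> {0..T} \<Longrightarrow> (u2' has_real_derivative - (\<kappa>2 s * u2 s)) (at s within {0..T})"
    using sol2 by (auto simp: sine_solution_def)
  define B where "B = exp ((1 + C) * T)"
  define w where "w = (\<lambda>s. u1 s - u2 s)"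
  define w' where "w' = (\<lambda>s. u1' s - u2' s)"
  define E where "E = (\<lambda>s. (w s)\<^sup>2 + (w' s)\<^sup>2)"
  define e where "e = (\<lambda>s. (\<kappa>1 s - \<kappa>2 s) * u2 s)"
  have dE: "(E has_real_derivative 2 * w s * w' s * (1 - \<kappa>1 s) - 2 * w' s * e s) (at s within {0..T})"
    if "s \<in> {0..T}" for s
    unfolding E_def w_def w'_def e_def using that
    by (auto intro!: derivative_eq_intros d1 d2 simp: algebra_simps)
  have C0: "0 \<le> C" and \<eta>0: "0 \<le> \<eta>" using C1[OF s] \<eta>[OF s] by auto
  have "2 * w s * w' s * (1 - \<kappa>1 s) - 2 * w' s * e s \<le> (2 + C) * E s + \<eta>\<^sup>2 * B\<^sup>2" if "s \<in> {0..T}" for s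
  proof -
    have "2 * w s * w' s * (1 - \<kappa>1 s) \<le> \<bar>2 * w s * w' s\<bar> * \<bar>1 - \<kappa>1 s\<bar>"
      by (metis abs_ge_self abs_mult)
    also have "\<dots> \<le> E s * (1 + C)"
    proof (rule mult_mono)
      show "\<bar>2 * w s * w' s\<bar> \<le> E s"
        using sum_squares_bound[of "w s" "w' s"] sum_squares_bound[of "- w s" "w' s"]
        by (auto simp: E_def abs_if)
    qed (use C1[OF that] in \<open>auto simp: E_def\<close>)
    finally have 1: "2 * w s * w' s * (1 - \<kappa>1 s) \<le> (1 + C) * E s" by (simp add: mult.commute)
    have "- (2 * w' s * e s) \<le> (w' s)\<^sup>2 + (e s)\<^sup>2"
      using sum_squares_bound[of "- w' s" "e s"] by simp
    moreover have "(w' s)\<^sup>2 \<le> E s" by (simp add: E_def)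
    moreover have "\<bar>e s\<bar> \<le> \<eta> * B"
      unfolding e_def abs_mult B_def
      using \<eta>[OF that] sine_solution_bound[OF sol2 C2 that] \<eta>0 by (intro mult_mono) auto
    then have "(e s)\<^sup>2 \<le> \<eta>\<^sup>2 * B\<^sup>2"
      by (metis abs_ge_zero power2_abs power_mono power_mult_distrib)
    ultimately show ?thesis using 1 by (simp add: algebra_simps)
  qed
  then have "E s \<le> (E 0 + \<eta>\<^sup>2 * B\<^sup>2 * s) * exp ((2 + C) * s)"
    using C0 by (intro gronwall_affine[OF dE _ _ _ s]) auto
  also have "\<dots> \<le> (0 + \<eta>\<^sup>2 * B\<^sup>2 * (1 + T)\<^sup>2) * (exp ((2 + C) * T))\<^sup>2"
  proof (intro mult_mono add_mono)
    have "s \<le> 1 + T" using s by auto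
    also have "\<dots> \<le> (1 + T)\<^sup>2" using s by (intro self_le_power) auto
    finally show "s \<le> (1 + T)\<^sup>2" .
    have "exp ((2 + C) * s) \<le> exp ((2 + C) * T)" using s C0 by (simp add: mult_left_mono)
    also have "\<dots> \<le> (exp ((2 + C) * T))\<^sup>2" using s C0 by (intro self_le_power) auto
    finally show "exp ((2 + C) * s) \<le> (exp ((2 + C) * T))\<^sup>2" .
  qed (use s in \<open>auto simp: E_def w_def w'_def u1' u2'\<close>)
  also have "\<dots> = (\<eta> * sine_stability C T)\<^sup>2"
    by (simp add: sine_stability_def B_def power_mult_distrib)
  finally have "(w s)\<^sup>2 \<le> (\<eta> * sine_stability C T)\<^sup>2"
    unfolding E_def using zero_le_power2[of "w' s"] by linarith
  moreover have "0 \<le> \<eta> * sine_stability C T"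
    using \<eta>0 s by (auto simp: sine_stability_def)
  ultimately show ?thesis unfolding w_def by (metis abs_le_square_iff abs_of_nonneg)
qed

lemma sine_solution_unique:
  assumes "sine_solution \<kappa> T u1" "sine_solution \<kappa> T u2" "continuous_on {0..T} \<kappa>" "s \<in> {0..T}"
  shows "u1 s = u2 s"
proof -
  have "compact (\<kappa> ` {0..T})" using assms by (intro compact_continuous_image) auto
  then obtain C where C: "\<And>s. s \<in> {0..T} \<Longrightarrow> \<bar>\<kappa> s\<bar> \<le> C"
    using compact_imp_bounded[of "\<kappa> ` {0..T}"] by (force simp: bounded_iff)
  have "\<bar>u1 s - u2 s\<bar> \<le> 0 * sine_stability C T"
    by (rule sine_solution_stability[OF assms(1,2) C C]) (use assms in auto)
  then show ?thesis by simp
qed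

lemma sine_solution_cong_subinterval:
  assumes "sine_solution \<kappa> T u" "T' \<le> T" "\<And>s. s \<in> {0..T'} \<Longrightarrow> \<kappa>' s = \<kappa> s"
  shows "sine_solution \<kappa>' T' u"
proof -
  obtain u' where "u 0 = 0" "u' 0 = 1"
    and d: "\<And>s. s \<in> {0..T} \<Longrightarrow> (u has_real_derivative u' s) (at s within {0..T})"
      "\<And>s. s \<in> {0..T} \<Longrightarrow> (u' has_real_derivative - (\<kappa> s * u s)) (at s within {0..T})"
    using assms(1) by (auto simp: sine_solution_def)
  moreover have "{0..T'} \<subseteq> {0..T}" using assms by auto
  ultimately show ?thesis
    unfolding sine_solution_def using assms(3)
    by (intro exI[of _ u']) (auto intro: DERIV_subset[OF _ \<open>{0..T'} \<subseteq> {0..T}\<close>])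
qed

lemma sine_restrict:
  assumes "continuous_on {0..T} \<kappa>" "T' \<le> T" "s \<in> {0..T'}"
  shows "sine \<kappa> T' s = sine \<kappa> T s"
proof -
  have c: "continuous_on {0..T'} \<kappa>" using assms by (auto intro: continuous_on_subset)
  show ?thesis
    using assms
    by (intro sine_solution_unique[OF sine_is_solution[OF c]
        sine_solution_cong_subinterval[OF sine_is_solution[OF assms(1)]] c]) auto
qed

lemma sine_continuous:
  assumes "continuous_on {0..T} \<kappa>" "0 \<le> T"
  shows "continuous_on {0..T} (sine \<kappa> T)"
  using sine_is_solution[OF assms] unfolding sine_solution_def by (metis DERIV_continuous_on)

lemma sine_quotient_limit:
  assumes sol: "sine_solution \<kappa> T u" and T: "0 < T"
  shows "((\<lambda>s. u s / s) \<longlongrightarrow> 1) (at_right 0)"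
proof -
  obtain u' where "u 0 = 0" "u' 0 = 1"
    and d: "\<And>s. s \<in> {0..T} \<Longrightarrow> (u has_real_derivative u' s) (at s within {0..T})"
    using sol by (auto simp: sine_solution_def)
  with T have "(u has_real_derivative 1) (at 0 within {0..T})" by (metis atLeastAtMost_iff less_imp_le order_refl)
  then have "((\<lambda>s. (u s - u 0) / (s - 0)) \<longlongrightarrow> 1) (at 0 within {0..T})"
    by (simp only: has_field_derivative_iff)
  then show ?thesis using \<open>u 0 = 0\<close> T at_within_Icc_at_right[of 0 T] by simp
qed

text \<open>The derivative of \<open>u1 / u2\<close> is \<open>W / u2\<^sup>2\<close> with the Wronskian \<open>W = u1' * u2 - u1 * u2'\<close>, which
  starts at \<open>0\<close> and has the derivative \<open>(\<kappa>2 - \<kappa>1) * u1 * u2\<close>.\<close>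

lemma sturm_ratio_mono_aux:
  assumes sol1: "sine_solution \<kappa>1 T u1" and sol2: "sine_solution \<kappa>2 T u2"
    and le: "\<And>s. s \<in> {0..T} \<Longrightarrow> \<kappa>1 s \<le> \<kappa>2 s"
    and pos1: "\<And>s. s \<in> {0<..<z} \<Longrightarrow> 0 < u1 s"
    and pos2: "\<And>s. s \<in> {0<..z} \<Longrightarrow> 0 < u2 s"
    and z: "z \<le> T" and pq: "0 < p" "p \<le> q" "q \<le> z"
  shows "u1 p / u2 p \<le> u1 q / u2 q"
proof -
  obtain u1' where u1': "u1 0 = 0" "u1' 0 = 1"
    and d1: "\<And>s. s \<in> {0..T} \<Longrightarrow> (u1 has_real_derivative u1' s) (at s within {0..T})"
      "\<And>s. s \<in> {0..T} \<Longrightarrow> (u1' has_real_derivative - (\<kappa>1 s * u1 s)) (at s within {0..T})"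
    using sol1 by (auto simp: sine_solution_def)
  obtain u2' where u2': "u2 0 = 0" "u2' 0 = 1"
    and d2: "\<And>s. s \<in> {0..T} \<Longrightarrow> (u2 has_real_derivative u2' s) (at s within {0..T})"
      "\<And>s. s \<in> {0..T} \<Longrightarrow> (u2' has_real_derivative - (\<kappa>2 s * u2 s)) (at s within {0..T})"
    using sol2 by (auto simp: sine_solution_def)
  define W where "W = (\<lambda>s. u1' s * u2 s - u1 s * u2' s)"
  have sub: "{0..z} \<subseteq> {0..T}" using z by auto
  have dW: "(W has_real_derivative (\<kappa>2 s - \<kappa>1 s) * (u1 s * u2 s)) (at s within {0..z})" if "s \<in> {0..z}" for s
  proof -
    have "s \<in> {0..T}" using that z by auto
    then have "(W has_real_derivative (\<kappa>2 s - \<kappa>1 s) * (u1 s * u2 s)) (at s within {0..T})"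
      unfolding W_def by (auto intro!: derivative_eq_intros d1 d2 simp: algebra_simps)
    then show ?thesis by (rule DERIV_subset[OF _ sub])
  qed
  have W: "0 \<le> W s" if "s \<in> {0..z}" for s
  proof -
    have "W 0 \<le> W s"
      by (rule nonneg_deriv_within_mono[OF dW])
        (use that pq z le pos1 pos2 in \<open>auto intro!: mult_nonneg_nonneg less_imp_le[OF pos1] less_imp_le[OF pos2]\<close>)
    then show ?thesis by (simp add: W_def u1' u2')
  qed
  have dq: "((\<lambda>s. u1 s / u2 s) has_real_derivative W s / (u2 s)\<^sup>2) (at s within {p..z})" if s: "s \<in> {p..z}" for s
  proof -
    have s: "s \<in> {0..T}" and "{p..z} \<subseteq> {0..T}" using that pq z by auto
    moreover have "u2 s \<noteq> 0" using pos2[of s] that pq by auto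
    then have "((\<lambda>s. u1 s / u2 s) has_real_derivative W s / (u2 s)\<^sup>2) (at s within {0..T})"
      unfolding W_def by (auto intro!: derivative_eq_intros d1 d2 s simp: power2_eq_square)
    ultimately show ?thesis using DERIV_subset by blast
  qed
  show ?thesis
    by (rule nonneg_deriv_within_mono[OF dq]) (use W pq in auto)
qed

text \<open>Both solutions are asymptotic to \<open>s\<close> at \<open>0\<close>, so their increasing ratio starts at \<open>1\<close>.\<close>

lemma sturm_ge_aux:
  assumes sol1: "sine_solution \<kappa>1 T u1" and sol2: "sine_solution \<kappa>2 T u2"
    and le: "\<And>s. s \<in> {0..T} \<Longrightarrow> \<kappa>1 s \<le> \<kappa>2 s"
    and pos1: "\<And>s. s \<in> {0<..<z} \<Longrightarrow> 0 < u1 s"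
    and pos2: "\<And>s. s \<in> {0<..z} \<Longrightarrow> 0 < u2 s"
    and z: "0 < z" "z \<le> T"
  shows "u2 z \<le> u1 z"
proof -
  have "0 < T" using z by simp
  have "((\<lambda>s. (u1 s / s) / (u2 s / s)) \<longlongrightarrow> 1 / 1) (at_right 0)"
    by (intro tendsto_divide sine_quotient_limit[OF sol1] sine_quotient_limit[OF sol2] \<open>0 < T\<close>) auto
  moreover have "\<forall>\<^sub>F s in at_right 0. (u1 s / s) / (u2 s / s) \<le> u1 z / u2 z"
    using eventually_at_right_less[of "0::real"] eventually_at_right_real[OF \<open>0 < z\<close>]
  proof eventually_elim
    case (elim s)
    then have "(u1 s / s) / (u2 s / s) = u1 s / u2 s" by simp
    then show ?case
      using sturm_ratio_mono_aux[OF sol1 sol2 le pos1 pos2, of z s z] elim z by auto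
  qed
  ultimately have "1 / 1 \<le> u1 z / u2 z"
    by (rule tendsto_upperbound) simp
  then show ?thesis using pos2[of z] z by (simp add: field_simps)
qed

lemma sine_positive_near_zero:
  assumes sol: "sine_solution \<kappa> T u" and T: "0 < T"
  shows "\<exists>d>0. d \<le> T \<and> (\<forall>s\<in>{0<..<d}. 0 < u s)"
proof -
  have "\<forall>\<^sub>F s in at_right 0. 0 < u s / s"
    using order_tendstoD(1)[OF sine_quotient_limit[OF assms], of 0] by simp
  then obtain b where "b > 0" "\<And>s. 0 < s \<Longrightarrow> s < b \<Longrightarrow> 0 < u s / s"
    by (auto simp: eventually_at_right_field)
  then show ?thesis using T
    by (intro exI[of _ "min b T"]) (auto simp: zero_less_divide_iff)
qed

text \<open>As long as \<open>u1\<close> is positive, the ratio \<open>u1 / u2\<close> increases from \<open>1\<close>. Hence at its first zero \<open>u1\<close>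
  would be at least \<open>u2\<close>, so it has no zero before \<open>T\<close>. The second conclusion states the
  monotonicity of the ratio without division; it makes the distortion coefficients monotone in the
  curvature.\<close>

theorem sturm_comparison:
  assumes sol1: "sine_solution \<kappa>1 T u1" and sol2: "sine_solution \<kappa>2 T u2"
    and le: "\<And>s. s \<in> {0..T} \<Longrightarrow> \<kappa>1 s \<le> \<kappa>2 s"
    and pos2: "\<And>s. s \<in> {0<..<T} \<Longrightarrow> 0 < u2 s"
  shows "\<And>s. s \<in> {0..T} \<Longrightarrow> u2 s \<le> u1 s"
    and "\<And>s s'. 0 \<le> s \<Longrightarrow> s \<le> s' \<Longrightarrow> s' \<le> T \<Longrightarrow> u1 s * u2 s' \<le> u1 s' * u2 s"
proof -
  have z0: "u1 0 = 0" "u2 0 = 0" using sol1 sol2 by (auto simp: sine_solution_def)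
  have c1: "continuous_on {0..T} u1" and c2: "continuous_on {0..T} u2"
    using sol1 sol2 unfolding sine_solution_def by (metis DERIV_continuous_on)+
  have pos1: "0 < u1 s" if s: "s \<in> {0<..<T}" for s
  proof (rule ccontr)
    assume "\<not> 0 < u1 s"
    obtain d where d: "d > 0" "d \<le> T" "\<And>r. r \<in> {0<..<d} \<Longrightarrow> 0 < u1 r"
      using sine_positive_near_zero[OF sol1] s by auto
    \<comment> \<open>The least element of \<open>Z\<close> is the first zero of \<open>u1\<close>.\<close>
    define Z where "Z = {r \<in> {d..s}. u1 r \<le> 0}"
    have "s \<in> Z" using \<open>\<not> 0 < u1 s\<close> d(3)[of s] s by (force simp: Z_def)
    have "continuous_on {d..s} u1" using s d by (intro continuous_on_subset[OF c1]) auto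
    then have "closed ({d..s} \<inter> u1 -` {..0})" by (rule continuous_closed_preimage) auto
    also have "{d..s} \<inter> u1 -` {..0} = Z" by (auto simp: Z_def)
    finally have "closed Z" .
    then have "compact Z"
      unfolding compact_eq_bounded_closed by (auto intro: bounded_subset[of "{d..s}"] simp: Z_def)
    then obtain z where z: "z \<in> Z" "\<And>r. r \<in> Z \<Longrightarrow> z \<le> r"
      using compact_attains_inf[of Z] \<open>s \<in> Z\<close> by blast
    have "0 < u1 r" if "r \<in> {0<..<z}" for r
    proof (rule ccontr)
      assume "\<not> 0 < u1 r"
      then have "r \<in> Z" using d(3)[of r] that z(1) by (force simp: Z_def)
      then show False using z(2)[of r] that by auto
    qed
    then have "u2 z \<le> u1 z"
      using z(1) s d by (intro sturm_ge_aux[OF sol1 sol2 le _ pos2]) (auto simp: Z_def)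
    moreover have "0 < u2 z" using z(1) s d by (intro pos2) (auto simp: Z_def)
    ultimately show False using z(1) by (auto simp: Z_def)
  qed
  have ge: "u2 s \<le> u1 s" if "s \<in> {0<..<T}" for s
    using that pos1 pos2 by (intro sturm_ge_aux[OF sol1 sol2 le]) auto
  have mono: "u1 s * u2 s' \<le> u1 s' * u2 s" if "0 < s" "s \<le> s'" "s' < T" for s s'
  proof -
    have "u1 s / u2 s \<le> u1 s' / u2 s'"
      by (rule sturm_ratio_mono_aux[OF sol1 sol2 le, of s']) (use that pos1 pos2 in auto)
    then show ?thesis using pos2[of s] pos2[of s'] that by (simp add: field_simps)
  qed
  have lim: "f T \<le> g T" if T: "0 < T" and c: "continuous_on {0..T} f" "continuous_on {0..T} g"
    and le: "\<And>s. s \<in> {p<..<T} \<Longrightarrow> f s \<le> g s" and p: "p < T" for f g :: "real \<Rightarrow> real" and p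
  proof (rule tendsto_le)
    have *: "at_left T = at T within {0..T}" using T by (simp add: at_within_Icc_at_left)
    show "(f \<longlongrightarrow> f T) (at_left T)" "(g \<longlongrightarrow> g T) (at_left T)"
      using c T unfolding * by (auto simp: continuous_on)
    show "\<forall>\<^sub>F s in at_left T. f s \<le> g s"
      using eventually_at_left_real[OF p] by eventually_elim (rule le)
  qed auto
  show 1: "u2 s \<le> u1 s" if "s \<in> {0..T}" for s
  proof -
    consider "s = 0" | "s \<in> {0<..<T}" | "s = T" "0 < T" using \<open>s \<in> {0..T}\<close> by force
    then show ?thesis
    proof cases
      case 3
      then show ?thesis using lim[OF _ c2 c1, of 0] ge by auto
    qed (use z0 ge in auto)
  qed
  show "u1 s * u2 s' \<le> u1 s' * u2 s" if s: "0 \<le> s" "s \<le> s'" "s' \<le> T" for s s'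
  proof -
    consider "s = 0" | "0 < s" "s' < T" | "s' = T" "s = T" | "0 < s" "s < T" "s' = T" using s by force
    then show ?thesis
    proof cases
      case 4
      show ?thesis
        unfolding \<open>s' = T\<close>
        by (rule lim[where p = s]) (use 4 mono in \<open>auto intro!: continuous_intros c1 c2\<close>)
    qed (use z0 mono s in auto)
  qed
qed

section \<open>Lipschitz approximation and generalized sines\<close>

lemma lip_approx_greatest:
  assumes "0 \<le> T" "\<And>r. r \<in> {0..T} \<Longrightarrow> a \<le> \<kappa> r + real n * \<bar>s - r\<bar>"
  shows "a \<le> lip_approx \<kappa> T n s"
  unfolding lip_approx_def using assms by (intro cINF_greatest) auto

lemma lip_approx_lower:
  assumes "r \<in> {0..T}" "\<And>r. r \<in> {0..T} \<Longrightarrow> - C \<le> \<kappa> r"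
  shows "lip_approx \<kappa> T n s \<le> \<kappa> r + real n * \<bar>s - r\<bar>"
  unfolding lip_approx_def
proof (rule cINF_lower[OF _ assms(1)])
  show "bdd_below ((\<lambda>r. \<kappa> r + real n * \<bar>s - r\<bar>) ` {0..T})"
  proof (rule bdd_belowI2)
    fix r assume "r \<in> {0..T}"
    then show "- C \<le> \<kappa> r + real n * \<bar>s - r\<bar>" using assms(2)[of r] by (simp add: add_increasing2)
  qed
qed

lemma lip_approx_le:
  assumes "s \<in> {0..T}" "\<And>r. r \<in> {0..T} \<Longrightarrow> - C \<le> \<kappa> r"
  shows "lip_approx \<kappa> T n s \<le> \<kappa> s"
  using lip_approx_lower[where n = n and s = s and \<kappa> = \<kappa>, OF assms] by simp

lemma lip_approx_ge_bound:
  assumes "0 \<le> T" "\<And>r. r \<in> {0..T} \<Longrightarrow> - C \<le> \<kappa> r"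
  shows "- C \<le> lip_approx \<kappa> T n s"
  using assms by (intro lip_approx_greatest) (auto simp: add_increasing2)

lemma lip_approx_lipschitz:
  assumes T: "0 \<le> T" and C: "\<And>r. r \<in> {0..T} \<Longrightarrow> - C \<le> \<kappa> r"
  shows "\<bar>lip_approx \<kappa> T n s - lip_approx \<kappa> T n s'\<bar> \<le> real n * \<bar>s - s'\<bar>"
proof -
  have *: "lip_approx \<kappa> T n s - real n * \<bar>s - s'\<bar> \<le> lip_approx \<kappa> T n s'" for s s'
  proof (rule lip_approx_greatest[OF T])
    fix r assume r: "r \<in> {0..T}"
    have "lip_approx \<kappa> T n s \<le> \<kappa> r + real n * \<bar>s - r\<bar>" by (rule lip_approx_lower[OF r C])
    also have "real n * \<bar>s - r\<bar> \<le> real n * (\<bar>s - s'\<bar> + \<bar>s' - r\<bar>)" by (intro mult_left_mono) auto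
    finally show "lip_approx \<kappa> T n s - real n * \<bar>s - s'\<bar> \<le> \<kappa> r + real n * \<bar>s' - r\<bar>"
      by (simp add: algebra_simps)
  qed
  show ?thesis using *[of s s'] *[of s' s] unfolding abs_minus_commute[of s' s] by (simp add: abs_le_iff)
qed

lemma lipschitz_continuous_on:
  fixes f :: "real \<Rightarrow> real"
  assumes "\<And>s s'. s \<in> S \<Longrightarrow> s' \<in> S \<Longrightarrow> \<bar>f s - f s'\<bar> \<le> L * \<bar>s - s'\<bar>"
  shows "continuous_on S f"
proof -
  have "(max L 0)-lipschitz_on S f"
  proof (rule lipschitz_onI)
    fix x y assume "x \<in> S" "y \<in> S"
    from assms[OF this] show "dist (f x) (f y) \<le> max L 0 * dist x y"
      unfolding dist_real_def by (smt (verit, best) mult_right_mono max.cobounded1 abs_ge_zero)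
  qed simp
  then show ?thesis by (rule lipschitz_on_continuous_on)
qed

lemma lip_approx_continuous:
  assumes "0 \<le> T" "\<And>r. r \<in> {0..T} \<Longrightarrow> - C \<le> \<kappa> r"
  shows "continuous_on S (lip_approx \<kappa> T n)"
  by (rule lipschitz_continuous_on[OF lip_approx_lipschitz[OF assms]])

lemma lip_approx_mono:
  assumes T: "0 \<le> T" and C: "\<And>r. r \<in> {0..T} \<Longrightarrow> - C \<le> \<kappa> r" and "n \<le> n'"
  shows "lip_approx \<kappa> T n s \<le> lip_approx \<kappa> T n' s"
proof (rule lip_approx_greatest[OF T])
  fix r assume r: "r \<in> {0..T}"
  have "lip_approx \<kappa> T n s \<le> \<kappa> r + real n * \<bar>s - r\<bar>" by (rule lip_approx_lower[OF r C])
  also have "\<dots> \<le> \<kappa> r + real n' * \<bar>s - r\<bar>"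
    using \<open>n \<le> n'\<close> by (intro add_left_mono mult_right_mono) auto
  finally show "lip_approx \<kappa> T n s \<le> \<kappa> r + real n' * \<bar>s - r\<bar>" .
qed

lemma lip_approx_interval_mono:
  assumes "0 \<le> T1" "T1 \<le> T2" and C: "\<And>r. r \<in> {0..T2} \<Longrightarrow> - C \<le> \<kappa> r"
  shows "lip_approx \<kappa> T2 n s \<le> lip_approx \<kappa> T1 n s"
  using assms(1,2) by (intro lip_approx_greatest lip_approx_lower[OF _ C]) auto

text \<open>The \<open>n\<close>-th approximation is the largest \<open>n\<close>-Lipschitz minorant.\<close>

lemma lipschitz_minorant_le_lip_approx:
  assumes f: "\<And>s r. s \<in> {0..T} \<Longrightarrow> r \<in> {0..T} \<Longrightarrow> \<bar>f s - f r\<bar> \<le> real n * \<bar>s - r\<bar>"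
    and le: "\<And>s. s \<in> {0..T} \<Longrightarrow> f s \<le> \<kappa> s" and "n \<le> j" and s: "s \<in> {0..T}"
  shows "f s \<le> lip_approx \<kappa> T j s"
proof (rule lip_approx_greatest)
  fix r assume r: "r \<in> {0..T}"
  have "f s \<le> f r + real n * \<bar>s - r\<bar>" using f[OF s r] by (auto simp: abs_le_iff)
  also have "\<dots> \<le> \<kappa> r + real j * \<bar>s - r\<bar>"
    using \<open>n \<le> j\<close> le[OF r] by (intro add_mono mult_right_mono) auto
  finally show "f s \<le> \<kappa> r + real j * \<bar>s - r\<bar>" .
qed (use s in auto)

text \<open>Enlarging the interval only adds competitors to the infimum. Those slightly beyond \<open>T1\<close> lower it by
  at most \<open>\<eta>\<close>, by lower semicontinuity at \<open>T1\<close>; the remaining ones are at a fixed distance and lose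
  against a large slope \<open>m\<close>. This replaces the uniform convergence that Dini's theorem would give for continuous
  \<open>\<kappa>\<close>.\<close>

lemma lip_approx_enlarged_interval:
  assumes lsc: "lsc_on {0..T2} \<kappa>" and T: "0 \<le> T1" "T1 \<le> T2"
    and C: "\<And>r. r \<in> {0..T2} \<Longrightarrow> - C \<le> \<kappa> r" and \<eta>: "0 < \<eta>"
  shows "\<exists>m. \<forall>s\<in>{0..T1}. lip_approx \<kappa> T1 n s - \<eta> \<le> lip_approx \<kappa> T2 m s"
proof -
  have C1: "\<And>r. r \<in> {0..T1} \<Longrightarrow> - C \<le> \<kappa> r" using C T by auto
  have "\<forall>\<^sub>F r in at T1 within {0..T2}. \<kappa> T1 - \<eta> < \<kappa> r"
    using lsc T \<eta> by (auto simp: lsc_on_def)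
  then obtain \<delta> where \<delta>: "\<delta> > 0"
    "\<And>r. r \<in> {0..T2} \<Longrightarrow> r \<noteq> T1 \<Longrightarrow> dist r T1 < \<delta> \<Longrightarrow> \<kappa> T1 - \<eta> < \<kappa> r"
    by (auto simp: eventually_at)
  obtain j :: nat where j: "\<kappa> 0 + real n * T1 + C \<le> real j * \<delta>"
    using reals_Archimedean3[OF \<delta>(1)] by (meson less_imp_le)
  define m where "m = max n j"
  have "lip_approx \<kappa> T1 n s - \<eta> \<le> lip_approx \<kappa> T2 m s" if s: "s \<in> {0..T1}" for s
  proof (rule lip_approx_greatest)
    fix r assume r: "r \<in> {0..T2}"
    have mn: "real n \<le> real m" "real j \<le> real m" by (auto simp: m_def)
    consider "r \<le> T1" | "T1 < r" "r < T1 + \<delta>" | "T1 + \<delta> \<le> r" by linarith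
    then show "lip_approx \<kappa> T1 n s - \<eta> \<le> \<kappa> r + real m * \<bar>s - r\<bar>"
    proof cases
      case 1
      then have "lip_approx \<kappa> T1 n s \<le> \<kappa> r + real n * \<bar>s - r\<bar>" using r by (intro lip_approx_lower[OF _ C1]) auto
      also have "real n * \<bar>s - r\<bar> \<le> real m * \<bar>s - r\<bar>" using mn by (intro mult_right_mono) auto
      finally show ?thesis using \<eta> by linarith
    next
      case 2
      have "lip_approx \<kappa> T1 n s \<le> \<kappa> T1 + real n * \<bar>s - T1\<bar>" using T by (intro lip_approx_lower[OF _ C1]) auto
      also have "real n * \<bar>s - T1\<bar> \<le> real m * \<bar>s - r\<bar>" using mn 2 s by (intro mult_mono) auto
      also have "\<kappa> T1 \<le> \<kappa> r + \<eta>" using \<delta>(2)[OF r] 2 by (auto simp: dist_real_def)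
      finally show ?thesis by linarith
    next
      case 3
      have "lip_approx \<kappa> T1 n s \<le> \<kappa> 0 + real n * \<bar>s - 0\<bar>" using T by (intro lip_approx_lower[OF _ C1]) auto
      also have "real n * \<bar>s - 0\<bar> \<le> real n * T1" using s by (intro mult_left_mono) auto
      finally have "lip_approx \<kappa> T1 n s \<le> real j * \<delta> - C" using j by linarith
      also have "real j * \<delta> \<le> real m * \<bar>s - r\<bar>" using mn 3 s \<delta> by (intro mult_mono) auto
      finally show ?thesis using C[OF r] \<eta> by linarith
    qed
  qed (use T in auto)
  then show ?thesis by blast
qed

lemma sine_mono:
  assumes "continuous_on {0..T} f" "continuous_on {0..T} g" "\<And>s. s \<in> {0..T} \<Longrightarrow> f s \<le> g s"
    and "\<And>s. s \<in> {0<..<T} \<Longrightarrow> 0 < sine g T s" and "s \<in> {0..T}"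
  shows "sine g T s \<le> sine f T s"
proof -
  have "0 \<le> T" using assms by auto
  then show ?thesis
    using sturm_comparison(1)[OF sine_is_solution[OF assms(1)] sine_is_solution[OF assms(2)] assms(3,4,5)] by blast
qed

text \<open>The approximations of \<open>\<kappa>\<close> increase with \<open>n\<close>, so by Sturm's theorem their sines decrease.\<close>

lemma gsine_on_limit:
  assumes T: "0 < T" and C: "\<And>r. r \<in> {0..T} \<Longrightarrow> - C \<le> \<kappa> r"
    and pos: "\<And>n s. s \<in> {0<..<T} \<Longrightarrow> 0 < sine (lip_approx \<kappa> T n) T s" and s: "s \<in> {0..T}"
  shows "(\<lambda>n. sine (lip_approx \<kappa> T n) T s) \<longlonglongrightarrow> gsine_on \<kappa> T s"
    and "gsine_on \<kappa> T s \<le> sine (lip_approx \<kappa> T n) T s"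
    and "0 \<le> gsine_on \<kappa> T s"
    and "0 \<le> sine (lip_approx \<kappa> T n) T s"
    and "sine (lip_approx \<kappa> T n) T s \<le> sine (lip_approx \<kappa> T 0) T s"
proof -
  have T0: "0 \<le> T" using T by simp
  note cont = lip_approx_continuous[of T C, OF T0 C]
  have dec: "sine (lip_approx \<kappa> T n') T s \<le> sine (lip_approx \<kappa> T n) T s" if "n \<le> n'" for n n'
    by (intro sine_mono cont pos lip_approx_mono[of T C, OF T0 C] that s)
  have nn: "0 \<le> sine (lip_approx \<kappa> T n) T s" for n
  proof -
    have "0 \<le> sine (lip_approx \<kappa> T n) T r" if "r \<in> closure {0<..<T}" for r
      using that
    proof (rule continuous_ge_on_closure[rotated])
      show "continuous_on (closure {0<..<T}) (sine (lip_approx \<kappa> T n) T)"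
        using sine_continuous[OF cont T0] T by simp
    qed (use pos[THEN less_imp_le] in auto)
    then show ?thesis using s T by simp
  qed
  have "decseq (\<lambda>n. sine (lip_approx \<kappa> T n) T s)" using dec by (simp add: decseq_def)
  then obtain L where L: "(\<lambda>n. sine (lip_approx \<kappa> T n) T s) \<longlonglongrightarrow> L" "\<forall>i. L \<le> sine (lip_approx \<kappa> T i) T s"
    using decseq_convergent[of _ 0] nn by blast
  then have "gsine_on \<kappa> T s = L" unfolding gsine_on_def by (intro limI)
  then show "(\<lambda>n. sine (lip_approx \<kappa> T n) T s) \<longlonglongrightarrow> gsine_on \<kappa> T s"
    "gsine_on \<kappa> T s \<le> sine (lip_approx \<kappa> T n) T s" using L by auto
  then show "0 \<le> gsine_on \<kappa> T s" using nn LIMSEQ_le_const by blast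
  show "0 \<le> sine (lip_approx \<kappa> T n) T s" by (rule nn)
  show "sine (lip_approx \<kappa> T n) T s \<le> sine (lip_approx \<kappa> T 0) T s" by (rule dec) simp
qed

text \<open>On the smaller interval the approximations are larger, which is the wrong direction for Sturm's
  theorem. After lowering \<open>lip_approx \<kappa> T1 n\<close> by \<open>\<eta>\<close> it lies below a later approximation on the larger
  interval; stability of the solution allows to let \<open>\<eta>\<close> tend to \<open>0\<close>.\<close>

lemma gsine_on_le_sine_subinterval:
  assumes lsc: "lsc_on {0..T2} \<kappa>" and T: "0 < T1" "T1 \<le> T2"
    and C: "\<And>r. r \<in> {0..T2} \<Longrightarrow> - C \<le> \<kappa> r"
    and pos: "\<And>n s. s \<in> {0<..<T2} \<Longrightarrow> 0 < sine (lip_approx \<kappa> T2 n) T2 s" and s: "s \<in> {0..T1}"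
  shows "gsine_on \<kappa> T2 s \<le> sine (lip_approx \<kappa> T1 n) T1 s"
proof -
  have C1: "\<And>r. r \<in> {0..T1} \<Longrightarrow> - C \<le> \<kappa> r" using C T by auto
  have T0: "0 \<le> T1" "0 \<le> T2" "0 < T2" using T by auto
  note cont1 = lip_approx_continuous[of T1 C, OF T0(1) C1]
  note cont2 = lip_approx_continuous[of T2 C, OF T0(2) C]
  define f where "f = lip_approx \<kappa> T1 n"
  have cf: "continuous_on {0..T1} f" unfolding f_def by (rule cont1)
  define B where "B = \<bar>C\<bar> + \<bar>\<kappa> 0\<bar> + real n * T1 + 1"
  have fB: "\<bar>f r\<bar> \<le> B - 1" if "r \<in> {0..T1}" for r
  proof -
    have "f r \<le> \<kappa> 0 + real n * \<bar>r - 0\<bar>" unfolding f_def using T by (intro lip_approx_lower[OF _ C1]) auto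
    also have "real n * \<bar>r - 0\<bar> \<le> real n * T1" using that by (intro mult_left_mono) auto
    finally have "f r \<le> \<kappa> 0 + real n * T1" by simp
    moreover have "- C \<le> f r" unfolding f_def by (rule lip_approx_ge_bound[OF T0(1) C1])
    moreover have "0 \<le> real n * T1" using T by simp
    ultimately show ?thesis by (auto simp: B_def abs_if)
  qed
  have key: "gsine_on \<kappa> T2 s \<le> sine f T1 s + \<eta> * sine_stability B T1" if \<eta>: "0 < \<eta>" "\<eta> \<le> 1" for \<eta>
  proof -
    define g where "g = (\<lambda>r. f r - \<eta>)"
    have cg: "continuous_on {0..T1} g" unfolding g_def by (intro continuous_intros cf)
    obtain m where m: "\<And>r. r \<in> {0..T1} \<Longrightarrow> g r \<le> lip_approx \<kappa> T2 m r"
      using lip_approx_enlarged_interval[OF lsc T0(1) T(2) C \<eta>(1)] unfolding g_def f_def by blast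
    have eq: "sine (lip_approx \<kappa> T2 m) T1 r = sine (lip_approx \<kappa> T2 m) T2 r" if "r \<in> {0..T1}" for r
      by (rule sine_restrict[OF cont2 T(2) that])
    have "gsine_on \<kappa> T2 s \<le> sine (lip_approx \<kappa> T2 m) T2 s"
      using s T by (intro gsine_on_limit(2)[OF T0(3) C pos]) auto
    also have "\<dots> = sine (lip_approx \<kappa> T2 m) T1 s" using eq[OF s] by simp
    also have "\<dots> \<le> sine g T1 s"
      by (rule sine_mono[OF cg cont2 m _ s]) (use pos eq T in auto)
    also have "\<bar>sine g T1 s - sine f T1 s\<bar> \<le> \<eta> * sine_stability B T1"
    proof (rule sine_solution_stability[OF sine_is_solution[OF cg T0(1)] sine_is_solution[OF cf T0(1)] _ _ _ s])
      fix r assume r: "r \<in> {0..T1}"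
      show "\<bar>g r\<bar> \<le> B" "\<bar>f r\<bar> \<le> B" "\<bar>g r - f r\<bar> \<le> \<eta>" using fB[OF r] \<eta> by (auto simp: g_def)
    qed
    then have "sine g T1 s \<le> sine f T1 s + \<eta> * sine_stability B T1" by linarith
    finally show ?thesis .
  qed
  have "(\<lambda>k. sine f T1 s + inverse (real (Suc k)) * sine_stability B T1) \<longlonglongrightarrow> sine f T1 s + 0 * sine_stability B T1"
    by (intro tendsto_intros LIMSEQ_inverse_real_of_nat)
  then have "gsine_on \<kappa> T2 s \<le> sine f T1 s + 0 * sine_stability B T1"
  proof (rule LIMSEQ_le_const)
    show "\<exists>N. \<forall>k\<ge>N. gsine_on \<kappa> T2 s \<le> sine f T1 s + inverse (real (Suc k)) * sine_stability B T1"
      by (intro exI allI impI key) (auto simp: field_simps)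
  qed
  then show ?thesis by (simp add: f_def)
qed

lemma sine_lip_approx_le_enlarged:
  assumes T: "0 < T1" "T1 \<le> T2" and C: "\<And>r. r \<in> {0..T2} \<Longrightarrow> - C \<le> \<kappa> r"
    and pos: "\<And>s. s \<in> {0<..<T1} \<Longrightarrow> 0 < sine (lip_approx \<kappa> T1 n) T1 s" and s: "s \<in> {0..T1}"
  shows "sine (lip_approx \<kappa> T1 n) T1 s \<le> sine (lip_approx \<kappa> T2 n) T2 s"
proof -
  have C1: "\<And>r. r \<in> {0..T1} \<Longrightarrow> - C \<le> \<kappa> r" using C T by auto
  have T0: "0 \<le> T1" "0 \<le> T2" using T by auto
  note cont1 = lip_approx_continuous[of T1 C, OF T0(1) C1]
  note cont2 = lip_approx_continuous[of T2 C, OF T0(2) C]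
  have "sine (lip_approx \<kappa> T1 n) T1 s \<le> sine (lip_approx \<kappa> T2 n) T1 s"
    by (intro sine_mono[OF cont2 cont1 _ pos s] lip_approx_interval_mono[OF T0(1) T(2) C]) auto
  also have "\<dots> = sine (lip_approx \<kappa> T2 n) T2 s" by (rule sine_restrict[OF cont2 T(2) s])
  finally show ?thesis .
qed

lemma gsine_on_independent:
  assumes lsc: "lsc_on {0..T2} \<kappa>" and T: "0 < T1" "T1 \<le> T2"
    and C: "\<And>r. r \<in> {0..T2} \<Longrightarrow> - C \<le> \<kappa> r"
    and pos1: "\<And>n s. s \<in> {0<..<T1} \<Longrightarrow> 0 < sine (lip_approx \<kappa> T1 n) T1 s"
    and pos2: "\<And>n s. s \<in> {0<..<T2} \<Longrightarrow> 0 < sine (lip_approx \<kappa> T2 n) T2 s" and s: "s \<in> {0..T1}"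
  shows "gsine_on \<kappa> T1 s = gsine_on \<kappa> T2 s"
proof (rule antisym)
  have C1: "\<And>r. r \<in> {0..T1} \<Longrightarrow> - C \<le> \<kappa> r" using C T by auto
  have l1: "(\<lambda>n. sine (lip_approx \<kappa> T1 n) T1 s) \<longlonglongrightarrow> gsine_on \<kappa> T1 s"
    by (rule gsine_on_limit(1)[OF T(1) C1 pos1 s])
  have l2: "(\<lambda>n. sine (lip_approx \<kappa> T2 n) T2 s) \<longlonglongrightarrow> gsine_on \<kappa> T2 s"
    using T s by (intro gsine_on_limit(1)[OF _ C pos2]) auto
  show "gsine_on \<kappa> T1 s \<le> gsine_on \<kappa> T2 s"
    using sine_lip_approx_le_enlarged[OF T C pos1 s] by (intro LIMSEQ_le[OF l1 l2]) auto
  show "gsine_on \<kappa> T2 s \<le> gsine_on \<kappa> T1 s"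
    using gsine_on_le_sine_subinterval[OF lsc T C pos2 s] by (intro LIMSEQ_le_const[OF l1]) auto
qed

lemma lsc_on_subset: "lsc_on S f \<Longrightarrow> S' \<subseteq> S \<Longrightarrow> lsc_on S' f"
  unfolding lsc_on_def by (meson at_le filter_leD subsetD)

text \<open>The radius \<open>R\<close> may be the supremum \<open>gpi\<close> without being attained. Positivity of the sines at a point
  \<open>s < R\<close> comes from some admissible interval \<open>{0..T}\<close> with \<open>s < T\<close>: if \<open>T < R\<close>, the sines on \<open>{0..R}\<close> lie above
  those on \<open>{0..T}\<close>; if \<open>T \<ge> R\<close>, they lie above the generalized sine, which is positive on
  \<open>{0<..<T}\<close>.\<close>

theorem gsine_up_to_gpi:
  assumes I0: "\<And>T. T \<in> I \<Longrightarrow> {0..T} \<subseteq> I" and cl: "closed I"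
    and lsc: "lsc_on I \<kappa>" and bdd: "\<And>T. T \<in> I \<Longrightarrow> \<exists>C. \<forall>r\<in>{0..T}. - C \<le> \<kappa> r"
    and R: "0 < R" "ennreal R \<le> gpi I \<kappa>"
  shows "gsine_domain I \<kappa> R" and "\<And>s. s \<in> {0<..<R} \<Longrightarrow> 0 < gsine_on \<kappa> R s"
    and "\<And>s. s \<in> {0..R} \<Longrightarrow> gsine I \<kappa> s = gsine_on \<kappa> R s"
proof -
  have ex: "\<exists>T>a. gsine_domain I \<kappa> T \<and> (\<forall>s\<in>{0<..<T}. 0 < gsine_on \<kappa> T s)" if "0 \<le> a" "a < R" for a
  proof -
    have "ennreal a < gpi I \<kappa>" using that R by (metis ennreal_lessI less_le_trans)
    then obtain T where T: "gsine_domain I \<kappa> T" "\<forall>s\<in>{0<..<T}. 0 < gsine_on \<kappa> T s" "ennreal a < ennreal T"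
      unfolding gpi_def less_Sup_iff by auto
    then have "a < T" using that(1) by (metis ennreal_leI not_le)
    with T show ?thesis by blast
  qed
  have RI: "R \<in> I"
  proof -
    have "{0..<R} \<subseteq> I"
    proof
      fix a assume a: "a \<in> {0..<R}"
      then obtain T where "T > a" "gsine_domain I \<kappa> T" using ex[of a] by auto
      then show "a \<in> I" using I0[of T] a by (auto simp: gsine_domain_def)
    qed
    then have "closure {0..<R} \<subseteq> I" using cl by (rule closure_minimal)
    then show ?thesis using R by auto
  qed
  have sub: "{0..T} \<subseteq> I" "lsc_on {0..T} \<kappa>" if "T \<in> I" for T
    using I0[OF that] lsc_on_subset[OF lsc] by auto
  have indep: "gsine_on \<kappa> T1 s = gsine_on \<kappa> T2 s"
    if dom: "gsine_domain I \<kappa> T1" "gsine_domain I \<kappa> T2" "s \<in> {0..T1}" "s \<in> {0..T2}" "T1 \<le> T2" for T1 T2 s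
  proof -
    obtain C where "\<forall>r\<in>{0..T2}. - C \<le> \<kappa> r" using bdd[of T2] dom unfolding gsine_domain_def by blast
    then show ?thesis
      using dom sub(2)[of T2]
      by (intro gsine_on_independent[of T2 \<kappa> T1 C]) (auto simp: gsine_domain_def)
  qed
  have indep': "gsine_on \<kappa> T1 s = gsine_on \<kappa> T2 s"
    if "gsine_domain I \<kappa> T1" "gsine_domain I \<kappa> T2" "s \<in> {0..T1}" "s \<in> {0..T2}" for T1 T2 s
    using indep[OF that] indep[OF that(2,1,4,3)] by (metis linear)
  have "0 < sine (lip_approx \<kappa> R n) R s" if s: "s \<in> {0<..<R}" for n s
  proof -
    obtain T where T: "T > s" "gsine_domain I \<kappa> T" "\<forall>s\<in>{0<..<T}. 0 < gsine_on \<kappa> T s"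
      using ex[of s] s by auto
    then have TI: "T \<in> I" "0 < T" "\<And>n s. s \<in> {0<..<T} \<Longrightarrow> 0 < sine (lip_approx \<kappa> T n) T s"
      by (auto simp: gsine_domain_def)
    show ?thesis
    proof (cases "R \<le> T")
      case True
      obtain C where C: "\<forall>r\<in>{0..T}. - C \<le> \<kappa> r" using bdd[OF TI(1)] by blast
      have "gsine_on \<kappa> T s \<le> sine (lip_approx \<kappa> R n) R s"
        using C s R by (intro gsine_on_le_sine_subinterval[OF sub(2)[OF TI(1)] R(1) True _ TI(3)]) auto
      then show ?thesis using T s by force
    next
      case False
      obtain C where C: "\<forall>r\<in>{0..R}. - C \<le> \<kappa> r" using bdd[OF RI] by blast
      have "sine (lip_approx \<kappa> T n) T s \<le> sine (lip_approx \<kappa> R n) R s"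
        using C s T False by (intro sine_lip_approx_le_enlarged[OF TI(2) _ _ TI(3)]) auto
      moreover have "0 < sine (lip_approx \<kappa> T n) T s" using TI(3) s T by auto
      ultimately show ?thesis by linarith
    qed
  qed
  then show dom: "gsine_domain I \<kappa> R" using RI R by (auto simp: gsine_domain_def)
  show "0 < gsine_on \<kappa> R s" if s: "s \<in> {0<..<R}" for s
  proof -
    obtain T where T: "T > s" "gsine_domain I \<kappa> T" "\<forall>s\<in>{0<..<T}. 0 < gsine_on \<kappa> T s"
      using ex[of s] s by auto
    have "gsine_on \<kappa> R s = gsine_on \<kappa> T s" using s T by (intro indep' dom) auto
    then show ?thesis using T s by auto
  qed
  show "gsine I \<kappa> s = gsine_on \<kappa> R s" if s: "s \<in> {0..R}" for s
  proof -
    define T where "T = (SOME T. gsine_domain I \<kappa> T \<and> s \<le> T)"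
    have "gsine_domain I \<kappa> T \<and> s \<le> T" unfolding T_def by (rule someI[of _ R]) (use dom s in auto)
    then show ?thesis unfolding gsine_def T_def[symmetric] using s by (intro indep' dom) auto
  qed
qed

text \<open>Monotonicity of the ratio in Sturm's theorem; once a sine vanishes the coefficient is \<open>\<infinity>\<close>, and then
  so is the one for any larger curvature.\<close>

lemma sigma_cont_mono:
  assumes f: "continuous_on {0..\<theta>} f" and g: "continuous_on {0..\<theta>} g"
    and le: "\<And>s. s \<in> {0..\<theta>} \<Longrightarrow> f s \<le> g s" and \<theta>: "0 < \<theta>" and t: "t \<in> {0..1}"
  shows "sigma_cont f t \<theta> \<le> sigma_cont g t \<theta>"
proof (cases "\<forall>s\<in>{0<..\<theta>}. 0 < sine g \<theta> s")
  case True
  have \<theta>0: "0 \<le> \<theta>" using \<theta> by simp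
  note st = sturm_comparison[OF sine_is_solution[OF f \<theta>0] sine_is_solution[OF g \<theta>0] le]
  have ge: "sine g \<theta> s \<le> sine f \<theta> s" if "s \<in> {0..\<theta>}" for s
    using st(1)[OF _ _ that] True by auto
  have pf: "0 < sine f \<theta> s" if "s \<in> {0<..\<theta>}" for s using ge[of s] True that by force
  have "sine f \<theta> (t * \<theta>) * sine g \<theta> \<theta> \<le> sine f \<theta> \<theta> * sine g \<theta> (t * \<theta>)"
    using st(2)[of "t * \<theta>" \<theta>] True t \<theta> by (auto simp: mult_left_le_one_le)
  then have "sine f \<theta> (t * \<theta>) / sine f \<theta> \<theta> \<le> sine g \<theta> (t * \<theta>) / sine g \<theta> \<theta>"
    using pf[of \<theta>] True \<theta> by (auto simp: field_simps)
  then show ?thesis using pf True by (auto simp: sigma_cont_def intro: ennreal_leI)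
qed (auto simp: sigma_cont_def)

text \<open>The approximations of \<open>\<kappa>\<close> eventually dominate a Lipschitz minorant \<open>f\<close>, so the coefficient of
  \<open>\<kappa>\<close> is at least that of \<open>f\<close>. The hypothesis on \<open>c\<close> is written without division, so that it also makes
  sense when the sine of \<open>f\<close> vanishes; in that case the coefficient is \<open>\<infinity>\<close>.\<close>

lemma sigma_coeff_lower_bound:
  assumes f: "\<And>s r. s \<in> {0..\<theta>} \<Longrightarrow> r \<in> {0..\<theta>} \<Longrightarrow> \<bar>f s - f r\<bar> \<le> L * \<bar>s - r\<bar>"
    and le: "\<And>s. s \<in> {0..\<theta>} \<Longrightarrow> f s \<le> \<kappa> s" and \<theta>: "0 < \<theta>" and t: "t \<in> {0..1}" 
    and c: "c * sine f \<theta> \<theta> \<le> sine f \<theta> (t * \<theta>)"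
  shows "ennreal c \<le> sigma_coeff \<kappa> t \<theta>"
proof -
  have \<theta>0: "0 \<le> \<theta>" using \<theta> by simp
  obtain n :: nat where n: "L \<le> real n" using real_arch_simple by blast
  have fn: "\<bar>f s - f r\<bar> \<le> real n * \<bar>s - r\<bar>" if "s \<in> {0..\<theta>}" "r \<in> {0..\<theta>}" for s r
    using f[OF that] mult_right_mono[OF n abs_ge_zero] by (rule order_trans)
  have cf: "continuous_on {0..\<theta>} f" by (rule lipschitz_continuous_on[OF f])
  then have "compact (f ` {0..\<theta>})" by (intro compact_continuous_image) auto
  then obtain C where C: "\<And>s. s \<in> {0..\<theta>} \<Longrightarrow> \<bar>f s\<bar> \<le> C"
    using compact_imp_bounded[of "f ` {0..\<theta>}"] by (force simp: bounded_iff)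
  have C': "- C \<le> \<kappa> r" if "r \<in> {0..\<theta>}" for r using C[OF that] le[OF that] by auto
  note cont = lip_approx_continuous[OF \<theta>0 C']
  have "incseq (\<lambda>n. sigma_cont (lip_approx \<kappa> \<theta> n) t \<theta>)"
    by (intro incseq_SucI sigma_cont_mono cont \<theta> t lip_approx_mono[OF \<theta>0 C']) auto
  then have "(\<lambda>n. sigma_cont (lip_approx \<kappa> \<theta> n) t \<theta>) \<longlonglongrightarrow> (SUP n. sigma_cont (lip_approx \<kappa> \<theta> n) t \<theta>)"
    by (rule LIMSEQ_SUP)
  then have eq: "sigma_coeff \<kappa> t \<theta> = (SUP n. sigma_cont (lip_approx \<kappa> \<theta> n) t \<theta>)"
    using \<theta> by (simp add: sigma_coeff_def limI)
  have "ennreal c \<le> sigma_cont f t \<theta>"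
  proof (cases "\<forall>s\<in>{0<..\<theta>}. 0 < sine f \<theta> s")
    case True
    then have "c \<le> sine f \<theta> (t * \<theta>) / sine f \<theta> \<theta>" using c \<theta> by (simp add: field_simps)
    then show ?thesis using True by (simp add: sigma_cont_def ennreal_leI)
  qed (auto simp: sigma_cont_def)
  also have "\<dots> \<le> sigma_cont (lip_approx \<kappa> \<theta> n) t \<theta>"
    by (intro sigma_cont_mono cf cont \<theta> t lipschitz_minorant_le_lip_approx[OF fn le]) auto
  also have "\<dots> \<le> sigma_coeff \<kappa> t \<theta>" unfolding eq by (rule SUP_upper) simp
  finally show ?thesis .
qed

section \<open>Location of the measures on a Wasserstein geodesic\<close>

lemma borel_measurable_fst_snd:
  "fst \<in> measurable (borel :: ('a::topological_space \<times> 'b::topological_space) measure) borel"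
  "snd \<in> measurable (borel :: ('a::topological_space \<times> 'b::topological_space) measure) borel"
  by (auto intro!: borel_measurable_continuous_onI continuous_intros)

lemma borel_measurable_cost [measurable]:
  "(\<lambda>z. (dist (fst z) (snd z))\<^sup>2) \<in> borel_measurable (borel :: ('a::metric_space \<times> 'a) measure)"
  by (intro borel_measurable_continuous_onI continuous_intros)

lemma ennreal_affine:
  assumes "0 \<le> A" "0 \<le> x" "0 \<le> B" "0 \<le> y" "0 \<le> z"
  shows "ennreal (A * x + (B * y + z)) = ennreal A * ennreal x + (ennreal B * ennreal y + ennreal z)"
  using assms by (simp add: ennreal_mult)

lemma P2D:
  assumes "\<mu> \<in> P2"
  shows "sets \<mu> = sets borel" "space \<mu> = UNIV" "prob_space \<mu>"
  using assms sets_eq_imp_space_eq[of \<mu> borel] by (auto simp: P2_def)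

lemma couplingsD:
  assumes "q \<in> couplings \<mu> \<nu>"
  shows "sets q = sets borel" "space q = UNIV" "prob_space q" "distr q borel fst = \<mu>" "distr q borel snd = \<nu>"
  using assms sets_eq_imp_space_eq[of q borel] by (auto simp: couplings_def)

text \<open>The product coupling. Finiteness is what allows to recover the infimum of the costs from the real
  number \<open>W2\<close>, since \<open>enn2real\<close> sends \<open>\<infinity>\<close> to \<open>0\<close>.\<close>

lemma P2_coupling_finite_cost:
  fixes \<mu> \<nu> :: "'a::polish_space measure"
  assumes "\<mu> \<in> P2" "\<nu> \<in> P2"
  shows "\<exists>q\<in>couplings \<mu> \<nu>. transport_cost q < \<infinity>"
proof -
  note [measurable_cong] = P2D(1)[OF assms(1)] P2D(1)[OF assms(2)]
  interpret \<mu>: prob_space \<mu> by (rule P2D(3)[OF assms(1)])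
  interpret \<nu>: prob_space \<nu> by (rule P2D(3)[OF assms(2)])
  interpret P: pair_prob_space \<mu> \<nu> ..
  have setsP: "sets (\<mu> \<Otimes>\<^sub>M \<nu>) = sets borel"
    using sets_pair_measure_cong[OF P2D(1)[OF assms(1)] P2D(1)[OF assms(2)]] by (simp only: borel_prod)
  obtain x y where x: "(\<integral>\<^sup>+ z. ennreal ((dist x z)\<^sup>2) \<partial>\<mu>) < \<infinity>" and y: "(\<integral>\<^sup>+ z. ennreal ((dist y z)\<^sup>2) \<partial>\<nu>) < \<infinity>"
    using assms by (auto simp: P2_def)
  have fst: "distr (\<mu> \<Otimes>\<^sub>M \<nu>) borel fst = \<mu>"
    using \<nu>.distr_pair_fst[of \<mu>] distr_cong[OF refl P2D(1)[OF assms(1)], of "\<mu> \<Otimes>\<^sub>M \<nu>" fst fst] by simp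
  have snd: "distr (\<mu> \<Otimes>\<^sub>M \<nu>) borel snd = \<nu>"
  proof (rule measure_eqI)
    fix A assume "A \<in> sets (distr (\<mu> \<Otimes>\<^sub>M \<nu>) borel snd)"
    then have A: "A \<in> sets \<nu>" by (simp add: P2D(1)[OF assms(2)])
    have "emeasure (distr (\<mu> \<Otimes>\<^sub>M \<nu>) borel snd) A = emeasure (\<mu> \<Otimes>\<^sub>M \<nu>) (space \<mu> \<times> A)"
      using A by (subst emeasure_distr) (auto intro!: arg_cong2[where f=emeasure] simp: space_pair_measure P2D[OF assms(1)] P2D[OF assms(2)])
    also have "\<dots> = emeasure \<nu> A" using A by (simp add: \<nu>.emeasure_pair_measure_Times \<mu>.emeasure_space_1)
    finally show "emeasure (distr (\<mu> \<Otimes>\<^sub>M \<nu>) borel snd) A = emeasure \<nu> A" .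
  qed (simp add: P2D[OF assms(2)])
  have "transport_cost (\<mu> \<Otimes>\<^sub>M \<nu>) \<le> (\<integral>\<^sup>+ z. ennreal (3 * (dist x y)\<^sup>2) + (3 * ennreal ((dist x (fst z))\<^sup>2) + 3 * ennreal ((dist y (snd z))\<^sup>2)) \<partial>(\<mu> \<Otimes>\<^sub>M \<nu>))"
    unfolding transport_cost_def
  proof (rule nn_integral_mono)
    fix z :: "'a \<times> 'a"
    have 1: "dist (fst z) (snd z) \<le> dist x (fst z) + dist x y + dist y (snd z)"
      using dist_triangle[of "fst z" "snd z" x] dist_triangle[of x "snd z" y] by (simp add: dist_commute)
    have "(a + b + c)\<^sup>2 \<le> 3 * a\<^sup>2 + 3 * b\<^sup>2 + 3 * c\<^sup>2" for a b c :: real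
      using sum_squares_bound[of a b] sum_squares_bound[of a c] sum_squares_bound[of b c]
      by (simp add: power2_eq_square algebra_simps)
    from order_trans[OF power_mono[OF 1] this] have "(dist (fst z) (snd z))\<^sup>2 \<le> 3 * (dist x y)\<^sup>2 + (3 * (dist x (fst z))\<^sup>2 + 3 * (dist y (snd z))\<^sup>2)"
      by (simp add: algebra_simps)
    then show "ennreal ((dist (fst z) (snd z))\<^sup>2) \<le> ennreal (3 * (dist x y)\<^sup>2) + (3 * ennreal ((dist x (fst z))\<^sup>2) + 3 * ennreal ((dist y (snd z))\<^sup>2))"
      by (subst ennreal_numeral[symmetric])+ (simp add: ennreal_mult''[symmetric] ennreal_plus[symmetric] ennreal_leI del: ennreal_plus ennreal_numeral)
  qed
  also have "\<dots> = ennreal (3 * (dist x y)\<^sup>2) + (3 * (\<integral>\<^sup>+ z. ennreal ((dist x (fst z))\<^sup>2) \<partial>(\<mu> \<Otimes>\<^sub>M \<nu>)) + 3 * (\<integral>\<^sup>+ z. ennreal ((dist y (snd z))\<^sup>2) \<partial>(\<mu> \<Otimes>\<^sub>M \<nu>)))"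
    by (simp add: nn_integral_add nn_integral_cmult P.emeasure_space_1)
  also have "(\<integral>\<^sup>+ z. ennreal ((dist x (fst z))\<^sup>2) \<partial>(\<mu> \<Otimes>\<^sub>M \<nu>)) = (\<integral>\<^sup>+ z. ennreal ((dist x z)\<^sup>2) \<partial>distr (\<mu> \<Otimes>\<^sub>M \<nu>) borel fst)"
    by (subst nn_integral_distr) auto
  also have "(\<integral>\<^sup>+ z. ennreal ((dist y (snd z))\<^sup>2) \<partial>(\<mu> \<Otimes>\<^sub>M \<nu>)) = (\<integral>\<^sup>+ z. ennreal ((dist y z)\<^sup>2) \<partial>distr (\<mu> \<Otimes>\<^sub>M \<nu>) borel snd)"
    by (subst nn_integral_distr) auto
  also have "ennreal (3 * (dist x y)\<^sup>2) + (3 * (\<integral>\<^sup>+ z. ennreal ((dist x z)\<^sup>2) \<partial>distr (\<mu> \<Otimes>\<^sub>M \<nu>) borel fst) + 3 * (\<integral>\<^sup>+ z. ennreal ((dist y z)\<^sup>2) \<partial>distr (\<mu> \<Otimes>\<^sub>M \<nu>) borel snd)) < \<infinity>"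
    using x y unfolding fst snd by (auto simp: ennreal_mult_less_top)
  finally have "transport_cost (\<mu> \<Otimes>\<^sub>M \<nu>) < \<infinity>" .
  moreover have "\<mu> \<Otimes>\<^sub>M \<nu> \<in> couplings \<mu> \<nu>"
    unfolding couplings_def using setsP fst snd P.prob_space_axioms by auto
  ultimately show ?thesis by blast
qed

lemma W2_squared:
  assumes "\<mu> \<in> P2" "\<nu> \<in> P2"
  shows "ennreal ((W2 \<mu> \<nu>)\<^sup>2) = (INF q\<in>couplings \<mu> \<nu>. transport_cost q)"
proof -
  obtain q where q: "q \<in> couplings \<mu> \<nu>" "transport_cost q < \<infinity>"
    using P2_coupling_finite_cost[OF assms] by blast
  then have "(INF q\<in>couplings \<mu> \<nu>. transport_cost q) < top" by (simp add: INF_less_iff) blast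
  then show ?thesis by (simp add: W2_def)
qed

lemma W2_le_transport_cost:
  assumes "\<mu> \<in> P2" "\<nu> \<in> P2" "q \<in> couplings \<mu> \<nu>"
  shows "ennreal ((W2 \<mu> \<nu>)\<^sup>2) \<le> transport_cost q"
  unfolding W2_squared[OF assms(1,2)] by (rule INF_lower[OF assms(3)])

lemma near_optimal_coupling:
  assumes "\<mu> \<in> P2" "\<nu> \<in> P2" "0 < \<zeta>"
  shows "\<exists>q\<in>couplings \<mu> \<nu>. transport_cost q \<le> ennreal ((W2 \<mu> \<nu>)\<^sup>2 + \<zeta>)"
proof -
  have "(INF q\<in>couplings \<mu> \<nu>. transport_cost q) < ennreal ((W2 \<mu> \<nu>)\<^sup>2 + \<zeta>)"
    unfolding W2_squared[OF assms(1,2), symmetric] using assms(3) by (intro ennreal_lessI) (auto simp: add_nonneg_pos)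
  then show ?thesis by (auto simp: INF_less_iff intro: less_imp_le)
qed

lemma fine_countable_partition:
  fixes \<eta> :: real
  assumes "0 < \<eta>"
  obtains f :: "'a::polish_space \<Rightarrow> nat" where "f \<in> measurable borel (count_space UNIV)"
    "\<And>y y'. f y = f y' \<Longrightarrow> dist y y' \<le> \<eta>"
proof -
  obtain D :: "'a set" where D: "countable D" "\<And>X. open X \<Longrightarrow> X \<noteq> {} \<Longrightarrow> \<exists>d\<in>D. d \<in> X"
    using countable_dense_setE by metis
  have "D \<noteq> {}" using D(2)[of UNIV] by auto
  define e where "e = from_nat_into D"
  have ex: "\<exists>n. dist (e n) y < \<eta> / 2" for y
  proof -
    obtain d where "d \<in> D" "d \<in> ball y (\<eta> / 2)" using D(2)[of "ball y (\<eta>/2)"] assms by auto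
    then show ?thesis using from_nat_into_surj[OF D(1), of d] by (auto simp: e_def dist_commute)
  qed
  define f where "f y = (LEAST n. dist (e n) y < \<eta> / 2)" for y
  have f: "dist (e (f y)) y < \<eta> / 2" for y unfolding f_def by (rule LeastI_ex[OF ex])
  show ?thesis
  proof
    show "f \<in> measurable borel (count_space UNIV)" unfolding f_def by measurable
    show "dist y y' \<le> \<eta>" if "f y = f y'" for y y'
      using f[of y] f[of y'] dist_triangle3[of y y' "e (f y)"] that by auto
  qed
qed

text \<open>Exact gluing would require the disintegration of \<open>q\<close> and \<open>q'\<close> over \<open>\<nu>\<close>. Instead the space is cut into
  countably many cells of diameter at most \<open>\<eta>\<close>, and on each cell of the middle space the two couplings
  are joined independently: \<open>G\<close> has the density \<open>1 / \<nu>(C)\<close> with respect to \<open>q \<Otimes>\<^sub>M q'\<close> where both middle points lie in the same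
  cell \<open>C\<close>. The marginals are then exact, and the two middle points are \<open>\<eta>\<close>-close.\<close>

lemma approximate_gluing:
  fixes \<nu> :: "'a::polish_space measure"
  assumes q: "q \<in> couplings \<mu> \<nu>" and q': "q' \<in> couplings \<nu> \<rho>" and "\<nu> \<in> P2" and "0 < \<eta>"
  shows "\<exists>G. sets G = sets (borel :: (('a \<times> 'a) \<times> ('a \<times> 'a)) measure) \<and> distr G borel fst = q \<and> distr G borel snd = q' \<and>
    (AE w in G. dist (snd (fst w)) (fst (snd w)) \<le> \<eta>)"
proof -
  obtain f :: "'a \<Rightarrow> nat" where f[measurable]: "f \<in> measurable borel (count_space UNIV)"
    and f\<eta>: "\<And>y y'. f y = f y' \<Longrightarrow> dist y y' \<le> \<eta>"
    using fine_countable_partition[OF \<open>0 < \<eta>\<close>] by blast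
  note [measurable_cong] = couplingsD(1)[OF q] couplingsD(1)[OF q'] P2D(1)[OF \<open>\<nu> \<in> P2\<close>]
  interpret q: prob_space q by (rule couplingsD(3)[OF q])
  interpret q': prob_space q' by (rule couplingsD(3)[OF q'])
  interpret \<nu>: prob_space \<nu> by (rule P2D(3)[OF \<open>\<nu> \<in> P2\<close>])
  interpret P: pair_prob_space q q' ..
  define p where "p i = emeasure \<nu> {y. f y = i}" for i
  have p_top: "p i \<noteq> \<infinity>" for i unfolding p_def by simp
  have pos: "AE y in \<nu>. p (f y) \<noteq> 0"
  proof (rule AE_I')
    show "(\<Union>i\<in>{i. p i = 0}. {y. f y = i}) \<in> null_sets \<nu>"
      by (intro null_sets_UN') (auto simp: null_sets_def p_def P2D[OF \<open>\<nu> \<in> P2\<close>])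
  qed auto
  define h where "h w = (if f (snd (fst w)) = f (fst (snd w)) then inverse (p (f (snd (fst w)))) else 0)"
    for w :: "('a \<times> 'a) \<times> ('a \<times> 'a)"
  have [measurable]: "fst \<in> measurable q borel" "snd \<in> measurable q borel"
    "fst \<in> measurable q' borel" "snd \<in> measurable q' borel"
    using borel_measurable_fst_snd[where 'a = 'a and 'b = 'a]
    unfolding measurable_cong_sets[OF couplingsD(1)[OF q] refl] measurable_cong_sets[OF couplingsD(1)[OF q'] refl]
    by blast+
  have "Measurable.pred (q \<Otimes>\<^sub>M q') (\<lambda>w. \<exists>i. f (snd (fst w)) = i \<and> f (fst (snd w)) = i)" by measurable
  moreover have "(\<lambda>w. \<exists>i. f (snd (fst w)) = i \<and> f (fst (snd w)) = i) = (\<lambda>w. f (snd (fst w)) = f (fst (snd w)))"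
    by (intro ext) auto
  ultimately have [measurable]: "Measurable.pred (q \<Otimes>\<^sub>M q') (\<lambda>w. f (snd (fst w)) = f (fst (snd w)))"
    by (rule back_subst)
  have [measurable]: "h \<in> borel_measurable (q \<Otimes>\<^sub>M q')" unfolding h_def by measurable
  define G where "G = density (q \<Otimes>\<^sub>M q') h"
  have setsG: "sets G = sets borel"
    unfolding G_def sets_density
    using sets_pair_measure_cong[OF couplingsD(1)[OF q] couplingsD(1)[OF q']] by (simp only: borel_prod)
  have [measurable]: "fst \<in> measurable G borel" "snd \<in> measurable G borel"
    unfolding measurable_cong_sets[OF setsG refl] by (rule borel_measurable_fst_snd)+
  have inner1: "(\<integral>\<^sup>+ z'. h (z, z') \<partial>q') = 1" if "p (f (snd z)) \<noteq> 0" for z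
  proof -
    have "(\<integral>\<^sup>+ z'. h (z, z') \<partial>q') = (\<integral>\<^sup>+ z'. inverse (p (f (snd z))) * indicator {z'. f (fst z') = f (snd z)} z' \<partial>q')"
      by (intro nn_integral_cong) (auto simp: h_def split: split_indicator)
    also have "\<dots> = inverse (p (f (snd z))) * emeasure q' {z'. f (fst z') = f (snd z)}"
      by (intro nn_integral_cmult_indicator) measurable
    also have "emeasure q' {z'. f (fst z') = f (snd z)} = emeasure (distr q' borel fst) {y. f y = f (snd z)}"
      by (subst emeasure_distr) (auto simp: couplingsD[OF q'] vimage_def)
    also have "\<dots> = p (f (snd z))" by (simp add: couplingsD[OF q'] p_def)
    finally show ?thesis
      using that p_top[of "f (snd z)"] ennreal_divide_self[of "p (f (snd z))"]
      by (simp add: divide_ennreal_def mult.commute less_top)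
  qed
  have inner2: "(\<integral>\<^sup>+ z. h (z, z') \<partial>q) = 1" if "p (f (fst z')) \<noteq> 0" for z'
  proof -
    have "(\<integral>\<^sup>+ z. h (z, z') \<partial>q) = (\<integral>\<^sup>+ z. inverse (p (f (fst z'))) * indicator {z. f (snd z) = f (fst z')} z \<partial>q)"
      by (intro nn_integral_cong) (auto simp: h_def split: split_indicator)
    also have "\<dots> = inverse (p (f (fst z'))) * emeasure q {z. f (snd z) = f (fst z')}"
      by (intro nn_integral_cmult_indicator) measurable
    also have "emeasure q {z. f (snd z) = f (fst z')} = emeasure (distr q borel snd) {y. f y = f (fst z')}"
      by (subst emeasure_distr) (auto simp: couplingsD[OF q] vimage_def)
    also have "\<dots> = p (f (fst z'))" by (simp add: couplingsD[OF q] p_def)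
    finally show ?thesis
      using that p_top[of "f (fst z')"] ennreal_divide_self[of "p (f (fst z'))"]
      by (simp add: divide_ennreal_def mult.commute less_top)
  qed
  have pos1: "AE z in q. p (f (snd z)) \<noteq> 0"
    using AE_distrD[of snd q borel "\<lambda>y. p (f y) \<noteq> 0"] pos unfolding couplingsD(5)[OF q] by simp
  have pos2: "AE z in q'. p (f (fst z)) \<noteq> 0"
    using AE_distrD[of fst q' borel "\<lambda>y. p (f y) \<noteq> 0"] pos unfolding couplingsD(4)[OF q'] by simp
  have eG: "emeasure G {w \<in> space G. Q w} = (\<integral>\<^sup>+ w. h w * indicator {w. Q w} w \<partial>(q \<Otimes>\<^sub>M q'))"
    if "Measurable.pred (q \<Otimes>\<^sub>M q') Q" for Q
    unfolding G_def using that
    by (subst emeasure_density) (auto intro!: nn_integral_cong simp: space_density split: split_indicator)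
  have "distr G borel fst = q"
  proof (rule measure_eqI)
    fix A assume "A \<in> sets (distr G borel fst)"
    then have A[measurable]: "A \<in> sets borel" by simp
    have "emeasure (distr G borel fst) A = emeasure G {w \<in> space G. fst w \<in> A}"
      by (subst emeasure_distr) (auto intro!: arg_cong2[where f=emeasure])
    also have "\<dots> = (\<integral>\<^sup>+ w. h w * indicator {w. fst w \<in> A} w \<partial>(q \<Otimes>\<^sub>M q'))"
      by (rule eG) measurable
    also have "\<dots> = (\<integral>\<^sup>+ z. \<integral>\<^sup>+ z'. h (z, z') * indicator A z \<partial>q' \<partial>q)"
      by (subst q'.nn_integral_fst[symmetric]) (auto intro!: nn_integral_cong split: split_indicator)
    also have "\<dots> = (\<integral>\<^sup>+ z. indicator A z \<partial>q)"
      by (rule nn_integral_cong_AE) (use pos1 in \<open>auto simp: nn_integral_multc inner1\<close>)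
    also have "\<dots> = emeasure q A" using A by (intro nn_integral_indicator) (simp add: couplingsD[OF q])
    finally show "emeasure (distr G borel fst) A = emeasure q A" .
  qed (simp add: couplingsD[OF q])
  moreover have "distr G borel snd = q'"
  proof (rule measure_eqI)
    fix A assume "A \<in> sets (distr G borel snd)"
    then have A[measurable]: "A \<in> sets borel" by simp
    have "emeasure (distr G borel snd) A = emeasure G {w \<in> space G. snd w \<in> A}"
      by (subst emeasure_distr) (auto intro!: arg_cong2[where f=emeasure])
    also have "\<dots> = (\<integral>\<^sup>+ w. h w * indicator {w. snd w \<in> A} w \<partial>(q \<Otimes>\<^sub>M q'))"
      by (rule eG) measurable
    also have "\<dots> = (\<integral>\<^sup>+ z'. \<integral>\<^sup>+ z. h (z, z') * indicator A z' \<partial>q \<partial>q')"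
      by (subst P.nn_integral_snd[symmetric]) (auto intro!: nn_integral_cong split: split_indicator)
    also have "\<dots> = (\<integral>\<^sup>+ z. indicator A z \<partial>q')"
      by (rule nn_integral_cong_AE) (use pos2 in \<open>auto simp: nn_integral_multc inner2\<close>)
    also have "\<dots> = emeasure q' A" using A by (intro nn_integral_indicator) (simp add: couplingsD[OF q'])
    finally show "emeasure (distr G borel snd) A = emeasure q' A" .
  qed (simp add: couplingsD[OF q'])
  moreover have "AE w in G. dist (snd (fst w)) (fst (snd w)) \<le> \<eta>"
    unfolding G_def by (subst AE_density) (auto simp: h_def intro!: f\<eta> split: if_splits)
  ultimately show ?thesis using setsG by blast
qed

text \<open>Let \<open>a\<close> and \<open>c\<close> be the distances from a point \<open>y\<close> to two points of distance \<open>D \<le> a + c + \<eta>\<close>. By the identity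
  \<open>a\<^sup>2 / t + c\<^sup>2 / (1 - t) = (a + c)\<^sup>2 + (a - t (a + c))\<^sup>2 / (t (1 - t))\<close> the left hand side is almost \<open>D\<^sup>2\<close> only
  if \<open>a + c\<close> is almost \<open>D\<close> and \<open>a\<close> is almost \<open>t D\<close>. The second conclusion quantifies the defect for
  \<open>y\<close> that miss the expected range of distances by \<open>\<beta>\<close>.\<close>

lemma midpoint_defect:
  fixes a c D D1 D2 t \<beta> \<eta> :: real
  assumes "0 \<le> a" "0 \<le> c" "0 \<le> D" "D \<le> a + c + \<eta>" "D1 \<le> D" "D \<le> D2" "0 < t" "t < 1" "0 < \<eta>" "\<eta> \<le> \<beta> / 2"
  shows "D\<^sup>2 \<le> a\<^sup>2 / t + c\<^sup>2 / (1 - t) + 2 * \<eta> * D2"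
    and "a < t * D1 - \<beta> \<or> t * D2 + \<beta> < a \<Longrightarrow> \<beta>\<^sup>2 / 4 + D\<^sup>2 \<le> a\<^sup>2 / t + c\<^sup>2 / (1 - t) + 2 * \<eta> * D2"
proof -
  define S where "S = a + c"
  have id: "a\<^sup>2 / t + c\<^sup>2 / (1 - t) = S\<^sup>2 + (a - t * S)\<^sup>2 / (t * (1 - t))"
    using assms(7,8) by (simp add: S_def field_simps power2_eq_square)
  have "t * (1 - t) \<le> 1" using assms(7,8) by (simp add: mult_le_one)
  then have "(a - t * S)\<^sup>2 \<le> (a - t * S)\<^sup>2 / (t * (1 - t))"
    using assms(7,8) by (simp add: pos_le_divide_eq mult_left_le)
  then have 1: "S\<^sup>2 + (a - t * S)\<^sup>2 \<le> a\<^sup>2 / t + c\<^sup>2 / (1 - t)" unfolding id by simp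
  have 2: "D\<^sup>2 - 2 * \<eta> * D2 \<le> S\<^sup>2"
  proof -
    have DD: "\<eta> * D \<le> \<eta> * D2" using assms by (intro mult_left_mono) auto
    show ?thesis
    proof (cases "\<eta> \<le> D")
      case True
      have "(D - \<eta>)\<^sup>2 \<le> S\<^sup>2" using True assms by (intro power_mono) (auto simp: S_def)
      then have "D\<^sup>2 - 2 * (\<eta> * D) + \<eta>\<^sup>2 \<le> S\<^sup>2" by (simp add: power2_diff mult_ac)
      then show ?thesis using DD zero_le_power2[of \<eta>] by linarith
    next
      case False
      then have "D * D \<le> \<eta> * D" using assms by (intro mult_right_mono) auto
      moreover have "0 \<le> \<eta> * D" using assms by simp
      ultimately have "D\<^sup>2 - 2 * \<eta> * D2 \<le> 0" using DD unfolding power2_eq_square by linarith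
      then show ?thesis using zero_le_power2[of S] by linarith
    qed
  qed
  show "D\<^sup>2 \<le> a\<^sup>2 / t + c\<^sup>2 / (1 - t) + 2 * \<eta> * D2"
    using 1 2 zero_le_power2[of "a - t * S"] by linarith
  assume bad: "a < t * D1 - \<beta> \<or> t * D2 + \<beta> < a"
  show "\<beta>\<^sup>2 / 4 + D\<^sup>2 \<le> a\<^sup>2 / t + c\<^sup>2 / (1 - t) + 2 * \<eta> * D2"
  proof (cases "\<beta> / 2 \<le> \<bar>a - t * S\<bar>")
    case True
    then have "(\<beta> / 2)\<^sup>2 \<le> (a - t * S)\<^sup>2"
      using assms by (metis abs_le_square_iff abs_of_nonneg less_eq_real_def order_trans)
    then show ?thesis using 1 2 by (simp add: power2_eq_square)
  next
    case False
    then have F: "t * S < a + \<beta> / 2" "a - \<beta> / 2 < t * S" by (auto simp: abs_if split: if_splits)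
    from bad show ?thesis
    proof
      assume "a < t * D1 - \<beta>"
      then have "t * S < t * D1 - \<beta> / 2" using F by linarith
      then have "t * (D1 - S) > \<beta> / 2" by (simp add: algebra_simps)
      moreover have "\<beta> / 2 > 0" using assms by linarith
      ultimately have "D1 - S > 0" using assms by (metis less_trans zero_less_mult_pos)
      then have "t * (D1 - S) \<le> D1 - S" using assms by (simp add: mult_left_le_one_le)
      then have False using \<open>t * (D1 - S) > \<beta> / 2\<close> assms unfolding S_def by linarith
      then show ?thesis ..
    next
      assume "t * D2 + \<beta> < a"
      then have "t * (S - D2) > \<beta> / 2" using F by (simp add: algebra_simps)
      moreover have "\<beta> / 2 > 0" using assms by linarith
      ultimately have "S - D2 > 0" using assms by (metis less_trans zero_less_mult_pos)
      then have "t * (S - D2) \<le> S - D2" using assms by (simp add: mult_left_le_one_le)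
      then have "D + \<beta> / 2 \<le> S" using \<open>t * (S - D2) > \<beta> / 2\<close> assms by linarith
      then have "(D + \<beta> / 2)\<^sup>2 \<le> S\<^sup>2" using assms by (intro power_mono) auto
      moreover have "0 \<le> D * \<beta>" "0 \<le> \<eta> * D2" using assms by auto
      moreover have "(D + \<beta> / 2)\<^sup>2 = D\<^sup>2 + D * \<beta> + \<beta>\<^sup>2 / 4" by (simp add: power2_sum power_divide)
      ultimately show ?thesis using 1 zero_le_power2[of "a - t * S"] by linarith
    qed
  qed
qed

text \<open>Glue almost optimal couplings of \<open>\<mu>0, \<mu>t\<close> and of \<open>\<mu>t, \<mu>1\<close>. Integrating \<open>a\<^sup>2 / t + c\<^sup>2 / (1 - t)\<close> gives at
  most \<open>W\<^sup>2\<close> up to a small error, whereas the integral of \<open>D\<^sup>2\<close> is at least \<open>W\<^sup>2\<close>. So the defect of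
  \<open>midpoint_defect\<close> has a small integral, and the points at a wrong distance have measure \<open>0\<close>.\<close>

theorem W2_geodesic_localization:
  fixes \<mu>0 \<mu>t \<mu>1 :: "'a::polish_space measure"
  assumes P: "\<mu>0 \<in> P2" "\<mu>t \<in> P2" "\<mu>1 \<in> P2" and t: "0 < t" "t < 1"
    and W: "W2 \<mu>0 \<mu>t = t * W2 \<mu>0 \<mu>1" "W2 \<mu>t \<mu>1 = (1 - t) * W2 \<mu>0 \<mu>1"
    and s0: "AE y in \<mu>0. dist x y \<le> \<epsilon>" and s1: "AE z in \<mu>1. R1 \<le> dist x z \<and> dist x z \<le> R2"
  shows "AE y in \<mu>t. t * (R1 - \<epsilon>) - \<epsilon> \<le> dist x y \<and> dist x y \<le> t * (R2 + \<epsilon>) + \<epsilon>"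
proof -
  define W where "W = W2 \<mu>0 \<mu>1"
  define bad where "bad \<beta> = {y. dist x y < t * (R1 - \<epsilon>) - \<epsilon> - \<beta> \<or> t * (R2 + \<epsilon>) + \<epsilon> + \<beta> < dist x y}" for \<beta>
  interpret \<mu>0: prob_space \<mu>0 by (rule P2D(3)[OF P(1)])
  interpret \<mu>t: prob_space \<mu>t by (rule P2D(3)[OF P(2)])
  interpret \<mu>1: prob_space \<mu>1 by (rule P2D(3)[OF P(3)])
  have D20: "0 \<le> R2 + \<epsilon>"
  proof -
    have "AE y in \<mu>0. 0 \<le> \<epsilon>" using s0 by eventually_elim (meson order_trans zero_le_dist)
    moreover have "AE z in \<mu>1. 0 \<le> R2" using s1 by eventually_elim (meson order_trans zero_le_dist)
    ultimately show ?thesis by simp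
  qed
  have bad_meas: "bad \<beta> \<in> sets \<mu>t" for \<beta> unfolding bad_def P2D(1)[OF P(2)] by measurable
  \<comment> \<open>Markov's inequality for the defect; \<open>\<zeta>\<close> bounds both the lack of optimality and the gluing error.\<close>
  have est: "\<beta>\<^sup>2 / 4 * measure \<mu>t (bad \<beta>) \<le> \<zeta> * (1 / t + 1 / (1 - t) + 2 * (R2 + \<epsilon>))" if \<beta>: "0 < \<beta>" and \<zeta>: "0 < \<zeta>" for \<beta> \<zeta>
  proof -
    define \<eta> where "\<eta> = min (\<beta> / 2) \<zeta>"
    have \<eta>: "0 < \<eta>" "\<eta> \<le> \<beta> / 2" "\<eta> \<le> \<zeta>" using \<beta> \<zeta> by (auto simp: \<eta>_def)
    obtain q where q: "q \<in> couplings \<mu>0 \<mu>t" "transport_cost q \<le> ennreal ((t * W)\<^sup>2 + \<zeta>)"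
      using near_optimal_coupling[OF P(1,2) \<zeta>] unfolding W W_def by blast
    obtain q' where q': "q' \<in> couplings \<mu>t \<mu>1" "transport_cost q' \<le> ennreal (((1 - t) * W)\<^sup>2 + \<zeta>)"
      using near_optimal_coupling[OF P(2,3) \<zeta>] unfolding W W_def by blast
    obtain G where G: "sets G = sets (borel :: (('a \<times> 'a) \<times> ('a \<times> 'a)) measure)"
      "distr G borel fst = q" "distr G borel snd = q'" "AE w in G. dist (snd (fst w)) (fst (snd w)) \<le> \<eta>"
      using approximate_gluing[OF q(1) q'(1) P(2) \<eta>(1)] by blast
    note [measurable_cong] = G(1) couplingsD(1)[OF q(1)] couplingsD(1)[OF q'(1)]
    note mfs = borel_measurable_fst_snd
    have [measurable]: "fst \<in> measurable G borel" "snd \<in> measurable G borel"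
      unfolding measurable_cong_sets[OF G(1) refl] by (rule mfs)+
    have [measurable]: "(\<lambda>w. fst (fst w)) \<in> measurable G borel" "(\<lambda>w. snd (fst w)) \<in> measurable G borel"
      "(\<lambda>w. fst (snd w)) \<in> measurable G borel" "(\<lambda>w. snd (snd w)) \<in> measurable G borel"
      by (rule measurable_compose[OF _ mfs(1)] measurable_compose[OF _ mfs(2)]; measurable)+
    have d0: "distr G borel (\<lambda>w. fst (fst w)) = \<mu>0" and dt: "distr G borel (\<lambda>w. snd (fst w)) = \<mu>t"
      and d1: "distr G borel (\<lambda>w. snd (snd w)) = \<mu>1"
      using distr_distr[of fst borel borel fst G] distr_distr[of snd borel borel fst G] distr_distr[of snd borel borel snd G]
        G(2,3) couplingsD(4,5)[OF q(1)] couplingsD(5)[OF q'(1)]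
      by (simp_all add: comp_def mfs)
    have pG: "prob_space G"
    proof (rule prob_spaceI)
      have "emeasure G (space G) = emeasure (distr G borel (\<lambda>w. fst (fst w))) UNIV"
        by (subst emeasure_distr) auto
      then show "emeasure G (space G) = 1"
        using \<mu>0.emeasure_space_1 P2D[OF P(1)] by (simp add: d0)
    qed
    interpret G: prob_space G by (rule pG)
    define q'' where "q'' = distr G borel (\<lambda>w. (fst (fst w), snd (snd w)))"
    have q'': "q'' \<in> couplings \<mu>0 \<mu>1"
    proof -
      have m: "(\<lambda>w. (fst (fst w), snd (snd w))) \<in> measurable G borel" by measurable
      note mfs' = mfs[where 'a = 'a and 'b = 'a]
      have "distr q'' borel fst = \<mu>0" "distr q'' borel snd = \<mu>1"
        unfolding q''_def using d0 d1 by (subst distr_distr; simp add: comp_def m mfs')+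
      then show ?thesis
        using G.prob_space_distr[OF m] by (simp add: couplings_def q''_def)
    qed
    have a0: "AE w in G. dist x (fst (fst w)) \<le> \<epsilon>"
      using AE_distrD[of "\<lambda>w. fst (fst w)" G borel "\<lambda>y. dist x y \<le> \<epsilon>"] s0 unfolding d0 by simp
    have a1: "AE w in G. R1 \<le> dist x (snd (snd w)) \<and> dist x (snd (snd w)) \<le> R2"
      using AE_distrD[of "\<lambda>w. snd (snd w)" G borel "\<lambda>z. R1 \<le> dist x z \<and> dist x z \<le> R2"] s1 unfolding d1 by simp
    define a where "a w = dist (fst (fst w)) (snd (fst w))" for w :: "('a \<times> 'a) \<times> ('a \<times> 'a)"
    define c where "c w = dist (fst (snd w)) (snd (snd w))" for w :: "('a \<times> 'a) \<times> ('a \<times> 'a)"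
    define D where "D w = dist (fst (fst w)) (snd (snd w))" for w :: "('a \<times> 'a) \<times> ('a \<times> 'a)"
    define I :: "('a \<times> 'a) \<times> ('a \<times> 'a) \<Rightarrow> real" where "I w = indicator (bad \<beta>) (snd (fst w))" for w
    have [measurable]: "bad \<beta> \<in> sets borel" using bad_meas P2D(1)[OF P(2)] by simp
    have [measurable]: "a \<in> borel_measurable G" "c \<in> borel_measurable G" "D \<in> borel_measurable G" "I \<in> borel_measurable G"
      unfolding a_def c_def D_def I_def by measurable
    have I1: "(\<integral>\<^sup>+ w. ennreal ((a w)\<^sup>2) \<partial>G) = transport_cost q"
      unfolding transport_cost_def G(2)[symmetric] a_def by (subst nn_integral_distr) auto
    have I2: "(\<integral>\<^sup>+ w. ennreal ((c w)\<^sup>2) \<partial>G) = transport_cost q'"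
      unfolding transport_cost_def G(3)[symmetric] c_def by (subst nn_integral_distr) auto
    have I3: "(\<integral>\<^sup>+ w. ennreal ((D w)\<^sup>2) \<partial>G) = transport_cost q''"
      unfolding transport_cost_def q''_def D_def by (subst nn_integral_distr) auto
    have I4: "(\<integral>\<^sup>+ w. ennreal (I w) \<partial>G) = ennreal (measure \<mu>t (bad \<beta>))"
    proof -
      have "(\<integral>\<^sup>+ w. ennreal (I w) \<partial>G) = (\<integral>\<^sup>+ y. indicator (bad \<beta>) y \<partial>\<mu>t)"
        unfolding dt[symmetric] by (subst nn_integral_distr) (auto simp: I_def intro!: nn_integral_cong split: split_indicator)
      then show ?thesis using bad_meas by (simp add: \<mu>t.emeasure_eq_measure)
    qed
    have pointwise: "AE w in G. \<beta>\<^sup>2 / 4 * I w + (1 * (D w)\<^sup>2 + 0) \<le> 1 / t * (a w)\<^sup>2 + (1 / (1 - t) * (c w)\<^sup>2 + 2 * \<eta> * (R2 + \<epsilon>))"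
      using a0 a1 G(4)
    proof eventually_elim
      case (elim w)
      have D: "D w \<le> a w + c w + \<eta>"
        unfolding a_def c_def D_def
        using dist_triangle[of "fst (fst w)" "snd (snd w)" "snd (fst w)"]
          dist_triangle[of "snd (fst w)" "snd (snd w)" "fst (snd w)"] elim by linarith
      have D': "R1 - \<epsilon> \<le> D w" "D w \<le> R2 + \<epsilon>"
        unfolding D_def using elim dist_triangle[of x "snd (snd w)" "fst (fst w)"]
          dist_triangle3[of "fst (fst w)" "snd (snd w)" x] by linarith+
      have nn: "0 \<le> a w" "0 \<le> c w" "0 \<le> D w" by (auto simp: a_def c_def D_def)
      note md = midpoint_defect[OF nn D D' t \<eta>(1,2)]
      have "a w < t * (R1 - \<epsilon>) - \<beta> \<or> t * (R2 + \<epsilon>) + \<beta> < a w" if "snd (fst w) \<in> bad \<beta>"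
        using that elim dist_triangle[of x "snd (fst w)" "fst (fst w)"]
          dist_triangle3[of "fst (fst w)" "snd (fst w)" x] unfolding bad_def a_def by auto
      then show ?case using md by (auto simp: I_def split: split_indicator)
    qed
    have "ennreal (\<beta>\<^sup>2 / 4 * measure \<mu>t (bad \<beta>) + (1 * W\<^sup>2 + 0))
      = ennreal (\<beta>\<^sup>2 / 4) * (\<integral>\<^sup>+ w. ennreal (I w) \<partial>G) + (ennreal 1 * ennreal (W\<^sup>2) + ennreal 0)"
      unfolding I4 by (rule ennreal_affine) auto
    also have "\<dots> \<le> ennreal (\<beta>\<^sup>2 / 4) * (\<integral>\<^sup>+ w. ennreal (I w) \<partial>G) + (ennreal 1 * (\<integral>\<^sup>+ w. ennreal ((D w)\<^sup>2) \<partial>G) + ennreal 0)"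
      unfolding I3 W_def using W2_le_transport_cost[OF P(1,3) q''] by (intro add_left_mono add_right_mono mult_left_mono) auto
    also have "\<dots> = (\<integral>\<^sup>+ w. ennreal (\<beta>\<^sup>2 / 4) * ennreal (I w) + (ennreal 1 * ennreal ((D w)\<^sup>2) + ennreal 0) \<partial>G)"
      by (simp add: nn_integral_add nn_integral_cmult)
    also have "\<dots> = (\<integral>\<^sup>+ w. ennreal (\<beta>\<^sup>2 / 4 * I w + (1 * (D w)\<^sup>2 + 0)) \<partial>G)"
      by (intro nn_integral_cong ennreal_affine[symmetric]) (auto simp: I_def)
    also have "\<dots> \<le> (\<integral>\<^sup>+ w. ennreal (1 / t * (a w)\<^sup>2 + (1 / (1 - t) * (c w)\<^sup>2 + 2 * \<eta> * (R2 + \<epsilon>))) \<partial>G)"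
      by (rule nn_integral_mono_AE) (use pointwise in eventually_elim, rule ennreal_leI)
    also have "\<dots> = (\<integral>\<^sup>+ w. ennreal (1 / t) * ennreal ((a w)\<^sup>2) + (ennreal (1 / (1 - t)) * ennreal ((c w)\<^sup>2) + ennreal (2 * \<eta> * (R2 + \<epsilon>))) \<partial>G)"
      using t \<eta> D20 by (intro nn_integral_cong ennreal_affine) auto
    also have "\<dots> = ennreal (1 / t) * transport_cost q + (ennreal (1 / (1 - t)) * transport_cost q' + ennreal (2 * \<eta> * (R2 + \<epsilon>)))"
      unfolding I1[symmetric] I2[symmetric]
      by (simp add: nn_integral_add nn_integral_cmult G.emeasure_space_1)
    also have "\<dots> \<le> ennreal (1 / t) * ennreal ((t * W)\<^sup>2 + \<zeta>) + (ennreal (1 / (1 - t)) * ennreal (((1 - t) * W)\<^sup>2 + \<zeta>) + ennreal (2 * \<eta> * (R2 + \<epsilon>)))"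
      using q(2) q'(2) by (intro add_mono mult_left_mono) auto
    also have "\<dots> = ennreal (1 / t * ((t * W)\<^sup>2 + \<zeta>) + (1 / (1 - t) * (((1 - t) * W)\<^sup>2 + \<zeta>) + 2 * \<eta> * (R2 + \<epsilon>)))"
      using t \<zeta> \<eta> D20 by (intro ennreal_affine[symmetric]) auto
    finally have "\<beta>\<^sup>2 / 4 * measure \<mu>t (bad \<beta>) + W\<^sup>2 \<le> 1 / t * ((t * W)\<^sup>2 + \<zeta>) + (1 / (1 - t) * (((1 - t) * W)\<^sup>2 + \<zeta>) + 2 * \<eta> * (R2 + \<epsilon>))"
      using t \<zeta> \<eta> D20 by (subst (asm) ennreal_le_iff) (auto intro!: add_nonneg_nonneg)
    also have "\<dots> = W\<^sup>2 + \<zeta> * (1 / t + 1 / (1 - t)) + 2 * \<eta> * (R2 + \<epsilon>)"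
    proof -
      have "1 / t * ((t * W)\<^sup>2 + \<zeta>) = t * W\<^sup>2 + \<zeta> * (1 / t)" "1 / (1 - t) * (((1 - t) * W)\<^sup>2 + \<zeta>) = (1 - t) * W\<^sup>2 + \<zeta> * (1 / (1 - t))"
        using t by (simp_all add: power2_eq_square distrib_left mult.assoc)
      then show ?thesis by (simp add: algebra_simps)
    qed
    also have "\<dots> \<le> W\<^sup>2 + \<zeta> * (1 / t + 1 / (1 - t)) + 2 * \<zeta> * (R2 + \<epsilon>)"
      using \<eta> D20 by (intro add_left_mono mult_right_mono) auto
    finally show ?thesis by (simp add: algebra_simps)
  qed
  have null: "measure \<mu>t (bad \<beta>) = 0" if \<beta>: "0 < \<beta>" for \<beta>
  proof (rule ccontr)
    assume "measure \<mu>t (bad \<beta>) \<noteq> 0"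
    then have "0 < \<beta>\<^sup>2 / 4 * measure \<mu>t (bad \<beta>)" (is "0 < ?e") using \<beta> by (auto simp: zero_less_measure_iff)
    define K where "K = 1 / t + 1 / (1 - t) + 2 * (R2 + \<epsilon>)"
    have "0 < 1 / t" "0 < 1 / (1 - t)" using t by auto
    moreover have "0 \<le> 2 * (R2 + \<epsilon>)" using D20 by simp
    ultimately have K: "0 < K" unfolding K_def by (intro add_pos_nonneg add_pos_pos)
    have "?e \<le> ?e / (2 * K) * K"
      using est[OF \<beta>, of "?e / (2 * K)"] K \<open>0 < ?e\<close> unfolding K_def by simp
    also have "\<dots> = ?e / 2" using K by simp
    finally show False using \<open>0 < ?e\<close> by argo
  qed
  have "AE y in \<mu>t. \<forall>n. y \<notin> bad (inverse (real (Suc n)))"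
  proof (subst AE_all_countable, rule allI)
    fix n
    have "emeasure \<mu>t (bad (inverse (real (Suc n)))) = 0"
      unfolding \<mu>t.emeasure_eq_measure by (subst null) auto
    then show "AE y in \<mu>t. y \<notin> bad (inverse (real (Suc n)))"
      using bad_meas by (intro AE_not_in null_setsI)
  qed
  then show ?thesis
  proof eventually_elim
    case (elim y)
    have lim: "(\<lambda>n. c + inverse (real (Suc n))) \<longlonglongrightarrow> c + 0" "(\<lambda>n. c - inverse (real (Suc n))) \<longlonglongrightarrow> c - 0" for c
      by (intro tendsto_intros LIMSEQ_inverse_real_of_nat)+
    have "t * (R1 - \<epsilon>) - \<epsilon> - 0 \<le> dist x y"
      using elim by (intro LIMSEQ_le_const2[OF lim(2)]) (auto simp: bad_def not_less)
    moreover have "dist x y \<le> t * (R2 + \<epsilon>) + \<epsilon> + 0"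
      using elim by (intro LIMSEQ_le_const[OF lim(1)]) (auto simp: bad_def not_less)
    ultimately show ?case by simp
  qed
qed

section \<open>The Brunn-Minkowski inequality for annuli\<close>

lemma borel_measurable_dist_to [measurable]: "(\<lambda>y. dist x y) \<in> borel_measurable (borel :: 'a::metric_space measure)"
  by (intro borel_measurable_continuous_onI continuous_intros)

lemma metric_measure_spaceD:
  assumes "metric_measure_space m"
  shows "sets m = sets borel" "space m = UNIV"
  using assms sets_eq_imp_space_eq[of m borel] by (auto simp: metric_measure_space_def)

text \<open>Balls of finite measure cover the space, and countably many of them suffice by Lindelof's theorem.\<close>

lemma metric_measure_space_sigma_finite:
  assumes m: "metric_measure_space (m :: 'a::polish_space measure)"
  shows "sigma_finite_measure m"
proof
  define F where "F = {B :: 'a set. open B \<and> emeasure m B < \<infinity>}"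
  obtain F' where F': "F' \<subseteq> F" "countable F'" "\<Union>F' = \<Union>F"
    by (rule Lindelof[of F]) (auto simp: F_def)
  have "\<Union>F = UNIV"
  proof (rule set_eqI, simp)
    fix x
    obtain r where "r > 0" "emeasure m (ball x r) < \<infinity>" using m by (auto simp: metric_measure_space_def)
    then show "\<exists>B\<in>F. x \<in> B" by (intro bexI[of _ "ball x r"]) (auto simp: F_def)
  qed
  then have "\<Union>F' = space m" using F' metric_measure_spaceD[OF m] by simp
  moreover have "F' \<subseteq> sets m"
  proof
    fix B assume "B \<in> F'"
    then have "open B" using F'(1) by (auto simp: F_def)
    then show "B \<in> sets m" unfolding metric_measure_spaceD(1)[OF m] by (rule borel_open)
  qed
  moreover have "\<forall>a\<in>F'. emeasure m a \<noteq> \<infinity>"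
  proof
    fix B assume "B \<in> F'"
    then have "emeasure m B < \<infinity>" using F'(1) by (auto simp: F_def)
    then show "emeasure m B \<noteq> \<infinity>" by simp
  qed
  ultimately show "\<exists>A. countable A \<and> A \<subseteq> sets m \<and> \<Union>A = space m \<and> (\<forall>a\<in>A. emeasure m a \<noteq> \<infinity>)"
    using F'(2) by (intro exI[of _ F'] conjI)
qed

lemma ac_density_properties:
  assumes "sigma_finite_measure m" "sets \<nu> = sets m" and ac: "absolutely_continuous m \<nu>"
  shows "ac_density m \<nu> \<in> borel_measurable m" "density m (ac_density m \<nu>) = \<nu>"
proof -
  interpret sigma_finite_measure m by fact
  obtain f where f: "f \<in> borel_measurable m" "density m f = \<nu>" using Radon_Nikodym[OF ac assms(2)] by blast
  have "lebesgue_decomposition m \<nu> f (null_measure m)"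
    unfolding lebesgue_decomposition_def using f by (auto intro!: bexI[of _ "{}"])
  then have "\<exists>\<rho> \<nu>s. lebesgue_decomposition m \<nu> \<rho> \<nu>s" by blast
  then obtain \<nu>s where d: "lebesgue_decomposition m \<nu> (ac_density m \<nu>) \<nu>s"
    using someI_ex[of "\<lambda>\<rho>. \<exists>\<nu>s. lebesgue_decomposition m \<nu> \<rho> \<nu>s"] unfolding ac_density_def by blast
  then show meas: "ac_density m \<nu> \<in> borel_measurable m" by (simp add: lebesgue_decomposition_def)
  obtain B where B: "B \<in> sets m" "emeasure m B = 0" "emeasure \<nu>s (space m - B) = 0"
    and s: "sets \<nu>s = sets m" and eq: "\<And>A. A \<in> sets m \<Longrightarrow> emeasure \<nu> A = emeasure (density m (ac_density m \<nu>)) A + emeasure \<nu>s A"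
    using d by (auto simp: lebesgue_decomposition_def)
  have "emeasure \<nu> B = 0" using ac B by (auto simp: absolutely_continuous_def null_sets_def)
  then have "emeasure \<nu>s B = 0" using eq[OF B(1)] by simp
  have "emeasure \<nu>s A = 0" if A: "A \<in> sets m" for A
  proof -
    have "emeasure \<nu>s A \<le> emeasure \<nu>s (B \<union> (space m - B))"
      using A B s sets.sets_into_space[OF A] by (intro emeasure_mono) auto
    also have "\<dots> \<le> emeasure \<nu>s B + emeasure \<nu>s (space m - B)"
      using B s by (intro emeasure_subadditive) auto
    finally show ?thesis using B \<open>emeasure \<nu>s B = 0\<close> by simp
  qed
  then show "density m (ac_density m \<nu>) = \<nu>"
    using eq assms(2) by (intro measure_eqI) auto
qed

lemma ennpowr_ennreal: "0 < a \<Longrightarrow> 0 \<le> c \<Longrightarrow> ennpowr (ennreal c) a = ennreal (c powr a)"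
  by (auto simp: ennpowr_def)

lemma ennpowr_mono:
  assumes "0 < a" "x \<le> y"
  shows "ennpowr x a \<le> ennpowr y a"
proof (cases "y = \<infinity>")
  case True
  then show ?thesis using assms by (simp add: ennpowr_def)
next
  case False
  then have "x \<noteq> \<infinity>" using assms by (auto simp: top_unique)
  moreover have "enn2real x \<le> enn2real y" using assms False by (intro enn2real_mono) (auto simp: less_top)
  ultimately show ?thesis using assms False
    by (auto simp: ennpowr_def intro!: ennreal_leI powr_mono2)
qed

text \<open>The tangent of the concave function \<open>x powr \<alpha>\<close> at \<open>1 / M\<close>.\<close>

lemma powr_le_tangent:
  fixes x M \<alpha> :: real
  assumes "0 \<le> x" "0 < M" "0 < \<alpha>" "\<alpha> < 1"
  shows "x powr \<alpha> \<le> \<alpha> * M powr (1 - \<alpha>) * x + (1 - \<alpha>) * M powr (- \<alpha>)"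
proof (cases "x = 0")
  case False
  have "(x * M) powr \<alpha> * 1 powr (1 - \<alpha>) \<le> \<alpha> * (x * M) + (1 - \<alpha>) * 1"
    using assms False by (intro Youngs_inequality_0) auto
  then have "M powr (- \<alpha>) * (x * M) powr \<alpha> \<le> M powr (- \<alpha>) * (\<alpha> * (x * M) + (1 - \<alpha>))"
    by (intro mult_left_mono) auto
  also have "M powr (- \<alpha>) * (x * M) powr \<alpha> = x powr \<alpha>"
    using assms by (simp add: powr_mult powr_minus)
  also have "M powr (- \<alpha>) * (\<alpha> * (x * M) + (1 - \<alpha>)) = \<alpha> * (M powr (- \<alpha>) * M) * x + (1 - \<alpha>) * M powr (- \<alpha>)"
    by (simp add: algebra_simps)
  also have "M powr (- \<alpha>) * M = M powr (1 - \<alpha>)"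
    using assms by (simp add: powr_diff powr_minus divide_inverse mult.commute)
  finally show ?thesis .
qed (use assms in auto)

text \<open>Jensen's inequality for the uniform distribution on \<open>A\<close>: integrate the tangent of the concave
  integrand at the constant density \<open>1 / measure m A\<close>.\<close>

lemma entropy_upper_bound:
  assumes \<rho>[measurable]: "\<rho> \<in> borel_measurable m" and p: "prob_space (density m \<rho>)" and N: "1 < N"
    and A[measurable]: "A \<in> sets m" and fin: "emeasure m A < \<infinity>" and AE: "AE y in density m \<rho>. y \<in> A"
  shows "(\<integral>\<^sup>+ y. ennpowr (\<rho> y) (1 - 1 / N) \<partial>m) \<le> ennreal (measure m A powr (1 / N))"
proof -
  interpret p: prob_space "density m \<rho>" by fact
  define M where "M = measure m A"
  have eM: "emeasure m A = ennreal M" using fin by (simp add: M_def emeasure_eq_ennreal_measure)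
  have tot: "(\<integral>\<^sup>+ y. \<rho> y \<partial>m) = 1"
  proof -
    have "emeasure (density m \<rho>) (space m) = 1" using p.emeasure_space_1 by simp
    then show ?thesis by (simp add: emeasure_density nn_integral_set_ennreal[symmetric] cong: nn_integral_cong)
  qed
  have AE': "AE y in m. y \<notin> A \<longrightarrow> \<rho> y = 0"
    using AE by (simp add: AE_density) (auto simp: zero_less_iff_neq_zero)
  have M: "0 < M"
  proof (rule ccontr)
    assume "\<not> 0 < M"
    then have "emeasure m A = 0" by (simp add: eM ennreal_neg)
    then have "AE y in m. y \<notin> A" using A by (intro AE_not_in null_setsI)
    then have "AE y in m. \<rho> y = 0" using AE' by eventually_elim auto
    then have "(\<integral>\<^sup>+ y. \<rho> y \<partial>m) = 0" by (simp add: nn_integral_0_iff_AE)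
    then show False using tot by simp
  qed
  define \<alpha> where "\<alpha> = 1 - 1 / N"
  have \<alpha>: "0 < \<alpha>" "\<alpha> < 1" using N by (auto simp: \<alpha>_def)
  have "(\<integral>\<^sup>+ y. ennpowr (\<rho> y) \<alpha> \<partial>m) \<le> (\<integral>\<^sup>+ y. ennreal (\<alpha> * M powr (1 - \<alpha>)) * \<rho> y + ennreal ((1 - \<alpha>) * M powr (- \<alpha>)) * indicator A y \<partial>m)"
  proof (rule nn_integral_mono_AE)
    show "AE y in m. ennpowr (\<rho> y) \<alpha> \<le> ennreal (\<alpha> * M powr (1 - \<alpha>)) * \<rho> y + ennreal ((1 - \<alpha>) * M powr (- \<alpha>)) * indicator A y"
      using AE'
    proof eventually_elim
      case (elim y)
      show ?case
      proof (cases "y \<in> A")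
        case False
        then show ?thesis using elim \<alpha> by (simp add: ennpowr_def)
      next
        case True
        show ?thesis
        proof (cases "\<rho> y" rule: ennreal_cases)
          case (real x)
          have "ennreal (x powr \<alpha>) \<le> ennreal (\<alpha> * M powr (1 - \<alpha>) * x + (1 - \<alpha>) * M powr (- \<alpha>))"
            by (intro ennreal_leI powr_le_tangent real M \<alpha>)
          also have "\<dots> = ennreal (\<alpha> * M powr (1 - \<alpha>)) * ennreal x + ennreal ((1 - \<alpha>) * M powr (- \<alpha>))"
            using \<alpha> real by (subst ennreal_plus) (auto simp: ennreal_mult)
          finally show ?thesis using True real \<alpha> by (simp add: ennpowr_ennreal)
        next
          case top
          then show ?thesis using \<alpha> M by (simp add: ennreal_mult_eq_top_iff ennreal_mult_top)
        qed
      qed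
    qed
  qed
  also have "\<dots> = ennreal (\<alpha> * M powr (1 - \<alpha>)) * 1 + ennreal ((1 - \<alpha>) * M powr (- \<alpha>)) * ennreal M"
    by (simp add: nn_integral_add nn_integral_cmult tot eM)
  also have "\<dots> = ennreal (\<alpha> * M powr (1 - \<alpha>) + (1 - \<alpha>) * (M powr (- \<alpha>) * M))"
    using \<alpha> M by (simp add: ennreal_mult[symmetric] ennreal_plus[symmetric] mult.assoc del: ennreal_plus)
  also have "M powr (- \<alpha>) * M = M powr (1 - \<alpha>)"
    using M by (simp add: powr_diff powr_minus divide_inverse mult.commute)
  also have "\<alpha> * M powr (1 - \<alpha>) + (1 - \<alpha>) * M powr (1 - \<alpha>) = M powr (1 / N)"
    by (simp add: \<alpha>_def algebra_simps)
  finally show ?thesis by (simp add: \<alpha>_def M_def)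
qed

definition uniform_density :: "'a measure \<Rightarrow> 'a set \<Rightarrow> 'a \<Rightarrow> ennreal" where
  "uniform_density m A = (\<lambda>y. ennreal (1 / measure m A) * indicator A y)"

lemma uniform_density_properties:
  fixes m :: "'a::polish_space measure"
  assumes m: "metric_measure_space m" and A: "A \<in> sets borel" "0 < emeasure m A" "emeasure m A < \<infinity>" "A \<subseteq> cball x r"
  shows "uniform_density m A \<in> borel_measurable m" "density m (uniform_density m A) \<in> P2_ac m"
    "bounded (msupport (density m (uniform_density m A)))"
    "AE y in density m (uniform_density m A). y \<in> A"
    "prob_space (density m (uniform_density m A))"
proof -
  define M where "M = measure m A"
  have eM: "emeasure m A = ennreal M" using A by (simp add: M_def emeasure_eq_ennreal_measure)
  then have M: "0 < M" using A by (metis ennreal_eq_0_iff not_le order_less_irrefl)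
  have [measurable]: "A \<in> sets m" using A metric_measure_spaceD[OF m] by simp
  show meas[measurable]: "uniform_density m A \<in> borel_measurable m" unfolding uniform_density_def by measurable
  define \<nu> where "\<nu> = density m (uniform_density m A)"
  have sp: "space \<nu> = UNIV" "sets \<nu> = sets borel" using metric_measure_spaceD[OF m] by (auto simp: \<nu>_def)
  have "emeasure \<nu> (space \<nu>) = (\<integral>\<^sup>+ y. ennreal (1 / M) * indicator A y \<partial>m)"
    unfolding \<nu>_def by (subst emeasure_density) (auto intro!: nn_integral_cong simp: uniform_density_def M_def split: split_indicator)
  also have "\<dots> = ennreal (1 / M) * ennreal M" by (simp add: nn_integral_cmult eM)
  also have "\<dots> = 1" using M by (simp add: ennreal_mult[symmetric])
  finally show prob: "prob_space (density m (uniform_density m A))" unfolding \<nu>_def[symmetric] by (rule prob_spaceI)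
  show AE: "AE y in density m (uniform_density m A). y \<in> A"
    by (subst AE_density) (auto simp: uniform_density_def split: split_indicator)
  interpret prob_space \<nu> unfolding \<nu>_def by fact
  have "(\<integral>\<^sup>+ y. ennreal ((dist x y)\<^sup>2) \<partial>\<nu>) \<le> (\<integral>\<^sup>+ y. ennreal (r\<^sup>2) \<partial>\<nu>)"
  proof (rule nn_integral_mono_AE)
    have "AE y in \<nu>. y \<in> A" using AE unfolding \<nu>_def .
    then show "AE y in \<nu>. ennreal ((dist x y)\<^sup>2) \<le> ennreal (r\<^sup>2)"
      by eventually_elim (use A(4) in \<open>auto intro!: ennreal_leI power_mono\<close>)
  qed
  also have "\<dots> < \<infinity>" by (simp add: emeasure_space_1)
  finally have "\<nu> \<in> P2" using sp prob unfolding P2_def \<nu>_def by auto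
  moreover have "absolutely_continuous m \<nu>"
    unfolding \<nu>_def by (rule absolutely_continuousI_density[OF meas])
  ultimately show "density m (uniform_density m A) \<in> P2_ac m" by (simp add: P2_ac_def \<nu>_def)
  have "msupport \<nu> \<subseteq> cball x r"
  proof
    fix y assume y: "y \<in> msupport \<nu>"
    show "y \<in> cball x r"
    proof (rule ccontr)
      assume "y \<notin> cball x r"
      then have "0 < emeasure \<nu> (- cball x r)" using y by (auto simp: msupport_def)
      moreover have "AE y in \<nu>. y \<notin> - cball x r"
        using AE unfolding \<nu>_def by eventually_elim (use A(4) in auto)
      then have "emeasure \<nu> (- cball x r) = 0"
        using AE_iff_null_sets[of "- cball x r" \<nu>] by (simp add: sp null_sets_def)
      ultimately show False by simp
    qed
  qed
  then show "bounded (msupport (density m (uniform_density m A)))"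
    unfolding \<nu>_def by (rule bounded_subset[OF bounded_cball])
qed

text \<open>Evaluation at a time is continuous because the supremum distance dominates the distance at that time.\<close>

lemma geodesic_eval_measurable:
  assumes t: "t \<in> {0..1}"
  shows "(\<lambda>\<gamma>. \<gamma> t) \<in> measurable (geodesic_borel :: (real \<Rightarrow> 'a::polish_space) measure) borel"
proof (rule borel_measurableI)
  fix S :: "'a set" assume S: "open S"
  define G where "G = (geodesic_space :: (real \<Rightarrow> 'a) metric)"
  have sub: "{U. openin (mtopology_of G) U} \<subseteq> Pow (mspace G)"
    using openin_subset by fastforce
  have sp: "space geodesic_borel = mspace G" and st: "sets geodesic_borel = sigma_sets (mspace G) {U. openin (mtopology_of G) U}"
    unfolding geodesic_borel_def G_def[symmetric] using sub by (simp_all add: space_measure_of sets_measure_of)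
  interpret M: Metric_space "mspace G" "mdist G" by (rule Metric_space_mspace_mdist)
  define U where "U = (\<lambda>\<gamma>. \<gamma> t) -` S \<inter> mspace G"
  have "openin (mtopology_of G) U"
    unfolding mtopology_of_def M.openin_mtopology
  proof (intro conjI allI impI)
    fix \<gamma> assume \<gamma>: "\<gamma> \<in> U"
    then obtain r where r: "r > 0" "ball (\<gamma> t) r \<subseteq> S" using S by (auto simp: U_def open_contains_ball)
    have "M.mball \<gamma> r \<subseteq> U"
    proof
      fix \<gamma>' assume g: "\<gamma>' \<in> M.mball \<gamma> r"
      then have g': "\<gamma> \<in> mspace G" "\<gamma>' \<in> mspace G" "mdist G \<gamma> \<gamma>' < r" by auto
      have "mdist euclidean_metric (\<gamma> t) (\<gamma>' t) < r"
      proof (rule cfunspace_mdist_lt[where X = "top_of_set {0..1::real}"])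
        show "compactin (top_of_set {0..1::real}) (topspace (top_of_set {0..1}))" by (simp add: compactin_subtopology)
      qed (use g' t in \<open>auto simp: G_def geodesic_space_def\<close>)
      then show "\<gamma>' \<in> U" using r g' by (auto simp: U_def)
    qed
    then show "\<exists>r>0. M.mball \<gamma> r \<subseteq> U" using r by blast
  qed (auto simp: U_def)
  then show "(\<lambda>\<gamma>. \<gamma> t) -` S \<inter> space geodesic_borel \<in> sets geodesic_borel"
    unfolding sp st U_def[symmetric] by (intro sigma_sets.Basic) simp
qed

lemma geodesic_borel_space:
  assumes "\<gamma> \<in> space (geodesic_borel :: (real \<Rightarrow> 'a::polish_space) measure)"
  shows "const_speed_geodesic dist \<gamma>"
proof -
  have "{U. openin (mtopology_of (geodesic_space :: (real \<Rightarrow> 'a) metric)) U} \<subseteq> Pow (mspace geodesic_space)"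
    using openin_subset by fastforce
  then show ?thesis using assms by (auto simp: geodesic_borel_def space_measure_of geodesic_space_def)
qed

lemma dynamical_optimal_coupling_AE:
  fixes Q :: "(real \<Rightarrow> 'a::polish_space) measure"
  assumes Q: "dynamical_optimal_coupling \<mu> \<nu> Q" and \<mu>: "AE y in \<mu>. P y" and \<nu>: "AE y in \<nu>. P' y"
  shows "AE \<gamma> in Q. const_speed_geodesic dist \<gamma> \<and> P (\<gamma> 0) \<and> P' (\<gamma> 1)"
    and "distr Q borel (\<lambda>\<gamma>. \<gamma> 1) = \<nu>" and "(\<lambda>\<gamma>. \<gamma> 1) \<in> measurable Q borel" and "prob_space Q"
proof -
  have sQ: "sets Q = sets geodesic_borel" and pQ: "prob_space Q" and c: "distr Q borel (\<lambda>\<gamma>. (\<gamma> 0, \<gamma> 1)) \<in> couplings \<mu> \<nu>"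
    using Q by (auto simp: dynamical_optimal_coupling_def optimal_coupling_def)
  show "prob_space Q" by fact
  have m0[measurable]: "(\<lambda>\<gamma>. \<gamma> 0) \<in> measurable Q borel" and m1[measurable]: "(\<lambda>\<gamma>. \<gamma> 1) \<in> measurable Q borel"
    using geodesic_eval_measurable[of 0] geodesic_eval_measurable[of 1]
    by (auto simp: measurable_cong_sets[OF sQ refl])
  have m: "(\<lambda>\<gamma>. (\<gamma> 0, \<gamma> 1)) \<in> measurable Q borel" by measurable
  have d0: "distr Q borel (\<lambda>\<gamma>. \<gamma> 0) = \<mu>" and d1: "distr Q borel (\<lambda>\<gamma>. \<gamma> 1) = \<nu>"
    using couplingsD(4,5)[OF c] distr_distr[OF borel_measurable_fst_snd(1) m] distr_distr[OF borel_measurable_fst_snd(2) m]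
    by (simp_all add: comp_def)
  show "distr Q borel (\<lambda>\<gamma>. \<gamma> 1) = \<nu>" "(\<lambda>\<gamma>. \<gamma> 1) \<in> measurable Q borel" by fact+
  have "AE \<gamma> in Q. P (\<gamma> 0)" using AE_distrD[OF m0, of P] \<mu> unfolding d0 by simp
  moreover have "AE \<gamma> in Q. P' (\<gamma> 1)" using AE_distrD[OF m1, of P'] \<nu> unfolding d1 by simp
  moreover have "AE \<gamma> in Q. const_speed_geodesic dist \<gamma>"
    using geodesic_borel_space sets_eq_imp_space_eq[OF sQ] by (intro AE_I2) auto
  ultimately show "AE \<gamma> in Q. const_speed_geodesic dist \<gamma> \<and> P (\<gamma> 0) \<and> P' (\<gamma> 1)" by eventually_elim auto
qed

definition annulus :: "'a::metric_space \<Rightarrow> real \<Rightarrow> real \<Rightarrow> 'a set" where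
  "annulus x a b = {y. a \<le> dist x y \<and> dist x y \<le> b}"

lemma annulus_borel [measurable]: "annulus x a b \<in> sets borel"
  unfolding annulus_def by measurable

text \<open>At length \<open>s\<close> along the geodesic the distance to \<open>x\<close> differs from \<open>s\<close> by at most \<open>\<delta>\<close>, because the
  geodesic starts within \<open>\<delta>\<close> of \<open>x\<close>. So \<open>f\<close> is a Lipschitz minorant of the curvature along it.\<close>

lemma tau_coeff_lower_bound:
  assumes \<gamma>: "const_speed_geodesic dist \<gamma>" and N: "1 < N" and t: "0 < t" "t < 1"
    and start: "dist x (\<gamma> 0) \<le> \<delta>" and len: "speed \<gamma> \<le> B"
    and f: "\<And>s r. s \<in> {0..B} \<Longrightarrow> r \<in> {0..B} \<Longrightarrow> \<bar>f s - f r\<bar> \<le> L * \<bar>s - r\<bar>"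
    and low: "\<And>p s. 0 \<le> s \<Longrightarrow> s \<le> B \<Longrightarrow> \<bar>dist x p - s\<bar> \<le> \<delta> \<Longrightarrow> (N - 1) * f s \<le> k p"
    and c: "0 \<le> c" "0 < speed \<gamma> \<Longrightarrow> c * sine f (speed \<gamma>) (speed \<gamma>) \<le> sine f (speed \<gamma>) (t * speed \<gamma>)"
      "speed \<gamma> = 0 \<Longrightarrow> c \<le> t"
  shows "ennreal (t powr (1 / N) * c powr ((N - 1) / N)) \<le> tau_coeff (along_fwd k \<gamma>) N t (speed \<gamma>)"
proof -
  define \<theta> where "\<theta> = speed \<gamma>"
  have \<theta>0: "0 \<le> \<theta>" by (simp add: \<theta>_def speed_def)
  have "ennreal c \<le> sigma_coeff_N (along_fwd k \<gamma>) (N - 1) t \<theta>"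
  proof (cases "\<theta> = 0")
    case True
    then show ?thesis using c by (auto simp: sigma_coeff_N_def sigma_coeff_def \<theta>_def intro!: ennreal_leI)
  next
    case False
    then have \<theta>: "0 < \<theta>" using \<theta>0 by simp
    show ?thesis unfolding sigma_coeff_N_def
    proof (rule sigma_coeff_lower_bound[where f = f and L = L])
      fix s assume s: "s \<in> {0..\<theta>}"
      then have u: "s / \<theta> \<in> {0..1}" using \<theta> by (simp add: field_simps)
      have "dist (\<gamma> 0) (\<gamma> (s / \<theta>)) = \<bar>0 - s / \<theta>\<bar> * dist (\<gamma> 0) (\<gamma> 1)"
        using \<gamma> u unfolding const_speed_geodesic_def by (metis atLeastAtMost_iff order_refl zero_le_one)
      also have "\<dots> = s" using \<theta> s by (simp add: \<theta>_def speed_def)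
      finally have "dist (\<gamma> 0) (\<gamma> (s / \<theta>)) = s" .
      then have "\<bar>dist x (\<gamma> (s / \<theta>)) - s\<bar> \<le> \<delta>"
        using start dist_triangle[of x "\<gamma> (s / \<theta>)" "\<gamma> 0"] dist_triangle3[of "\<gamma> 0" "\<gamma> (s / \<theta>)" x]
        by (auto simp: abs_le_iff)
      then have "(N - 1) * f s \<le> k (\<gamma> (s / \<theta>))" using s len by (intro low) (auto simp: \<theta>_def)
      then show "f s \<le> along_fwd k \<gamma> s / (N - 1)"
        using N by (simp add: along_fwd_def \<theta>_def field_simps)
    qed (use \<theta> t c f len in \<open>auto simp: \<theta>_def\<close>)
  qed
  then have "ennpowr (ennreal c) ((N - 1) / N) \<le> ennpowr (sigma_coeff_N (along_fwd k \<gamma>) (N - 1) t \<theta>) ((N - 1) / N)"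
    using N by (intro ennpowr_mono) auto
  then have "ennreal (c powr ((N - 1) / N)) \<le> ennpowr (sigma_coeff_N (along_fwd k \<gamma>) (N - 1) t \<theta>) ((N - 1) / N)"
    using N c by (subst (asm) ennpowr_ennreal) auto
  then have "ennreal (t powr (1 / N)) * ennreal (c powr ((N - 1) / N)) \<le> tau_coeff (along_fwd k \<gamma>) N t \<theta>"
    unfolding tau_coeff_def using N t by (subst ennpowr_ennreal) (auto intro!: mult_left_mono)
  then show ?thesis by (simp add: ennreal_mult \<theta>_def)
qed

text \<open>Apply the condition \<open>CD\<close> to the uniform distributions on the ball of radius \<open>\<epsilon>\<close> and on the annulus.
  The term with \<open>\<rho>0\<close> is dropped and the other one bounded from below by a constant; the entropy of the
  intermediate measure is bounded by the measure of the set on which it lives. Raising the result to the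
  power \<open>N\<close> gives the claim. Only lengths \<open>\<theta>\<close> of geodesics between the two sets enter; geodesics of
  length \<open>0\<close> occur only if \<open>R1 \<le> \<epsilon>\<close>, and for them the distortion coefficient is \<open>t\<close>.\<close>

lemma brunn_minkowski_annuli_approx:
  fixes m :: "'a::polish_space measure"
  assumes m: "metric_measure_space m" and supp: "msupport m = UNIV" and CD: "CD m k N" and N: "1 < N"
    and t: "0 < t" "t < 1" and \<epsilon>: "0 < \<epsilon>" and R: "R1 \<le> R2"
    and fin: "emeasure m (cball x (R2 + 2 * \<epsilon>)) < \<infinity>"
    and f: "\<And>s r. s \<in> {0..R2 + \<epsilon>} \<Longrightarrow> r \<in> {0..R2 + \<epsilon>} \<Longrightarrow> \<bar>f s - f r\<bar> \<le> L * \<bar>s - r\<bar>"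
    and low: "\<And>p s. 0 \<le> s \<Longrightarrow> s \<le> R2 + \<epsilon> \<Longrightarrow> \<bar>dist x p - s\<bar> \<le> \<epsilon> \<Longrightarrow> (N - 1) * f s \<le> k p"
    and c: "0 \<le> c" "\<And>\<theta>. \<theta> \<in> {R1 - \<epsilon>..R2 + \<epsilon>} \<Longrightarrow> 0 < \<theta> \<Longrightarrow> c * sine f \<theta> \<theta> \<le> sine f \<theta> (t * \<theta>)"
      "R1 \<le> \<epsilon> \<Longrightarrow> c \<le> t"
  shows "t * c powr (N - 1) * measure m (annulus x R1 R2) \<le> measure m (annulus x (t * (R1 - \<epsilon>) - \<epsilon>) (t * (R2 + \<epsilon>) + \<epsilon>))"
proof (cases "measure m (annulus x R1 R2) = 0")
  case False
  note sm = metric_measure_spaceD[OF m]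
  note [measurable_cong] = sm(1)
  define A1 where "A1 = annulus x R1 R2"
  define M1 where "M1 = measure m A1"
  define A' where "A' = annulus x (t * (R1 - \<epsilon>) - \<epsilon>) (t * (R2 + \<epsilon>) + \<epsilon>)"
  define M' where "M' = measure m A'"
  have [measurable]: "A1 \<in> sets borel" "A' \<in> sets borel" by (auto simp: A1_def A'_def)
  have M1: "0 < M1" using False by (simp add: M1_def A1_def zero_less_measure_iff)
  have "A1 \<noteq> {}" using M1 by (auto simp: M1_def)
  then have R2: "0 \<le> R2" unfolding A1_def annulus_def by (smt (verit) Collect_empty_eq zero_le_dist)
  have cb: "emeasure m B < \<infinity>" if "B \<subseteq> cball x (R2 + 2 * \<epsilon>)" for B
  proof -
    have "emeasure m B \<le> emeasure m (cball x (R2 + 2 * \<epsilon>))" using sm by (intro emeasure_mono that) auto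
    then show ?thesis using fin by (rule order_le_less_trans)
  qed
  have A1: "A1 \<subseteq> cball x R2" by (auto simp: A1_def annulus_def)
  then have fin1: "emeasure m A1 < \<infinity>" using \<epsilon> by (intro cb) (auto intro: order_trans)
  then have e1: "emeasure m A1 = ennreal M1" by (simp add: M1_def emeasure_eq_ennreal_measure)
  have "t * (R2 + \<epsilon>) \<le> R2 + \<epsilon>" using t R2 \<epsilon> by (intro mult_left_le_one_le) auto
  then have "A' \<subseteq> cball x (R2 + 2 * \<epsilon>)" by (auto simp: A'_def annulus_def)
  then have fin': "emeasure m A' < \<infinity>" by (rule cb)
  have B0: "ball x \<epsilon> \<subseteq> cball x \<epsilon>" by auto
  have "x \<in> msupport m" using supp by simp
  then have pos0: "0 < emeasure m (ball x \<epsilon>)" using \<epsilon> by (auto simp: msupport_def)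
  have fin0: "emeasure m (ball x \<epsilon>) < \<infinity>" using R2 \<epsilon> by (intro cb) auto
  define \<rho>0 where "\<rho>0 = uniform_density m (ball x \<epsilon>)"
  define \<rho>1 where "\<rho>1 = uniform_density m A1"
  define \<nu>0 where "\<nu>0 = density m \<rho>0"
  define \<nu>1 where "\<nu>1 = density m \<rho>1"
  have pos1: "0 < emeasure m A1" using M1 e1 by simp
  have Ab: "ball x \<epsilon> \<in> sets borel" "A1 \<in> sets borel" by auto
  note u0 = uniform_density_properties[OF m Ab(1) pos0 fin0 B0, folded \<rho>0_def, folded \<nu>0_def]
  note u1 = uniform_density_properties[OF m Ab(2) pos1 fin1 A1, folded \<rho>1_def, folded \<nu>1_def]
  obtain Q \<nu> where Q: "dynamical_optimal_coupling \<nu>0 \<nu>1 Q" and geo: "const_speed_geodesic W2 \<nu>"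
    and ac: "\<forall>t\<in>{0..1}. \<nu> t \<in> P2_ac m" and ends: "\<nu> 0 = \<nu>0" "\<nu> 1 = \<nu>1"
    and ent: "\<forall>t\<in>{0..1}. \<forall>N'\<ge>N. renyi_entropy m N' (\<nu> t) \<le> - enn2ereal (CD_integral k N' t \<rho>0 \<rho>1 Q)"
    using CD[unfolded CD_def, rule_format, OF u0(2) u1(2) u0(1) u1(1) \<nu>0_def \<nu>1_def u0(3) u1(3)]
    by blast
  have t01: "t \<in> {0..1}" using t by auto
  have acts: "\<nu> t \<in> P2_ac m" using ac t01 by blast
  then have P2s: "\<nu>0 \<in> P2" "\<nu> t \<in> P2" "\<nu>1 \<in> P2" using u0(2) u1(2) by (simp_all add: P2_ac_def)
  have Wg: "W2 \<nu>0 (\<nu> t) = t * W2 \<nu>0 \<nu>1" "W2 (\<nu> t) \<nu>1 = (1 - t) * W2 \<nu>0 \<nu>1"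
    using geo[unfolded const_speed_geodesic_def, rule_format, of 0 t]
      geo[unfolded const_speed_geodesic_def, rule_format, of t 1] t01 t
    by (simp_all add: ends)
  have AE0: "AE y in \<nu>0. dist x y \<le> \<epsilon>" using u0(4) by eventually_elim auto
  have AE1: "AE y in \<nu>1. R1 \<le> dist x y \<and> dist x y \<le> R2" using u1(4) by eventually_elim (auto simp: A1_def annulus_def)
  have AEt: "AE y in \<nu> t. y \<in> A'"
    using W2_geodesic_localization[OF P2s t Wg AE0 AE1] by eventually_elim (auto simp: A'_def annulus_def)
  define \<rho> where "\<rho> = ac_density m (\<nu> t)"
  have sets\<nu>: "sets (\<nu> t) = sets m" using P2D(1)[OF P2s(2)] sm by simp
  have acm: "absolutely_continuous m (\<nu> t)" using acts by (simp add: P2_ac_def)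
  note \<rho> = ac_density_properties[OF metric_measure_space_sigma_finite[OF m] sets\<nu> acm, folded \<rho>_def]
  \<comment> \<open>The intermediate measure is carried by \<open>A'\<close>, by \<open>W2_geodesic_localization\<close>.\<close>
  have up: "(\<integral>\<^sup>+ y. ennpowr (\<rho> y) (1 - 1 / N) \<partial>m) \<le> ennreal (M' powr (1 / N))"
    unfolding M'_def
    by (rule entropy_upper_bound[OF \<rho>(1) _ N _ fin']) (use P2D(3)[OF P2s(2)] AEt in \<open>simp_all only: \<rho>(2)\<close>, simp add: sm)
  have "renyi_entropy m N (\<nu> t) \<le> - enn2ereal (CD_integral k N t \<rho>0 \<rho>1 Q)" using ent t01 by blast
  then have "enn2ereal (CD_integral k N t \<rho>0 \<rho>1 Q) \<le> enn2ereal (\<integral>\<^sup>+ y. ennpowr (\<rho> y) (1 - 1 / N) \<partial>m)"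
    by (simp add: renyi_entropy_def \<rho>_def)
  then have low1: "CD_integral k N t \<rho>0 \<rho>1 Q \<le> (\<integral>\<^sup>+ y. ennpowr (\<rho> y) (1 - 1 / N) \<partial>m)"
    by (simp add: less_eq_ennreal.rep_eq)
  interpret Q: prob_space Q by (rule dynamical_optimal_coupling_AE(4)[OF Q AE0 AE1])
  define K where "K = t powr (1 / N) * c powr ((N - 1) / N)"
  have "ennreal (K * M1 powr (1 / N)) = (\<integral>\<^sup>+ \<gamma>. ennreal (K * M1 powr (1 / N)) \<partial>Q)"
    by (simp add: Q.emeasure_space_1)
  also have "\<dots> \<le> CD_integral k N t \<rho>0 \<rho>1 Q"
    unfolding CD_integral_def
  proof (rule nn_integral_mono_AE)
    show "AE \<gamma> in Q. ennreal (K * M1 powr (1 / N)) \<le> tau_coeff (along_bwd k \<gamma>) N (1 - t) (speed \<gamma>) * ennpowr (\<rho>0 (\<gamma> 0)) (- 1 / N)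
           + tau_coeff (along_fwd k \<gamma>) N t (speed \<gamma>) * ennpowr (\<rho>1 (\<gamma> 1)) (- 1 / N)"
      using dynamical_optimal_coupling_AE(1)[OF Q AE0 AE1]
    proof eventually_elim
      case (elim \<gamma>)
      have sp: "R1 - \<epsilon> \<le> speed \<gamma>" "speed \<gamma> \<le> R2 + \<epsilon>" "0 \<le> speed \<gamma>"
        using elim dist_triangle[of x "\<gamma> 1" "\<gamma> 0"] dist_triangle3[of "\<gamma> 0" "\<gamma> 1" x] by (auto simp: speed_def)
      have "ennreal K \<le> tau_coeff (along_fwd k \<gamma>) N t (speed \<gamma>)"
        unfolding K_def
        by (rule tau_coeff_lower_bound[where x = x and \<delta> = \<epsilon> and f = f and L = L and B = "R2 + \<epsilon>"])
          (use elim N t f low c sp in auto)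
      moreover have "ennpowr (\<rho>1 (\<gamma> 1)) (- 1 / N) = ennreal (M1 powr (1 / N))"
      proof -
        have "\<rho>1 (\<gamma> 1) = ennreal (1 / M1)"
          using elim by (auto simp: \<rho>1_def uniform_density_def M1_def A1_def annulus_def)
        moreover have "(1 / M1) powr (- 1 / N) = M1 powr (1 / N)"
        proof -
          have "(1 / M1) powr (- (1 / N)) = M1 powr (1 / N)"
            using M1 by (simp add: powr_minus_divide powr_divide)
          then show ?thesis by simp
        qed
        ultimately show ?thesis using M1 N by (simp add: ennpowr_def ennreal_eq_0_iff)
      qed
      ultimately have "ennreal K * ennreal (M1 powr (1 / N)) \<le> tau_coeff (along_fwd k \<gamma>) N t (speed \<gamma>) * ennpowr (\<rho>1 (\<gamma> 1)) (- 1 / N)"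
        by (intro mult_mono) auto
      then show ?case
        using t c by (subst ennreal_mult) (auto simp: K_def intro: add_increasing)
    qed
  qed
  also note low1
  also note up
  finally have le: "K * M1 powr (1 / N) \<le> M' powr (1 / N)" by simp
  have "(K * M1 powr (1 / N)) powr N \<le> (M' powr (1 / N)) powr N"
    using le N t c by (intro powr_mono2) (auto simp: K_def)
  also have "(M' powr (1 / N)) powr N = M'" using N by (simp add: powr_powr M'_def)
  also have "(K * M1 powr (1 / N)) powr N = t * c powr (N - 1) * M1"
    using N t c M1 by (simp add: K_def powr_mult powr_powr)
  finally show ?thesis by (simp add: M1_def M'_def A1_def A'_def)
qed simp

text \<open>The annuli of \<open>brunn_minkowski_annuli_approx\<close> decrease to the scaled annulus as \<open>\<epsilon> \<rightarrow> 0\<close>.\<close>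

theorem brunn_minkowski_annuli:
  fixes m :: "'a::polish_space measure"
  assumes m: "metric_measure_space m" and supp: "msupport m = UNIV" and CD: "CD m k N" and N: "1 < N"
    and t: "0 < t" "t < 1" and \<delta>: "0 < \<delta>" and R: "R1 \<le> R2"
    and fin: "emeasure m (cball x (R2 + 2 * \<delta>)) < \<infinity>"
    and f: "\<And>s r. s \<in> {0..R2 + \<delta>} \<Longrightarrow> r \<in> {0..R2 + \<delta>} \<Longrightarrow> \<bar>f s - f r\<bar> \<le> L * \<bar>s - r\<bar>"
    and low: "\<And>p s. 0 \<le> s \<Longrightarrow> s \<le> R2 + \<delta> \<Longrightarrow> \<bar>dist x p - s\<bar> \<le> \<delta> \<Longrightarrow> (N - 1) * f s \<le> k p"
    and c: "0 \<le> c" "\<And>\<theta>. \<theta> \<in> {R1 - \<delta>..R2 + \<delta>} \<Longrightarrow> 0 < \<theta> \<Longrightarrow> c * sine f \<theta> \<theta> \<le> sine f \<theta> (t * \<theta>)"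
      "R1 \<le> \<delta> \<Longrightarrow> c \<le> t"
  shows "t * c powr (N - 1) * measure m (annulus x R1 R2) \<le> measure m (annulus x (t * R1) (t * R2))"
proof (cases "R2 < 0")
  case True
  then have "annulus x R1 R2 = {}" by (auto simp: annulus_def) (meson not_le order_trans zero_le_dist)
  then show ?thesis by simp
next
  case False
  note sm = metric_measure_spaceD[OF m]
  define \<epsilon> where "\<epsilon> n = \<delta> / real (Suc n)" for n
  have \<epsilon>: "0 < \<epsilon> n" "\<epsilon> n \<le> \<delta>" for n using \<delta> by (auto simp: \<epsilon>_def field_simps)
  define S where "S n = annulus x (t * (R1 - \<epsilon> n) - \<epsilon> n) (t * (R2 + \<epsilon> n) + \<epsilon> n)" for n
  have ed: "\<epsilon> (Suc n) \<le> \<epsilon> n" for n using \<delta> by (simp add: \<epsilon>_def frac_le)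
  have e0: "\<epsilon> \<longlonglongrightarrow> 0" unfolding \<epsilon>_def
    using tendsto_mult[OF tendsto_const[of \<delta>] LIMSEQ_inverse_real_of_nat] by (simp add: divide_inverse)
  have dec: "decseq S"
  proof (rule decseq_SucI)
    fix n
    have "t * \<epsilon> (Suc n) \<le> t * \<epsilon> n" using ed t by (intro mult_left_mono) auto
    then show "S (Suc n) \<subseteq> S n"
      using ed[of n] by (auto simp: S_def annulus_def algebra_simps)
  qed
  have Sfin: "emeasure m (S n) \<noteq> \<infinity>" for n
  proof -
    have "t * (R2 + \<epsilon> n) \<le> R2 + \<epsilon> n" using t False \<epsilon>[of n] by (intro mult_left_le_one_le) auto
    then have "S n \<subseteq> cball x (R2 + 2 * \<delta>)" using \<epsilon>[of n] by (auto simp: S_def annulus_def)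
    then have "emeasure m (S n) \<le> emeasure m (cball x (R2 + 2 * \<delta>))" using sm by (intro emeasure_mono) auto
    then show ?thesis using fin by auto
  qed
  have "(\<lambda>n. measure m (S n)) \<longlonglongrightarrow> measure m (\<Inter>n. S n)"
    by (rule Lim_measure_decseq[OF _ dec Sfin]) (auto simp: S_def sm)
  moreover have "(\<Inter>n. S n) = annulus x (t * R1) (t * R2)"
  proof (intro equalityI subsetI)
    fix y assume y: "y \<in> (\<Inter>n. S n)"
    have "(\<lambda>n. t * (R1 - \<epsilon> n) - \<epsilon> n) \<longlonglongrightarrow> t * (R1 - 0) - 0" "(\<lambda>n. t * (R2 + \<epsilon> n) + \<epsilon> n) \<longlonglongrightarrow> t * (R2 + 0) + 0"
      by (intro tendsto_intros e0)+
    then show "y \<in> annulus x (t * R1) (t * R2)"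
      using y LIMSEQ_le_const[of _ "t * R2" "dist x y"] LIMSEQ_le_const2[of _ "t * R1" "dist x y"]
      by (auto simp: S_def annulus_def)
  next
    fix y assume y: "y \<in> annulus x (t * R1) (t * R2)"
    have "0 \<le> t * \<epsilon> n" for n using t \<epsilon>[of n] by simp
    then show "y \<in> (\<Inter>n. S n)"
      using y \<epsilon>(1) by (auto simp: S_def annulus_def algebra_simps add_nonneg_nonneg intro: order_trans less_imp_le)
        (smt (verit))+
  qed
  ultimately have lim: "(\<lambda>n. measure m (S n)) \<longlonglongrightarrow> measure m (annulus x (t * R1) (t * R2))" by simp
  have "t * c powr (N - 1) * measure m (annulus x R1 R2) \<le> measure m (S n)" for n
    unfolding S_def
  proof (rule brunn_minkowski_annuli_approx[OF m supp CD N t \<epsilon>(1) R, where f = f and L = L])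
    have "emeasure m (cball x (R2 + 2 * \<epsilon> n)) \<le> emeasure m (cball x (R2 + 2 * \<delta>))"
      using \<epsilon>[of n] sm by (intro emeasure_mono) auto
    then show "emeasure m (cball x (R2 + 2 * \<epsilon> n)) < \<infinity>" using fin by (rule order_le_less_trans)
  qed (use \<epsilon>[of n] f low c in auto)
  then show ?thesis by (intro LIMSEQ_le_const[OF lim]) auto
qed

section \<open>Properness\<close>

lemma sine_negative_constant:
  assumes C: "0 < C" and s: "s \<in> {0..\<theta>}"
  shows "sine (\<lambda>_. - C) \<theta> s = sinh (sqrt C * s) / sqrt C"
proof (rule sine_solution_unique[OF sine_is_solution _ _ s])
  show "sine_solution (\<lambda>_. - C) \<theta> (\<lambda>s. sinh (sqrt C * s) / sqrt C)"
    unfolding sine_solution_def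
    using C by (intro exI[of _ "\<lambda>s. cosh (sqrt C * s)"]) (auto intro!: derivative_eq_intros simp: field_simps)
qed (use s in auto)

lemma sinh_bounds:
  fixes y :: real
  assumes "0 \<le> y"
  shows "y \<le> sinh y" "sinh y \<le> y * cosh y"
proof -
  have "(\<lambda>y. sinh y - y) 0 \<le> (\<lambda>y. sinh y - y) y"
    by (rule nonneg_deriv_within_mono[where f' = "\<lambda>y. cosh y - 1" and a = 0 and b = y])
      (use assms in \<open>auto intro!: derivative_eq_intros simp: cosh_real_ge_1\<close>)
  then show "y \<le> sinh y" by simp
  have "(\<lambda>y. y * cosh y - sinh y) 0 \<le> (\<lambda>y. y * cosh y - sinh y) y"
    by (rule nonneg_deriv_within_mono[where f' = "\<lambda>y. y * sinh y" and a = 0 and b = y])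
      (use assms in \<open>auto intro!: derivative_eq_intros\<close>)
  then show "sinh y \<le> y * cosh y" by simp
qed

text \<open>A lower bound for the distortion coefficient of a negative constant that is uniform in lengths up to \<open>B\<close>;
  it only uses \<open>y \<le> sinh y \<le> y * cosh y\<close>.\<close>

lemma sine_negative_constant_ratio:
  assumes C: "0 < C" and \<theta>: "0 < \<theta>" "\<theta> \<le> B" and t: "0 \<le> t" "t \<le> 1"
  shows "t / cosh (sqrt C * B) * sine (\<lambda>_. - C) \<theta> \<theta> \<le> sine (\<lambda>_. - C) \<theta> (t * \<theta>)"
proof -
  define a where "a = sqrt C"
  have a: "0 < a" using C by (simp add: a_def)
  have "sinh (a * \<theta>) \<le> a * \<theta> * cosh (a * B)"
  proof -
    have "sinh (a * \<theta>) \<le> a * \<theta> * cosh (a * \<theta>)" using a \<theta> by (intro sinh_bounds) auto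
    also have "\<dots> \<le> a * \<theta> * cosh (a * B)"
      using a \<theta> by (intro mult_left_mono) (auto simp: cosh_real_nonneg_le_iff)
    finally show ?thesis .
  qed
  then have "t / cosh (a * B) * sinh (a * \<theta>) \<le> t / cosh (a * B) * (a * \<theta> * cosh (a * B))"
    using t by (intro mult_left_mono) (auto simp: less_imp_le[OF cosh_real_pos])
  also have "\<dots> = a * (t * \<theta>)" using cosh_real_pos[of "a * B"] by simp
  also have "\<dots> \<le> sinh (a * (t * \<theta>))" using a t \<theta> by (intro sinh_bounds) auto
  finally have "t / cosh (a * B) * sinh (a * \<theta>) / a \<le> sinh (a * (t * \<theta>)) / a"
    using a by (intro divide_right_mono) auto
  moreover have "t * \<theta> \<in> {0..\<theta>}" "\<theta> \<in> {0..\<theta>}" using t \<theta> by (auto simp: mult_left_le_one_le)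
  ultimately show ?thesis by (simp add: sine_negative_constant[OF C] a_def)
qed

lemma annulus_zero: "annulus x 0 r = cball x r"
  by (auto simp: annulus_def)

text \<open>Contract the ball of radius \<open>2 * \<rho>\<close> around \<open>y\<close>, which contains the fixed ball \<open>cball p \<rho>\<close>, into \<open>cball y s\<close>
  by the Brunn-Minkowski inequality with constant curvature bound. The resulting constant does not
  depend on \<open>y\<close>.\<close>

lemma local_ball_volume_lower_bound:
  fixes m :: "'a::polish_space measure"
  assumes m: "metric_measure_space m" and supp: "msupport m = UNIV" and CD: "CD m k N" and N: "1 < N"
    and \<rho>: "0 < \<rho>" and fin: "emeasure m (cball p (5 * \<rho>)) < \<infinity>" and K: "\<And>q. dist p q \<le> 5 * \<rho> \<Longrightarrow> - K \<le> k q"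
    and s: "0 < s" "s \<le> 4 * \<rho>"
  shows "\<exists>v>0. \<forall>y\<in>cball p \<rho>. v \<le> measure m (cball y s)"
proof -
  note sm = metric_measure_spaceD[OF m]
  \<comment> \<open>Adding \<open>1\<close> makes the constant positive, so that its sine is an honest hyperbolic one.\<close>
  define C where "C = (\<bar>K\<bar> + 1) / (N - 1)"
  have C: "0 < C" using N by (simp add: C_def add_nonneg_pos)
  define t where "t = min (1 / 2) (s / (2 * \<rho>))"
  have t: "0 < t" "t < 1" "t * (2 * \<rho>) \<le> s" using s \<rho> by (auto simp: t_def min_def field_simps)
  define c where "c = t / cosh (sqrt C * (3 * \<rho>))"
  have cs: "1 \<le> cosh (sqrt C * (3 * \<rho>))" by (rule cosh_real_ge_1)
  have c: "0 < c" "c \<le> t" using t cs by (auto simp: c_def divide_le_eq)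
  have finp: "emeasure m B < \<infinity>" if "B \<subseteq> cball p (5 * \<rho>)" for B
  proof -
    have "emeasure m B \<le> emeasure m (cball p (5 * \<rho>))" using sm by (intro emeasure_mono that) auto
    then show ?thesis using fin by (rule order_le_less_trans)
  qed
  have est: "t * c powr (N - 1) * measure m (cball p \<rho>) \<le> measure m (cball y s)" if y: "y \<in> cball p \<rho>" for y
  proof -
    have sub: "cball y r \<subseteq> cball p (5 * \<rho>)" if "r \<le> 4 * \<rho>" for r
    proof
      fix z assume "z \<in> cball y r"
      then show "z \<in> cball p (5 * \<rho>)" using y that dist_triangle[of p z y] by auto
    qed
    have fm: "cball y r \<in> fmeasurable m" if "r \<le> 4 * \<rho>" for r
      using finp[OF sub[OF that]] sm by (intro fmeasurableI) auto
    have "measure m (cball p \<rho>) \<le> measure m (cball y (2 * \<rho>))"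
    proof (rule measure_mono_fmeasurable)
      show "cball p \<rho> \<subseteq> cball y (2 * \<rho>)"
      proof
        fix z assume "z \<in> cball p \<rho>"
        then show "z \<in> cball y (2 * \<rho>)" using y dist_triangle3[of y z p] by auto
      qed
    qed (use sm fm \<rho> in auto)
    then have "t * c powr (N - 1) * measure m (cball p \<rho>) \<le> t * c powr (N - 1) * measure m (annulus y 0 (2 * \<rho>))"
      unfolding annulus_zero using t by (intro mult_left_mono) auto
    also have "\<dots> \<le> measure m (annulus y (t * 0) (t * (2 * \<rho>)))"
    proof (rule brunn_minkowski_annuli[OF m supp CD N t(1,2) \<rho>, where f = "\<lambda>_. - C" and L = 0])
      show "emeasure m (cball y (2 * \<rho> + 2 * \<rho>)) < \<infinity>" by (intro finp sub) simp
      show "(N - 1) * - C \<le> k q" if "0 \<le> r" "r \<le> 2 * \<rho> + \<rho>" "\<bar>dist y q - r\<bar> \<le> \<rho>" for q r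
      proof -
        have "(N - 1) * - C \<le> - K" using N by (simp add: C_def)
        also have "- K \<le> k q" using that y dist_triangle[of p q y] by (intro K) (auto simp: abs_le_iff)
        finally show ?thesis .
      qed
      show "c * sine (\<lambda>_. - C) \<theta> \<theta> \<le> sine (\<lambda>_. - C) \<theta> (t * \<theta>)" if "\<theta> \<in> {0 - \<rho>..2 * \<rho> + \<rho>}" "0 < \<theta>" for \<theta>
        unfolding c_def using that t by (intro sine_negative_constant_ratio[OF C]) auto
    qed (use \<rho> c in auto)
    also have "\<dots> = measure m (cball y (t * (2 * \<rho>)))" by (simp add: annulus_zero)
    also have "\<dots> \<le> measure m (cball y s)"
      using t sm fm[OF s(2)] by (intro measure_mono_fmeasurable) auto
    finally show ?thesis .
  qed
  have "0 < measure m (cball p \<rho>)"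
  proof -
    have "p \<in> msupport m" using supp by simp
    then have "0 < emeasure m (ball p \<rho>)" using \<rho> by (auto simp: msupport_def)
    also have "\<dots> \<le> emeasure m (cball p \<rho>)" using sm by (intro emeasure_mono) auto
    finally have "0 < emeasure m (cball p \<rho>)" .
    moreover have "emeasure m (cball p \<rho>) < \<infinity>" using \<rho> by (intro finp) auto
    ultimately show ?thesis by (simp add: measure_def enn2real_positive_iff)
  qed
  then show ?thesis using est t c by (intro exI[of _ "t * c powr (N - 1) * measure m (cball p \<rho>)"]) auto
qed

lemma compact_if_totally_bounded:
  fixes S :: "'a::complete_space set"
  assumes "closed S" "\<And>e. 0 < e \<Longrightarrow> \<exists>F. finite F \<and> S \<subseteq> (\<Union>y\<in>F. ball y e)"
  shows "compact S"
  unfolding compact_eq_totally_bounded using assms by (simp add: complete_eq_closed)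

text \<open>Separated points of a small ball have disjoint neighbourhoods whose measures are bounded below, all
  inside a set of finite measure. So there are boundedly many of them, and a maximal separated
  set is a net.\<close>

lemma locally_compact_space:
  fixes m :: "'a::polish_space measure" and p :: 'a
  assumes m: "metric_measure_space m" and supp: "msupport m = UNIV" and CD: "CD m k N" and N: "1 < N"
    and k: "admissible k"
  shows "\<exists>\<rho>>0. compact (cball p \<rho>)"
proof -
  note sm = metric_measure_spaceD[OF m]
  obtain r1 where r1: "r1 > 0" "emeasure m (ball p r1) < \<infinity>" using m by (auto simp: metric_measure_space_def)
  obtain U where U: "open U" "p \<in> U" "bdd_below (k ` U)" using k unfolding admissible_def by blast
  then obtain r2 K where r2: "r2 > 0" "ball p r2 \<subseteq> U" and K: "\<And>q. q \<in> U \<Longrightarrow> K \<le> k q"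
    by (metis bdd_below.unfold imageI open_contains_ball)
  define \<rho> where "\<rho> = min r1 r2 / 6"
  have \<rho>: "0 < \<rho>" "5 * \<rho> < r1" "5 * \<rho> < r2" using r1 r2 by (auto simp: \<rho>_def)
  have "emeasure m (cball p (5 * \<rho>)) \<le> emeasure m (ball p r1)" using \<rho> sm by (intro emeasure_mono) auto
  then have fin: "emeasure m (cball p (5 * \<rho>)) < \<infinity>" using r1 by (auto intro: order_le_less_trans)
  have K': "- (- K) \<le> k q" if "dist p q \<le> 5 * \<rho>" for q
  proof -
    have "q \<in> ball p r2" using that \<rho> by simp
    then show ?thesis using K r2 by auto
  qed
  have "compact (cball p \<rho>)"
  proof (rule compact_if_totally_bounded)
    fix e :: real assume e: "0 < e"
    define s where "s = min (e / 3) \<rho>"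
    have s: "0 < s" "s \<le> e / 3" "s \<le> \<rho>" using e \<rho> by (auto simp: s_def)
    obtain v where v: "v > 0" "\<And>y. y \<in> cball p \<rho> \<Longrightarrow> v \<le> measure m (cball y s)"
      using local_ball_volume_lower_bound[OF m supp CD N \<rho>(1) fin K' s(1)] s(3) \<rho>(1) by force
    define sep where "sep F \<longleftrightarrow> finite F \<and> F \<subseteq> cball p \<rho> \<and> (\<forall>y\<in>F. \<forall>z\<in>F. y \<noteq> z \<longrightarrow> e \<le> dist y z)" for F
    have bnd: "real (card F) * v \<le> measure m (cball p (5 * \<rho>))" if F: "sep F" for F
    proof -
      have fm: "cball y s \<in> fmeasurable m" "cball y s \<subseteq> cball p (5 * \<rho>)" if "y \<in> F" for y
      proof -
        have "y \<in> cball p \<rho>" using F that by (auto simp: sep_def)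
        then show sub: "cball y s \<subseteq> cball p (5 * \<rho>)"
          using s \<rho> dist_triangle[of p _ y] by (auto simp: subset_eq) (smt (verit))
        have "emeasure m (cball y s) \<le> emeasure m (cball p (5 * \<rho>))" using sm by (intro emeasure_mono sub) auto
        then show "cball y s \<in> fmeasurable m" using fin sm by (intro fmeasurableI) (auto intro: order_le_less_trans)
      qed
      have disj: "disjoint_family_on (\<lambda>y. cball y s) F"
        unfolding disjoint_family_on_def
      proof (intro ballI impI)
        fix y z assume yz: "y \<in> F" "z \<in> F" "y \<noteq> z"
        then have "e \<le> dist y z" using F by (auto simp: sep_def)
        then show "cball y s \<inter> cball z s = {}"
          using s e dist_triangle2[of y z] by (auto simp: dist_commute) (smt (verit))
      qed
      have "real (card F) * v = (\<Sum>y\<in>F. v)" by simp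
      also have "\<dots> \<le> (\<Sum>y\<in>F. measure m (cball y s))" using F by (intro sum_mono v) (auto simp: sep_def)
      also have "\<dots> = measure m (\<Union>y\<in>F. cball y s)"
        using F fm disj sm by (intro measure_finite_Union[symmetric]) (auto simp: sep_def fmeasurable_def less_top)
      also have "\<dots> \<le> measure m (cball p (5 * \<rho>))"
        using F fm sm fin by (intro measure_mono_fmeasurable fmeasurableI) (auto simp: sep_def intro!: sets.finite_UN)
      finally show ?thesis .
    qed
    have "sep {}" by (simp add: sep_def)
    moreover have "\<forall>F. sep F \<longrightarrow> card F \<le> nat \<lceil>measure m (cball p (5 * \<rho>)) / v\<rceil>"
    proof (intro allI impI)
      fix F assume "sep F"
      then have "real (card F) \<le> measure m (cball p (5 * \<rho>)) / v" using bnd[of F] v(1) by (simp add: pos_le_divide_eq)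
      then show "card F \<le> nat \<lceil>measure m (cball p (5 * \<rho>)) / v\<rceil>" by linarith
    qed
    ultimately obtain F where F: "sep F" "\<And>F'. sep F' \<Longrightarrow> card F' \<le> card F"
      using ex_has_greatest_nat[of sep "{}" card] by (metis le_imp_less_Suc)
    have "cball p \<rho> \<subseteq> (\<Union>y\<in>F. ball y e)"
    proof
      fix z assume z: "z \<in> cball p \<rho>"
      show "z \<in> (\<Union>y\<in>F. ball y e)"
      proof (rule ccontr)
        assume "z \<notin> (\<Union>y\<in>F. ball y e)"
        then have far: "e \<le> dist y z" if "y \<in> F" for y using that by auto
        then have "z \<notin> F" using e by force
        moreover have "sep (insert z F)"
          using F(1) z far by (auto simp: sep_def dist_commute)
        ultimately have "z \<notin> F" "sep (insert z F)" .
        then show False using F(2)[of "insert z F"] F(1) by (simp add: sep_def)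
      qed
    qed
    then show "\<exists>F. finite F \<and> cball p \<rho> \<subseteq> (\<Union>y\<in>F. ball y e)" using F(1) by (auto simp: sep_def)
  qed simp
  then show ?thesis using \<rho> by blast
qed

text \<open>Transport a small ball around \<open>y\<close> to a small ball around \<open>z\<close>: some geodesic connects points near \<open>y\<close> and
  \<open>z\<close>.\<close>

lemma approximate_intermediate_points:
  fixes m :: "'a::polish_space measure" and y z :: 'a
  assumes m: "metric_measure_space m" and supp: "msupport m = UNIV" and CD: "CD m k N"
    and l: "0 \<le> l" "l \<le> 1" and \<eta>: "0 < \<eta>"
  shows "\<exists>w. dist y w \<le> l * dist y z + \<eta> \<and> dist w z \<le> (1 - l) * dist y z + \<eta>"
proof -
  note sm = metric_measure_spaceD[OF m]
  obtain r1 where r1: "r1 > 0" "emeasure m (ball y r1) < \<infinity>" using m by (auto simp: metric_measure_space_def)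
  obtain r2 where r2: "r2 > 0" "emeasure m (ball z r2) < \<infinity>" using m by (auto simp: metric_measure_space_def)
  define \<epsilon> where "\<epsilon> = min (\<eta> / 3) (min r1 r2)"
  have \<epsilon>: "0 < \<epsilon>" "\<epsilon> \<le> \<eta> / 3" "\<epsilon> \<le> r1" "\<epsilon> \<le> r2" using r1 r2 \<eta> by (auto simp: \<epsilon>_def)
  have fin: "emeasure m (ball y \<epsilon>) < \<infinity>" "emeasure m (ball z \<epsilon>) < \<infinity>"
    using emeasure_mono[of "ball y \<epsilon>" "ball y r1" m] emeasure_mono[of "ball z \<epsilon>" "ball z r2" m] sm \<epsilon> r1 r2
    by (auto simp: subset_ball intro: order_le_less_trans)
  have pos: "0 < emeasure m (ball q \<epsilon>)" for q
  proof -
    have "q \<in> msupport m" using supp by simp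
    then show ?thesis using \<epsilon> by (auto simp: msupport_def)
  qed
  have b: "ball q \<epsilon> \<in> sets borel" "ball q \<epsilon> \<subseteq> cball q \<epsilon>" for q :: 'a by auto
  note u0 = uniform_density_properties[OF m b(1) pos fin(1) b(2)]
  note u1 = uniform_density_properties[OF m b(1) pos fin(2) b(2)]
  obtain Q where Q: "dynamical_optimal_coupling (density m (uniform_density m (ball y \<epsilon>))) (density m (uniform_density m (ball z \<epsilon>))) Q"
    using CD[unfolded CD_def, rule_format, OF u0(2) u1(2) u0(1) u1(1) refl refl u0(3) u1(3)] by blast
  note AE = dynamical_optimal_coupling_AE[OF Q u0(4) u1(4)]
  interpret Q: prob_space Q by (rule AE(4))
  obtain \<gamma> where \<gamma>: "const_speed_geodesic dist \<gamma>" "dist y (\<gamma> 0) < \<epsilon>" "dist z (\<gamma> 1) < \<epsilon>"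
  proof -
    have "\<exists>\<gamma>. const_speed_geodesic dist \<gamma> \<and> \<gamma> 0 \<in> ball y \<epsilon> \<and> \<gamma> 1 \<in> ball z \<epsilon>"
    proof (rule ccontr)
      assume *: "\<not> ?thesis"
      have "AE \<gamma> in Q. False" using AE(1) by eventually_elim (use * in blast)
      then show False by simp
    qed
    then show ?thesis using that by auto
  qed
  have d: "dist (\<gamma> 0) (\<gamma> l) = l * dist (\<gamma> 0) (\<gamma> 1)" "dist (\<gamma> l) (\<gamma> 1) = (1 - l) * dist (\<gamma> 0) (\<gamma> 1)"
    using \<gamma>(1)[unfolded const_speed_geodesic_def, rule_format, of 0 l] \<gamma>(1)[unfolded const_speed_geodesic_def, rule_format, of l 1] l
    by auto
  have D: "dist (\<gamma> 0) (\<gamma> 1) \<le> dist y z + 2 * \<epsilon>"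
    using dist_triangle[of "\<gamma> 0" "\<gamma> 1" y] dist_triangle[of y "\<gamma> 1" z] \<gamma> by (simp add: dist_commute)
  have "l * dist (\<gamma> 0) (\<gamma> 1) \<le> l * dist y z + 2 * \<epsilon>" "(1 - l) * dist (\<gamma> 0) (\<gamma> 1) \<le> (1 - l) * dist y z + 2 * \<epsilon>"
  proof -
    have "l * dist (\<gamma> 0) (\<gamma> 1) \<le> l * (dist y z + 2 * \<epsilon>)" "(1 - l) * dist (\<gamma> 0) (\<gamma> 1) \<le> (1 - l) * (dist y z + 2 * \<epsilon>)"
      using D l by (auto intro: mult_left_mono)
    moreover have "l * (2 * \<epsilon>) \<le> 2 * \<epsilon>" "(1 - l) * (2 * \<epsilon>) \<le> 2 * \<epsilon>" using l \<epsilon> by (auto intro!: mult_left_le_one_le)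
    ultimately show "l * dist (\<gamma> 0) (\<gamma> 1) \<le> l * dist y z + 2 * \<epsilon>" "(1 - l) * dist (\<gamma> 0) (\<gamma> 1) \<le> (1 - l) * dist y z + 2 * \<epsilon>"
      by (simp_all only: distrib_left)
  qed
  then show ?thesis
    using \<gamma> d \<epsilon> dist_triangle[of y "\<gamma> l" "\<gamma> 0"] dist_triangle2[of "\<gamma> l" z "\<gamma> 1"]
    by (intro exI[of _ "\<gamma> l"]) auto
qed

text \<open>Let \<open>s\<close> be the supremum of the radii of compact balls. Points of \<open>cball x s\<close> are close to slightly
  smaller balls, so \<open>cball x s\<close> is totally bounded. Being compact it has a compact neighbourhood by
  local compactness, and this contains a slightly larger ball.\<close>

lemma hopf_rinow:
  fixes x :: "'a::{complete_space,metric_space}"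
  assumes lc: "\<And>p::'a. \<exists>\<rho>>0. compact (cball p \<rho>)"
    and mid: "\<And>(y::'a) z l \<eta>. 0 \<le> l \<Longrightarrow> l \<le> 1 \<Longrightarrow> 0 < \<eta> \<Longrightarrow>
      \<exists>w. dist y w \<le> l * dist y z + \<eta> \<and> dist w z \<le> (1 - l) * dist y z + \<eta>"
  shows "compact (cball x r)"
proof (rule ccontr)
  assume nc: "\<not> compact (cball x r)"
  define S where "S = {s. compact (cball x s)}"
  have mono: "s' \<in> S" if "s \<in> S" "s' \<le> s" for s s'
  proof -
    have "compact (cball x s)" using that by (simp add: S_def)
    then have "compact (cball x s' \<inter> cball x s)" by (intro closed_Int_compact) auto
    moreover have "cball x s' \<inter> cball x s = cball x s'" using that by auto
    ultimately show ?thesis by (simp add: S_def)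
  qed
  have ub: "s < r" if "s \<in> S" for s
    using mono[OF that, of r] nc by (force simp: S_def)
  obtain \<rho> where \<rho>: "\<rho> > 0" "\<rho> \<in> S" using lc[of x] by (auto simp: S_def)
  define s where "s = Sup S"
  have bdd: "bdd_above S" using ub by (intro bdd_aboveI[of _ r]) (auto intro: less_imp_le)
  have s\<rho>: "\<rho> \<le> s" unfolding s_def using \<rho>(2) bdd by (rule cSup_upper)
  then have s0: "0 < s" using \<rho> by simp
  have below: "s' \<in> S" if lt: "s' < s" for s'
  proof -
    obtain q where "q \<in> S" "s' < q" using lt less_cSup_iff[OF _ bdd, of s'] \<rho> unfolding s_def by blast
    then show ?thesis using mono by auto
  qed
  have "compact (cball x s)"
  proof (rule compact_if_totally_bounded)
    fix e0 :: real assume e0: "0 < e0"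
    define e where "e = min e0 s"
    have e: "0 < e" "e \<le> e0" "e \<le> s" using e0 s0 by (auto simp: e_def)
    have "compact (cball x (s - e / 8))" using below[of "s - e / 8"] e by (simp add: S_def)
    then obtain F where F: "finite F" "cball x (s - e / 8) \<subseteq> (\<Union>y\<in>F. ball y (e / 2))"
      unfolding compact_eq_totally_bounded using e by (meson half_gt_zero)
    have "cball x s \<subseteq> (\<Union>y\<in>F. ball y e0)"
    proof
      fix z assume "z \<in> cball x s"
      then have z: "dist x z \<le> s" by simp
      have "\<exists>w. dist x w \<le> s - e / 8 \<and> dist w z < e / 2"
      proof (cases "dist x z \<le> s - e / 8")
        case True
        then show ?thesis using e by (intro exI[of _ z]) auto
      next
        case False
        \<comment> \<open>Moves \<open>z\<close> towards \<open>x\<close> by between \<open>7 / 24 * e\<close> and \<open>e / 3\<close>, up to the error \<open>e / 12\<close>.\<close>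
        define l where "l = 1 - e / (3 * s)"
        have l: "0 \<le> l" "l \<le> 1" using e s0 by (auto simp: l_def field_simps)
        obtain w where w: "dist x w \<le> l * dist x z + e / 12" "dist w z \<le> (1 - l) * dist x z + e / 12"
          using mid[OF l, of "e / 12" x z] e by auto
        have "7 / 8 * s \<le> dist x z" using False e by linarith
        then have "e / (3 * s) * (7 / 8 * s) \<le> e / (3 * s) * dist x z" using e s0 by (intro mult_left_mono) auto
        then have 1: "7 / 24 * e \<le> e / (3 * s) * dist x z" using s0 by simp
        have "e / (3 * s) * dist x z \<le> e / (3 * s) * s" using e s0 z by (intro mult_left_mono) auto
        then have 2: "e / (3 * s) * dist x z \<le> e / 3" using s0 by simp
        have "dist x w \<le> dist x z - e / (3 * s) * dist x z + e / 12" using w(1) by (simp add: l_def left_diff_distrib)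
        moreover have "dist w z \<le> e / (3 * s) * dist x z + e / 12" using w(2) by (simp add: l_def)
        ultimately show ?thesis using 1 2 z e by (intro exI[of _ w]) linarith
      qed
      then obtain w where w: "w \<in> cball x (s - e / 8)" "dist w z < e / 2" by auto
      then obtain y where "y \<in> F" "dist y w < e / 2" using F by auto
      then show "z \<in> (\<Union>y\<in>F. ball y e0)" using w e dist_triangle[of y z w] by (intro UN_I[of y]) auto
    qed
    then show "\<exists>F. finite F \<and> cball x s \<subseteq> (\<Union>y\<in>F. ball y e0)" using F by blast
  qed simp
  obtain \<rho>' where \<rho>': "\<And>p::'a. 0 < \<rho>' p" "\<And>p. compact (cball p (\<rho>' p))" using lc by metis
  obtain F where F: "F \<subseteq> cball x s" "finite F" "cball x s \<subseteq> (\<Union>p\<in>F. ball p (\<rho>' p))"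
  proof (rule compactE_image[OF \<open>compact (cball x s)\<close>, of "cball x s" "\<lambda>p. ball p (\<rho>' p)"])
    show "cball x s \<subseteq> (\<Union>p\<in>cball x s. ball p (\<rho>' p))" using \<rho>'(1) by force
  qed auto
  obtain d0 where d0: "d0 > 0" "(\<Union>p\<in>cball x s. ball p d0) \<subseteq> (\<Union>p\<in>F. ball p (\<rho>' p))"
    using compact_subset_open_imp_ball_epsilon_subset[OF \<open>compact (cball x s)\<close> _ F(3)] by blast
  define d where "d = min d0 s"
  have d: "0 < d" "d \<le> d0" "d \<le> s" using d0 s0 by (auto simp: d_def)
  have cK: "compact (\<Union>p\<in>F. cball p (\<rho>' p))" using F(2) \<rho>'(2) by (intro compact_UN) auto
  have "cball x (s + d / 4) \<subseteq> (\<Union>p\<in>F. cball p (\<rho>' p))"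
  proof
    fix z assume "z \<in> cball x (s + d / 4)"
    then have z: "dist x z \<le> s + d / 4" by simp
    have "\<exists>w. dist x w \<le> s \<and> dist w z < d"
    proof (cases "dist x z \<le> s")
      case True
      then show ?thesis using d by (intro exI[of _ z]) auto
    next
      case False
      define l where "l = (s - d / 4) / dist x z"
      have l: "0 \<le> l" "l \<le> 1" "l * dist x z = s - d / 4" 
      proof -
        have dz: "0 < dist x z" "s < dist x z" using False s0 by auto
        then show "0 \<le> l" unfolding l_def using d by (intro divide_nonneg_pos) auto
        show "l \<le> 1" unfolding l_def divide_le_eq_1_pos[OF dz(1)] using dz d by linarith
        show "l * dist x z = s - d / 4" using dz by (simp only: l_def) simp
      qed
      obtain w where w: "dist x w \<le> l * dist x z + d / 4" "dist w z \<le> (1 - l) * dist x z + d / 4"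
        using mid[OF l(1,2), of "d / 4" x z] d by auto
      then have "dist w z \<le> dist x z - l * dist x z + d / 4" by (simp add: left_diff_distrib)
      then show ?thesis using w l z d by (intro exI[of _ w]) auto
    qed
    then obtain w where "w \<in> cball x s" "dist w z < d0" using d by force
    then have "z \<in> (\<Union>p\<in>cball x s. ball p d0)" by auto
    then have "z \<in> (\<Union>p\<in>F. ball p (\<rho>' p))" using d0(2) by (rule rev_subsetD)
    then show "z \<in> (\<Union>p\<in>F. cball p (\<rho>' p))" by (auto intro: less_imp_le)
  qed
  then have "compact (cball x (s + d / 4))"
    using compact_Int_closed[OF cK, of "cball x (s + d / 4)"] by (simp add: Int_absorb1)
  then have "s + d / 4 \<le> s" unfolding s_def using bdd by (intro cSup_upper) (auto simp: S_def s_def)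
  then show False using d by simp
qed

theorem CD_proper:
  fixes m :: "'a::polish_space measure"
  assumes "metric_measure_space m" "msupport m = UNIV" "CD m k N" "1 < N" "admissible k"
  shows "compact (cball (x::'a) r)"
proof (rule hopf_rinow)
  show "\<exists>\<rho>>0. compact (cball p \<rho>)" for p :: 'a
    by (rule locally_compact_space[OF assms])
  show "\<exists>w. dist y w \<le> l * dist y z + \<eta> \<and> dist w z \<le> (1 - l) * dist y z + \<eta>"
    if "0 \<le> l" "l \<le> 1" "0 < \<eta>" for y z :: 'a and l \<eta>
    by (rule approximate_intermediate_points[OF assms(1-3) that])
qed

lemma compact_local_property:
  assumes "compact K" and loc: "\<And>x. \<exists>U. open U \<and> x \<in> U \<and> P U" and P: "P {}" "\<And>A B. P A \<Longrightarrow> P B \<Longrightarrow> P (A \<union> B)"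
  shows "\<exists>U. K \<subseteq> U \<and> P U"
proof -
  obtain U where U: "\<And>x. open (U x)" "\<And>x. x \<in> U x" "\<And>x. P (U x)" using loc by metis
  obtain F where F: "finite F" "K \<subseteq> (\<Union>x\<in>F. U x)"
  proof (rule compactE_image[OF assms(1), of K U])
    show "K \<subseteq> (\<Union>x\<in>K. U x)" using U(2) by blast
  qed (use U(1) in auto)
  have "P (\<Union>x\<in>F. U x)" using F(1) by induction (use P U in auto)
  then show ?thesis using F by blast
qed

lemma CD_ball_volume_finite:
  fixes m :: "'a::polish_space measure"
  assumes "metric_measure_space m" "msupport m = UNIV" "CD m k N" "1 < N" "admissible k"
  shows "emeasure m (cball x r) < \<infinity>"
proof -
  note sm = metric_measure_spaceD[OF assms(1)]
  have "\<exists>U. cball x r \<subseteq> U \<and> (U \<in> sets m \<and> emeasure m U < \<infinity>)"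
  proof (rule compact_local_property[OF CD_proper[OF assms]])
    fix y
    obtain r where "r > 0" "emeasure m (ball y r) < \<infinity>" using assms(1) by (auto simp: metric_measure_space_def)
    then show "\<exists>U. open U \<and> y \<in> U \<and> (U \<in> sets m \<and> emeasure m U < \<infinity>)"
      using sm by (intro exI[of _ "ball y r"]) auto
  next
    fix A B assume "A \<in> sets m \<and> emeasure m A < \<infinity>" "B \<in> sets m \<and> emeasure m B < \<infinity>"
    then show "A \<union> B \<in> sets m \<and> emeasure m (A \<union> B) < \<infinity>"
      using emeasure_subadditive[of A m B] by (auto simp: less_top[symmetric] top_unique)
  qed auto
  then obtain U where "cball x r \<subseteq> U" "U \<in> sets m" "emeasure m U < \<infinity>" by blast
  then show ?thesis using emeasure_mono[of "cball x r" U m] by (auto intro: order_le_less_trans)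
qed

lemma CD_bounded_below_on_balls:
  fixes m :: "'a::polish_space measure"
  assumes "metric_measure_space m" "msupport m = UNIV" "CD m k N" "1 < N" "admissible k"
  shows "bdd_below (k ` cball x r)"
proof -
  have "\<exists>U. cball x r \<subseteq> U \<and> bdd_below (k ` U)"
  proof (rule compact_local_property[OF CD_proper[OF assms]])
    show "\<exists>U. open U \<and> y \<in> U \<and> bdd_below (k ` U)" for y using assms(5) by (auto simp: admissible_def)
  qed (auto simp: image_Un bdd_below_Un)
  then show ?thesis by (meson bdd_below_mono image_mono)
qed

text \<open>Limits of approximate intermediate points exist by properness.\<close>

lemma radii_interval:
  fixes m :: "'a::polish_space measure" and x :: 'a
  assumes "metric_measure_space m" "msupport m = UNIV" "CD m k N" "1 < N" "admissible k"
  shows "T \<in> radii x \<Longrightarrow> {0..T} \<subseteq> radii x" and "closed (radii x)"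
proof -
  have lim: "r \<in> radii x" if w: "\<And>n. dist x (w n) \<le> B" and lim: "(\<lambda>n. dist x (w n)) \<longlonglongrightarrow> r" for w :: "nat \<Rightarrow> 'a" and B r
  proof -
    have "\<forall>n. w n \<in> cball x B" using w by auto
    then obtain l f where l: "strict_mono (f :: nat \<Rightarrow> nat)" "(w \<circ> f) \<longlonglongrightarrow> l"
      using CD_proper[OF assms, of x B] unfolding compact_def by meson
    then have "(\<lambda>n. dist x ((w \<circ> f) n)) \<longlonglongrightarrow> dist x l" by (intro tendsto_intros)
    moreover have "(\<lambda>n. dist x ((w \<circ> f) n)) \<longlonglongrightarrow> r"
      using LIMSEQ_subseq_LIMSEQ[OF lim l(1)] by (simp add: comp_def)
    ultimately have "dist x l = r" by (rule LIMSEQ_unique)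
    then show ?thesis by (auto simp: radii_def sphere_def)
  qed
  show "{0..T} \<subseteq> radii x" if T: "T \<in> radii x"
  proof
    fix r assume r: "r \<in> {0..T}"
    have "sphere x T \<noteq> {}" using T by (simp add: radii_def)
    then obtain z where z: "dist x z = T" by (metis all_not_in_conv mem_sphere)
    show "r \<in> radii x"
    proof (cases "T = 0")
      case True
      then show ?thesis using r T by auto
    next
      case False
      define l where "l = r / T"
      have l: "0 \<le> l" "l \<le> 1" "l * T = r" using r False by (auto simp: l_def field_simps)
      have "\<exists>w. dist x w \<le> l * dist x z + inverse (real (Suc n)) \<and> dist w z \<le> (1 - l) * dist x z + inverse (real (Suc n))" for n
        by (rule approximate_intermediate_points[OF assms(1-3) l(1,2)]) simp
      then obtain w where w: "\<And>n. dist x (w n) \<le> l * T + inverse (real (Suc n))" "\<And>n. dist (w n) z \<le> (1 - l) * T + inverse (real (Suc n))"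
        unfolding z by metis
      have lb: "r - inverse (real (Suc n)) \<le> dist x (w n)" for n
        using w(2)[of n] dist_triangle[of x z "w n"] l(3) z by (simp add: left_diff_distrib)
      show ?thesis
      proof (rule lim)
        show "dist x (w n) \<le> r + 1" for n
          using w(1)[of n] l(3) le_imp_inverse_le[of 1 "real (Suc n)"] by simp
        have "(\<lambda>n. r + inverse (real (Suc n))) \<longlonglongrightarrow> r + 0" "(\<lambda>n. r - inverse (real (Suc n))) \<longlonglongrightarrow> r - 0"
          by (intro tendsto_intros LIMSEQ_inverse_real_of_nat)+
        then have lims: "(\<lambda>n. r + inverse (real (Suc n))) \<longlonglongrightarrow> r" "(\<lambda>n. r - inverse (real (Suc n))) \<longlonglongrightarrow> r"
          by simp_all
        show "(\<lambda>n. dist x (w n)) \<longlonglongrightarrow> r"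
        proof (rule tendsto_sandwich[OF _ _ lims(2,1)])
          show "\<forall>\<^sub>F n in sequentially. r - inverse (real (Suc n)) \<le> dist x (w n)"
            by (intro always_eventually allI lb)
          show "\<forall>\<^sub>F n in sequentially. dist x (w n) \<le> r + inverse (real (Suc n))"
            using w(1) unfolding l(3) by (intro always_eventually allI)
        qed
      qed
    qed
  qed
  show "closed (radii x)"
    unfolding closed_sequential_limits
  proof (intro allI impI, elim conjE)
    fix s l assume s: "\<forall>n. s n \<in> radii x" "s \<longlonglongrightarrow> l"
    have "\<exists>z. dist x z = s n" for n
    proof -
      have "sphere x (s n) \<noteq> {}" using s(1) by (simp add: radii_def)
      then show ?thesis by (metis all_not_in_conv mem_sphere)
    qed
    then obtain z where z: "\<And>n. dist x (z n) = s n" by metis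
    obtain B where "\<And>n. norm (s n) \<le> B" using convergent_imp_Bseq[of s] s(2) by (auto simp: convergent_def Bseq_def)
    then show "l \<in> radii x" using s(2) z by (intro lim[of z B]) (auto simp: abs_le_iff)
  qed
qed

text \<open>The envelope is a supremum over minorants, so it is useful only if there is at least one. The step
  function \<open>g\<close> below, the infimum of \<open>k\<close> over a ball of radius \<open>\<lfloor>r\<rfloor> + 1\<close>, is one: it is
  nonincreasing with jumps at integers, where it takes the lower value.\<close>

lemma radial_lsc_properties:
  fixes m :: "'a::polish_space measure" and x :: 'a
  assumes "metric_measure_space m" "msupport m = UNIV" "CD m k N" "1 < N" "admissible k"
  shows "lsc_on (radii x) (radial_lsc k x)"
    and "\<exists>C. \<forall>r\<in>radii x. r \<le> T \<longrightarrow> - C \<le> radial_lsc k x r"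
    and "radial_lsc k x (dist x p) \<le> k p"
proof -
  have bb: "bdd_below (k ` cball x r)" for r by (rule CD_bounded_below_on_balls[OF assms])
  define B where "B n = (INF y\<in>cball x (real n + 1). k y)" for n :: nat
  have Bk: "B n \<le> k y" if "dist x y \<le> real n + 1" for n y
    unfolding B_def using that by (intro cINF_lower bb) auto
  have Bmono: "B n' \<le> B n" if "n \<le> n'" for n n'
    unfolding B_def using that by (intro cINF_superset_mono bb) auto
  define g where "g r = B (nat \<lfloor>r\<rfloor>)" for r :: real
  define G where "G r = {h r |h. lsc_on (radii x) h \<and> (\<forall>y\<in>radii x. h y \<le> radial_min k x y)}" for r
  have E: "radial_lsc k x r = Sup (G r)" for r by (simp add: radial_lsc_def lsc_envelope_def G_def)
  have glsc: "lsc_on (radii x) g"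
    unfolding lsc_on_def
  proof (intro ballI allI impI)
    fix r a assume r: "r \<in> radii x" and a: "a < g r"
    have "\<forall>\<^sub>F s in at r within radii x. s < of_int \<lfloor>r\<rfloor> + 1"
      by (rule order_tendstoD(2)[OF tendsto_ident_at]) linarith
    then show "\<forall>\<^sub>F s in at r within radii x. a < g s"
    proof eventually_elim
      case (elim s)
      then have "nat \<lfloor>s\<rfloor> \<le> nat \<lfloor>r\<rfloor>" by (intro nat_mono) linarith
      then show ?case using a Bmono[of "nat \<lfloor>s\<rfloor>" "nat \<lfloor>r\<rfloor>"] by (simp add: g_def)
    qed
  qed
  have gmin: "g r \<le> radial_min k x r" if "r \<in> radii x" for r
    unfolding radial_min_def
  proof (rule cINF_greatest)
    show "sphere x r \<noteq> {}" using that by (simp add: radii_def)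
    fix y assume y: "y \<in> sphere x r"
    then have "dist x y = r" "0 \<le> r" using that by (simp_all add: radii_def)
    then have "dist x y \<le> real (nat \<lfloor>r\<rfloor>) + 1" by linarith
    then show "g r \<le> k y" unfolding g_def by (rule Bk)
  qed
  have gG: "g r \<in> G r" for r using glsc gmin by (auto simp: G_def)
  have Gle: "v \<le> radial_min k x r" if "r \<in> radii x" "v \<in> G r" for r v using that by (auto simp: G_def)
  then have Gbdd: "bdd_above (G r)" if "r \<in> radii x" for r using that by (intro bdd_aboveI) 
  show "lsc_on (radii x) (radial_lsc k x)"
    unfolding lsc_on_def
  proof (intro ballI allI impI)
    fix r a assume r: "r \<in> radii x" and a: "a < radial_lsc k x r"
    then obtain v where "v \<in> G r" "a < v" unfolding E using less_cSup_iff[OF _ Gbdd[OF r], of a] gG by blast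
    then obtain h where h: "lsc_on (radii x) h" "\<forall>y\<in>radii x. h y \<le> radial_min k x y" "a < h r" by (auto simp: G_def)
    have ev: "\<forall>\<^sub>F s in at r within radii x. a < h s" using h r by (auto simp: lsc_on_def)
    have "h s \<le> radial_lsc k x s" if "s \<in> radii x" for s
      unfolding E using h that by (intro cSup_upper Gbdd) (auto simp: G_def)
    then show "\<forall>\<^sub>F s in at r within radii x. a < radial_lsc k x s"
      using ev unfolding eventually_at_filter by (auto elim!: eventually_mono intro: less_le_trans)
  qed
  have gle: "g r \<le> radial_lsc k x r" if "r \<in> radii x" for r
    unfolding E by (rule cSup_upper[OF gG Gbdd[OF that]])
  show "\<exists>C. \<forall>r\<in>radii x. r \<le> T \<longrightarrow> - C \<le> radial_lsc k x r"
  proof (intro exI[of _ "- B (nat \<lfloor>T\<rfloor>)"] ballI impI)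
    fix r assume r: "r \<in> radii x" "r \<le> T"
    have "B (nat \<lfloor>T\<rfloor>) \<le> g r" unfolding g_def using r by (intro Bmono nat_mono floor_mono)
    then show "- (- B (nat \<lfloor>T\<rfloor>)) \<le> radial_lsc k x r" using gle[OF r(1)] by simp
  qed
  have pr: "dist x p \<in> radii x" by (auto simp: radii_def sphere_def)
  have "radial_lsc k x (dist x p) \<le> radial_min k x (dist x p)"
    unfolding E using gG by (intro cSup_least Gle[OF pr]) auto
  also have "\<dots> \<le> k p"
    unfolding radial_min_def
  proof (rule cINF_lower)
    show "bdd_below (k ` sphere x (dist x p))" by (rule bdd_below_mono[OF bb[of "dist x p"]]) auto
  qed auto
  finally show "radial_lsc k x (dist x p) \<le> k p" .
qed

section \<open>Comparison of a monotone function with a density\<close>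

lemma positive_continuous_ratio:
  fixes k :: "real \<Rightarrow> real"
  assumes cont: "continuous_on {a..d} k" and pos: "\<And>s. s \<in> {a..d} \<Longrightarrow> 0 < k s" and \<epsilon>: "0 < \<epsilon>" and ad: "a \<le> d"
  shows "\<exists>\<delta>>0. \<forall>y\<in>{a..d}. \<forall>y'\<in>{a..d}. \<bar>y - y'\<bar> < \<delta> \<longrightarrow> k y \<le> (1 + \<epsilon>) * k y'"
proof -
  obtain z where z: "z \<in> {a..d}" "\<And>s. s \<in> {a..d} \<Longrightarrow> k z \<le> k s"
    using continuous_attains_inf[OF compact_Icc _ cont] ad by auto
  have "uniformly_continuous_on {a..d} k" by (rule compact_uniformly_continuous[OF cont compact_Icc])
  moreover have "0 < \<epsilon> * k z" using \<epsilon> pos[OF z(1)] by simp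
  ultimately obtain \<delta> where \<delta>: "\<delta> > 0" "\<And>y y'. y \<in> {a..d} \<Longrightarrow> y' \<in> {a..d} \<Longrightarrow> dist y' y < \<delta> \<Longrightarrow> dist (k y') (k y) < \<epsilon> * k z"
    unfolding uniformly_continuous_on_def by metis
  have "k y \<le> (1 + \<epsilon>) * k y'" if "y \<in> {a..d}" "y' \<in> {a..d}" "\<bar>y - y'\<bar> < \<delta>" for y y'
  proof -
    have "\<bar>k y - k y'\<bar> < \<epsilon> * k z" using \<delta>(2)[of y' y] that by (simp add: dist_real_def)
    also have "\<epsilon> * k z \<le> \<epsilon> * k y'" using z that \<epsilon> by (intro mult_left_mono) auto
    finally show ?thesis by (simp add: distrib_right)
  qed
  then show ?thesis using \<delta>(1) by blast
qed

lemma deriv_within_mvt: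
  fixes K k :: "real \<Rightarrow> real"
  assumes der: "\<And>s. s \<in> {a..d} \<Longrightarrow> (K has_real_derivative k s) (at s within {a..d})"
    and "a \<le> p" "p < q" "q \<le> d"
  obtains \<xi> where "p < \<xi>" "\<xi> < q" "K q - K p = (q - p) * k \<xi>"
proof -
  have 1: "(K has_real_derivative k s) (at s)" if "p < s" "s < q" for s
  proof -
    have "s \<in> interior {a..d}" using that assms by auto
    then show ?thesis using der[of s] at_within_interior interior_subset by (metis subsetD)
  qed
  have 2: "continuous_on {p..q} K"
    using assms DERIV_continuous_on[of "{a..d}" K k, OF der] by (auto intro: continuous_on_subset)
  obtain l \<xi> where "p < \<xi>" "\<xi> < q" "(K has_real_derivative l) (at \<xi>)" "K q - K p = (q - p) * l"
    using MVT[OF \<open>p < q\<close> 2] 1 real_differentiable_def by metis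
  then show ?thesis using that 1 DERIV_unique by blast
qed

text \<open>The hypothesis says that translation to the left by \<open>\<tau>\<close> increases the increment of \<open>f\<close> at least by the
  ratio of the values of \<open>k\<close>. Cut \<open>{a..r}\<close> and \<open>{r..d}\<close> into cells of equal length \<open>s\<close>, up to a remainder
  at \<open>a\<close>. Any cell on the left is a translate of any cell on the right, and since \<open>k\<close> varies little on
  a cell, the increments satisfy \<open>\<Delta>f\<^sub>right * \<Delta>K\<^sub>left \<le> (1 + \<epsilon>)\<^sup>3 * (\<Delta>f\<^sub>left * \<Delta>K\<^sub>right)\<close>. Sum over all pairs of cells; the term
  \<open>B * \<epsilon>\<close> accounts for the remainder.\<close>

lemma comparison_additive_approx:
  fixes f K k :: "real \<Rightarrow> real"
  assumes ard: "a < r" "r < d"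
    and mono: "\<And>p q. a \<le> p \<Longrightarrow> p \<le> q \<Longrightarrow> q \<le> d \<Longrightarrow> f p \<le> f q"
    and der: "\<And>s. s \<in> {a..d} \<Longrightarrow> (K has_real_derivative k s) (at s within {a..d})"
    and cont: "continuous_on {a..d} k" and pos: "\<And>s. s \<in> {a..d} \<Longrightarrow> 0 < k s"
    and comp: "\<And>c \<tau> p q. 0 \<le> c \<Longrightarrow> 0 < \<tau> \<Longrightarrow> a + \<tau> \<le> p \<Longrightarrow> p \<le> q \<Longrightarrow> q \<le> d \<Longrightarrow>
      (\<And>\<theta>. \<theta> \<in> {p..q} \<Longrightarrow> c * k \<theta> < k (\<theta> - \<tau>)) \<Longrightarrow> c * (f q - f p) \<le> f (q - \<tau>) - f (p - \<tau>)"
    and B: "\<And>s. s \<in> {a..d} \<Longrightarrow> k s \<le> B" and \<epsilon>: "0 < \<epsilon>"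
  shows "(f d - f r) * (K r - K a - B * \<epsilon>) \<le> (1 + \<epsilon>) ^ 3 * ((f r - f a) * (K d - K r))"
proof -
  have Kmono: "K p \<le> K q" if "a \<le> p" "p \<le> q" "q \<le> d" for p q
    by (rule nonneg_deriv_within_mono[OF der]) (use pos that in \<open>auto intro: less_imp_le\<close>)
  obtain \<delta> where \<delta>: "\<delta> > 0" "\<And>y y'. y \<in> {a..d} \<Longrightarrow> y' \<in> {a..d} \<Longrightarrow> \<bar>y - y'\<bar> < \<delta> \<Longrightarrow> k y \<le> (1 + \<epsilon>) * k y'"
    using positive_continuous_ratio[OF cont pos \<epsilon>] ard by (meson less_imp_le order.trans)
  obtain n0 where n0: "(d - r) / min \<delta> \<epsilon> < real n0" using reals_Archimedean2 by blast
  define n where "n = Suc n0"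
  define s where "s = (d - r) / real n"
  have s: "0 < s" using ard by (simp add: s_def n_def)
  have "d - r < min \<delta> \<epsilon> * real n" using n0 \<delta> \<epsilon> by (simp add: n_def divide_less_eq) (auto simp: field_simps min_def split: if_splits)
  moreover have "0 < real n" by (simp add: n_def)
  ultimately have "s < min \<delta> \<epsilon>" unfolding s_def by (subst pos_divide_less_eq)
  then have s\<delta>: "s < \<delta>" "s < \<epsilon>" by auto
  have ns: "real n * s = d - r" by (simp add: s_def n_def)
  \<comment> \<open>The number of whole cells that fit into \<open>{a..r}\<close>.\<close>
  define M where "M = nat \<lfloor>(r - a) / s\<rfloor>"
  have "0 \<le> (r - a) / s" using s ard by simp
  then have "real M \<le> (r - a) / s" "(r - a) / s < real M + 1" unfolding M_def by linarith+
  then have M: "real M * s \<le> r - a" "r - a < real M * s + s" using s by (auto simp: field_simps)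
  define L where "L i = r - real i * s" for i :: nat
  define Rt where "Rt j = r + real j * s" for j :: nat
  have L: "L (Suc i) = L i - s" "a \<le> L (Suc i)" "L i \<le> r" if "i < M" for i
  proof -
    have "real (Suc i) * s \<le> real M * s" using that s by (intro mult_right_mono) auto
    then show "a \<le> L (Suc i)" using M unfolding L_def by linarith
  qed (use s in \<open>auto simp: L_def algebra_simps\<close>)
  have Rt: "Rt (Suc j) = Rt j + s" "Rt (Suc j) \<le> d" "r \<le> Rt j" if "j < n" for j
  proof -
    have "real (Suc j) * s \<le> real n * s" using that s by (intro mult_right_mono) auto
    then show "Rt (Suc j) \<le> d" using ns unfolding Rt_def by linarith
  qed (use s in \<open>auto simp: Rt_def algebra_simps\<close>)
  define e3 where "e3 = (1 + \<epsilon>) ^ 3"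
  have e3: "0 < e3" using \<epsilon> by (simp add: e3_def)
  \<comment> \<open>Two factors \<open>1 + \<epsilon>\<close> pay for the variation of \<open>k\<close> on the two cells, the third one makes the hypothesis strict.\<close>
  have cell: "(f (Rt (Suc j)) - f (Rt j)) * (K (L i) - K (L (Suc i))) \<le> e3 * ((f (L i) - f (L (Suc i))) * (K (Rt (Suc j)) - K (Rt j)))"
    if i: "i < M" and j: "j < n" for i j
  proof -
    note Li = L[OF i] and Rj = Rt[OF j]
    define \<tau> where "\<tau> = Rt j - L (Suc i)"
    have \<tau>: "0 < \<tau>" "Rt j - \<tau> = L (Suc i)" "Rt (Suc j) - \<tau> = L i" using Li Rj s by (auto simp: \<tau>_def)
    obtain \<xi>i where \<xi>i: "L (Suc i) < \<xi>i" "\<xi>i < L i" "K (L i) - K (L (Suc i)) = (L i - L (Suc i)) * k \<xi>i"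
      by (rule deriv_within_mvt[OF der, where p = "L (Suc i)" and q = "L i"]) (use Li s ard in auto)
    obtain \<xi>j where \<xi>j: "Rt j < \<xi>j" "\<xi>j < Rt (Suc j)" "K (Rt (Suc j)) - K (Rt j) = (Rt (Suc j) - Rt j) * k \<xi>j"
      by (rule deriv_within_mvt[OF der, where p = "Rt j" and q = "Rt (Suc j)"]) (use Rj s ard in auto)
    have ki: "0 < k \<xi>i" and kj: "0 < k \<xi>j" using \<xi>i \<xi>j Li Rj ard by (auto intro!: pos)
    define c where "c = k \<xi>i / (e3 * k \<xi>j)"
    have c: "0 \<le> c" "c * (e3 * k \<xi>j) = k \<xi>i" using ki kj e3 by (auto simp: c_def)
    have "c * (f (Rt (Suc j)) - f (Rt j)) \<le> f (Rt (Suc j) - \<tau>) - f (Rt j - \<tau>)"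
    proof (rule comp[OF c(1) \<tau>(1)])
      fix \<theta> assume \<theta>: "\<theta> \<in> {Rt j..Rt (Suc j)}"
      have \<theta>': "\<theta> - \<tau> \<in> {L (Suc i)..L i}" using \<theta> \<tau> by auto
      have 1: "k \<theta> \<le> (1 + \<epsilon>) * k \<xi>j" using \<theta> \<xi>j Rj ard s\<delta> by (intro \<delta>(2)) (auto simp: abs_if)
      have 2: "k \<xi>i \<le> (1 + \<epsilon>) * k (\<theta> - \<tau>)" using \<theta>' \<xi>i Li ard s\<delta> by (intro \<delta>(2)) (auto simp: abs_if)
      have k3: "0 < k (\<theta> - \<tau>)" using \<theta>' Li ard by (intro pos) auto
      have "c * k \<theta> \<le> c * ((1 + \<epsilon>) * k \<xi>j)" by (rule mult_left_mono[OF 1 c(1)])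
      then have "(1 + \<epsilon>)\<^sup>2 * (c * k \<theta>) \<le> (1 + \<epsilon>)\<^sup>2 * (c * ((1 + \<epsilon>) * k \<xi>j))" by (rule mult_left_mono) simp
      also have "\<dots> = k \<xi>i" using c(2) by (simp add: e3_def power2_eq_square power3_eq_cube mult_ac)
      also note 2
      also have "(1 + \<epsilon>) * k (\<theta> - \<tau>) < (1 + \<epsilon>) * ((1 + \<epsilon>) * k (\<theta> - \<tau>))" using k3 \<epsilon> by simp
      also have "\<dots> = (1 + \<epsilon>)\<^sup>2 * k (\<theta> - \<tau>)" by (simp add: power2_eq_square)
      finally show "c * k \<theta> < k (\<theta> - \<tau>)" using \<epsilon> by (simp add: mult_less_cancel_left_pos)
    qed (use Li Rj s in \<open>auto simp: \<tau>_def\<close>)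
    then have "c * (f (Rt (Suc j)) - f (Rt j)) \<le> f (L i) - f (L (Suc i))" unfolding \<tau> .
    then have "(e3 * k \<xi>j * s) * (c * (f (Rt (Suc j)) - f (Rt j))) \<le> (e3 * k \<xi>j * s) * (f (L i) - f (L (Suc i)))"
      using e3 kj s by (intro mult_left_mono) auto
    also have "(e3 * k \<xi>j * s) * (f (L i) - f (L (Suc i))) = e3 * ((f (L i) - f (L (Suc i))) * (s * k \<xi>j))"
      by (simp add: mult_ac)
    also have "(e3 * k \<xi>j * s) * (c * (f (Rt (Suc j)) - f (Rt j))) = (f (Rt (Suc j)) - f (Rt j)) * (s * k \<xi>i)"
      unfolding c(2)[symmetric] by (simp add: mult_ac)
    finally have "(f (Rt (Suc j)) - f (Rt j)) * (s * k \<xi>i) \<le> e3 * ((f (L i) - f (L (Suc i))) * (s * k \<xi>j))" .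
    moreover have "K (L i) - K (L (Suc i)) = s * k \<xi>i" "K (Rt (Suc j)) - K (Rt j) = s * k \<xi>j"
      using \<xi>i(3) \<xi>j(3) Li Rj by simp_all
    ultimately show ?thesis by (simp only:)
  qed
  have "(\<Sum>j<n. f (Rt (Suc j)) - f (Rt j)) * (\<Sum>i<M. K (L i) - K (L (Suc i)))
    = (\<Sum>i<M. \<Sum>j<n. (f (Rt (Suc j)) - f (Rt j)) * (K (L i) - K (L (Suc i))))"
    unfolding sum_product by (rule sum.swap)
  also have "\<dots> \<le> (\<Sum>i<M. \<Sum>j<n. e3 * ((f (L i) - f (L (Suc i))) * (K (Rt (Suc j)) - K (Rt j))))"
    by (intro sum_mono cell) auto
  also have "\<dots> = e3 * ((\<Sum>i<M. f (L i) - f (L (Suc i))) * (\<Sum>j<n. K (Rt (Suc j)) - K (Rt j)))"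
    unfolding sum_product by (simp only: sum_distrib_left)
  finally have "(\<Sum>j<n. f (Rt (Suc j)) - f (Rt j)) * (\<Sum>i<M. K (L i) - K (L (Suc i)))
    \<le> e3 * ((\<Sum>i<M. f (L i) - f (L (Suc i))) * (\<Sum>j<n. K (Rt (Suc j)) - K (Rt j)))" .
  then have "(f (Rt n) - f (Rt 0)) * (K (L 0) - K (L M)) \<le> e3 * ((f (L 0) - f (L M)) * (K (Rt n) - K (Rt 0)))"
    unfolding sum_lessThan_telescope[of "\<lambda>j. f (Rt j)" n] sum_lessThan_telescope[of "\<lambda>j. K (Rt j)" n]
      sum_lessThan_telescope'[of "\<lambda>i. f (L i)" M] sum_lessThan_telescope'[of "\<lambda>i. K (L i)" M] .
  then have main: "(f d - f r) * (K r - K (L M)) \<le> e3 * ((f r - f (L M)) * (K d - K r))"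
    using ns by (simp add: Rt_def L_def)
  have LM: "a \<le> L M" "L M < a + s" "L M \<le> r" using M s by (auto simp: L_def)
  have "K (L M) - K a \<le> B * \<epsilon>"
  proof (cases "L M = a")
    case True
    have "0 < B" using pos[of a] B[of a] ard by auto
    then show ?thesis using True \<epsilon> by simp
  next
    case False
    obtain \<xi> where \<xi>: "a < \<xi>" "\<xi> < L M" "K (L M) - K a = (L M - a) * k \<xi>"
      by (rule deriv_within_mvt[OF der, where p = a and q = "L M"]) (use LM False ard in auto)
    have "(L M - a) * k \<xi> \<le> \<epsilon> * B"
      using LM \<xi> s\<delta> ard \<epsilon> pos[of \<xi>] by (intro mult_mono B) (auto intro: less_imp_le)
    then show ?thesis using \<xi>(3) by (simp add: mult.commute)
  qed
  then have "(f d - f r) * (K r - K a - B * \<epsilon>) \<le> (f d - f r) * (K r - K (L M))"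
    using mono[of r d] ard by (intro mult_left_mono) auto
  also note main
  also have "e3 * ((f r - f (L M)) * (K d - K r)) \<le> e3 * ((f r - f a) * (K d - K r))"
    using mono[of a "L M"] Kmono[of r d] LM ard e3 by (intro mult_left_mono mult_right_mono) auto
  finally show ?thesis by (simp add: e3_def)
qed

lemma comparison_additive:
  fixes f K k :: "real \<Rightarrow> real"
  assumes ard: "a < r" "r < d"
    and mono: "\<And>p q. a \<le> p \<Longrightarrow> p \<le> q \<Longrightarrow> q \<le> d \<Longrightarrow> f p \<le> f q"
    and der: "\<And>s. s \<in> {a..d} \<Longrightarrow> (K has_real_derivative k s) (at s within {a..d})"
    and cont: "continuous_on {a..d} k" and pos: "\<And>s. s \<in> {a..d} \<Longrightarrow> 0 < k s"
    and comp: "\<And>c \<tau> p q. 0 \<le> c \<Longrightarrow> 0 < \<tau> \<Longrightarrow> a + \<tau> \<le> p \<Longrightarrow> p \<le> q \<Longrightarrow> q \<le> d \<Longrightarrow>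
      (\<And>\<theta>. \<theta> \<in> {p..q} \<Longrightarrow> c * k \<theta> < k (\<theta> - \<tau>)) \<Longrightarrow> c * (f q - f p) \<le> f (q - \<tau>) - f (p - \<tau>)"
  shows "(f d - f r) * (K r - K a) \<le> (f r - f a) * (K d - K r)"
proof -
  obtain z where z: "z \<in> {a..d}" "\<And>s. s \<in> {a..d} \<Longrightarrow> k s \<le> k z"
    using continuous_attains_sup[OF compact_Icc _ cont] ard by auto
  define \<epsilon> where "\<epsilon> n = inverse (real (Suc n))" for n
  have \<epsilon>: "\<epsilon> \<longlonglongrightarrow> 0" unfolding \<epsilon>_def by (rule LIMSEQ_inverse_real_of_nat)
  have "(\<lambda>n. (f d - f r) * (K r - K a - k z * \<epsilon> n)) \<longlonglongrightarrow> (f d - f r) * (K r - K a - k z * 0)"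
    "(\<lambda>n. (1 + \<epsilon> n) ^ 3 * ((f r - f a) * (K d - K r))) \<longlonglongrightarrow> (1 + 0) ^ 3 * ((f r - f a) * (K d - K r))"
    by (intro tendsto_intros \<epsilon>)+
  then have "(f d - f r) * (K r - K a - k z * 0) \<le> (1 + 0) ^ 3 * ((f r - f a) * (K d - K r))"
  proof (rule LIMSEQ_le)
    show "\<exists>N. \<forall>n\<ge>N. (f d - f r) * (K r - K a - k z * \<epsilon> n) \<le> (1 + \<epsilon> n) ^ 3 * ((f r - f a) * (K d - K r))"
      by (intro exI allI impI comparison_additive_approx[OF ard mono der cont pos comp z(2)]) (auto simp: \<epsilon>_def)
  qed
  then show ?thesis by simp
qed

text \<open>In logarithmic coordinates scaling by \<open>t\<close> is translation by \<open>- ln t\<close>, and the factor \<open>t\<close> in the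
  hypothesis is absorbed by the density \<open>h (exp y) * exp y\<close> of \<open>H (exp y)\<close>. The conclusion compares
  the average slopes of \<open>v\<close> as a function of \<open>H\<close> on the two sides of \<open>r\<close>.\<close>

lemma comparison_multiplicative:
  fixes v H h :: "real \<Rightarrow> real"
  assumes ard: "0 < a" "a < r" "r < d"
    and mono: "\<And>p q. a \<le> p \<Longrightarrow> p \<le> q \<Longrightarrow> q \<le> d \<Longrightarrow> v p \<le> v q"
    and der: "\<And>s. s \<in> {a..d} \<Longrightarrow> (H has_real_derivative h s) (at s within {a..d})"
    and cont: "continuous_on {a..d} h" and pos: "\<And>s. s \<in> {a..d} \<Longrightarrow> 0 < h s"
    and comp: "\<And>c t p q. 0 \<le> c \<Longrightarrow> 0 < t \<Longrightarrow> t < 1 \<Longrightarrow> a \<le> t * p \<Longrightarrow> p \<le> q \<Longrightarrow> q \<le> d \<Longrightarrow>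
      (\<And>\<theta>. \<theta> \<in> {p..q} \<Longrightarrow> c * h \<theta> < h (t * \<theta>)) \<Longrightarrow> t * c * (v q - v p) \<le> v (t * q) - v (t * p)"
  shows "(v d - v r) * (H r - H a) \<le> (v r - v a) * (H d - H r)"
proof -
  have im: "exp ` {ln a..ln d} \<subseteq> {a..d}"
  proof (clarsimp, intro conjI)
    fix y assume y: "ln a \<le> y" "y \<le> ln d"
    show "a \<le> exp y" "exp y \<le> d" using y ard by (metis exp_le_cancel_iff exp_ln less_trans)+
  qed
  have ee: "exp y \<in> {a..d}" if "y \<in> {ln a..ln d}" for y using im that by blast
  have "((\<lambda>y. v (exp y)) (ln d) - (\<lambda>y. v (exp y)) (ln r)) * ((\<lambda>y. H (exp y)) (ln r) - (\<lambda>y. H (exp y)) (ln a))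
    \<le> ((\<lambda>y. v (exp y)) (ln r) - (\<lambda>y. v (exp y)) (ln a)) * ((\<lambda>y. H (exp y)) (ln d) - (\<lambda>y. H (exp y)) (ln r))"
  proof (rule comparison_additive[where f = "\<lambda>y. v (exp y)" and K = "\<lambda>y. H (exp y)" and k = "\<lambda>y. h (exp y) * exp y"])
    show "v (exp p) \<le> v (exp q)" if "ln a \<le> p" "p \<le> q" "q \<le> ln d" for p q
      using ee[of p] ee[of q] that by (intro mono) auto
    show "((\<lambda>y. H (exp y)) has_real_derivative h (exp s) * exp s) (at s within {ln a..ln d})" if "s \<in> {ln a..ln d}" for s
    proof -
      have A: "(H has_real_derivative h (exp s)) (at (exp s) within exp ` {ln a..ln d})"
        by (rule DERIV_subset[OF der[OF ee[OF that]] im])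
      have B: "(exp has_real_derivative exp s) (at s within {ln a..ln d})"
        by (auto intro!: derivative_eq_intros)
      show ?thesis using DERIV_image_chain[OF A B] unfolding o_def .
    qed
    show "continuous_on {ln a..ln d} (\<lambda>y. h (exp y) * exp y)"
      by (intro continuous_intros continuous_on_compose2[OF cont _ im])
    show "0 < h (exp s) * exp s" if "s \<in> {ln a..ln d}" for s using pos[OF ee[OF that]] by simp
    show "c * (v (exp q) - v (exp p)) \<le> v (exp (q - \<tau>)) - v (exp (p - \<tau>))"
      if c: "0 \<le> c" and \<tau>: "0 < \<tau>" and pq: "ln a + \<tau> \<le> p" "p \<le> q" "q \<le> ln d"
        and cc: "\<And>\<theta>. \<theta> \<in> {p..q} \<Longrightarrow> c * (h (exp \<theta>) * exp \<theta>) < h (exp (\<theta> - \<tau>)) * exp (\<theta> - \<tau>)" for c \<tau> p q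
    proof -
      define t where "t = exp (- \<tau>)"
      have t: "0 < t" "t < 1" using \<tau> by (auto simp: t_def)
      have te: "exp (y - \<tau>) = t * exp y" for y by (simp add: t_def exp_diff exp_minus field_simps)
      have "t * (c / t) * (v (exp q) - v (exp p)) \<le> v (t * exp q) - v (t * exp p)"
      proof (rule comp)
        show "a \<le> t * exp p" unfolding te[symmetric] using ee[of "p - \<tau>"] pq \<tau> by auto
        show "exp q \<le> d" using ee[of q] pq \<tau> by auto
        fix \<theta> assume \<theta>: "\<theta> \<in> {exp p..exp q}"
        then have \<theta>0: "0 < \<theta>" using exp_gt_zero[of p] by (meson atLeastAtMost_iff less_le_trans)
        then have "ln \<theta> \<in> {p..q}" using \<theta> by (auto simp: ln_ge_iff) (metis exp_le_cancel_iff exp_ln)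
        from cc[OF this] have "c * h \<theta> * \<theta> < t * h (t * \<theta>) * \<theta>" using \<theta>0 by (simp add: te mult_ac)
        then have "c * h \<theta> < t * h (t * \<theta>)" using \<theta>0 by simp
        then show "c / t * h \<theta> < h (t * \<theta>)" using t by (simp add: field_simps)
      qed (use c t pq in auto)
      then show ?thesis using t by (simp add: te)
    qed
  qed (use ard in auto)
  then show ?thesis using ard by simp
qed

section \<open>Comparison of spheres and balls\<close>

lemma lsc_on_divide:
  assumes "lsc_on S f" "0 < (c::real)"
  shows "lsc_on S (\<lambda>r. f r / c)"
  using assms by (auto simp: lsc_on_def pos_less_divide_eq)

text \<open>Throughout, \<open>kap\<close> is the model curvature, \<open>u n\<close> the sine of its \<open>n\<close>-th Lipschitz approximation, \<open>g\<close> their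
  limit, the model sine, and \<open>v w\<close> the volume of the ball of radius \<open>w\<close>. The approximations are formed
  on \<open>{0..R}\<close>; as infima they define Lipschitz functions on the whole line, and \<open>u n\<close> solves the equation up to
  \<open>R + 1\<close>, because the sphere volume at \<open>R\<close> involves radii slightly larger than \<open>R\<close>.\<close>

locale bishop_gromov =
  fixes m :: "'a::polish_space measure" and k :: "'a \<Rightarrow> real" and N :: real and x :: 'a and R :: real
  assumes mms: "metric_measure_space m" and supp: "msupport m = UNIV" and adm: "admissible k"
    and CD: "CD m k N" and N: "1 < N" and R: "0 < R" and Rpi: "ennreal R \<le> model_pi k N x"
begin

definition kap :: "real \<Rightarrow> real" where "kap r = radial_lsc k x r / (N - 1)"
definition u :: "nat \<Rightarrow> real \<Rightarrow> real" where "u n = sine (lip_approx kap R n) (R + 1)"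
definition g :: "real \<Rightarrow> real" where "g = gsine_on kap R"
definition v :: "real \<Rightarrow> real" where "v w = measure m (cball x w)"

lemmas sm = metric_measure_spaceD[OF mms]
lemmas rlp = radial_lsc_properties[OF mms supp CD N adm]
lemmas ri = radii_interval[OF mms supp CD N adm]

lemma kap_lsc: "lsc_on (radii x) kap"
  unfolding kap_def using rlp(1) N by (intro lsc_on_divide) auto

lemma kap_le: "(N - 1) * kap (dist x p) \<le> k p"
  using rlp(3)[of x p] N by (simp add: kap_def)

lemma dist_in_radii: "dist x p \<in> radii x"
  by (auto simp: radii_def sphere_def)

lemma kap_bounded_below: "\<exists>C. \<forall>r\<in>radii x. r \<le> T \<longrightarrow> - C \<le> kap r"
proof -
  obtain C where C: "\<forall>r\<in>radii x. r \<le> T \<longrightarrow> - C \<le> radial_lsc k x r" using rlp(2) by blast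
  show ?thesis
  proof (intro exI[of _ "C / (N - 1)"] ballI impI)
    fix r assume "r \<in> radii x" "r \<le> T"
    then have "- C / (N - 1) \<le> radial_lsc k x r / (N - 1)" using C N by (intro divide_right_mono) auto
    then show "- (C / (N - 1)) \<le> kap r" by (simp add: kap_def)
  qed
qed

lemma
  shows domain: "gsine_domain (radii x) kap R" and g_pos: "s \<in> {0<..<R} \<Longrightarrow> 0 < g s"
    and model_sine_eq: "s \<in> {0..R} \<Longrightarrow> model_sine k N x s = g s"
proof -
  have bdd: "\<exists>C. \<forall>r\<in>{0..T}. - C \<le> kap r" if "T \<in> radii x" for T
  proof -
    obtain C where "\<forall>r\<in>radii x. r \<le> T \<longrightarrow> - C \<le> kap r" using kap_bounded_below by blast
    then show ?thesis using ri(1)[OF that] by (intro exI[of _ C]) auto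
  qed
  have pi: "ennreal R \<le> gpi (radii x) kap"
    using Rpi by (simp add: model_pi_def kap_def[abs_def])
  note gg = gsine_up_to_gpi[OF ri(1) ri(2) kap_lsc bdd R pi]
  show "gsine_domain (radii x) kap R" by (rule gg(1))
  show "s \<in> {0<..<R} \<Longrightarrow> 0 < g s" unfolding g_def by (rule gg(2))
  show "s \<in> {0..R} \<Longrightarrow> model_sine k N x s = g s"
    unfolding g_def model_sine_def kap_def[abs_def, symmetric] by (rule gg(3))
qed

lemma R_radii: "R \<in> radii x" and radii_subset: "{0..R} \<subseteq> radii x"
  using domain ri(1) by (auto simp: gsine_domain_def)

lemma kap_lower: obtains C where "\<And>r. r \<in> {0..R} \<Longrightarrow> - C \<le> kap r"
proof -
  obtain C where "\<forall>r\<in>radii x. r \<le> R \<longrightarrow> - C \<le> kap r" using kap_bounded_below by blast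
  moreover have "r \<in> radii x" "r \<le> R" if "r \<in> {0..R}" for r using that radii_subset by auto
  ultimately show ?thesis by (intro that[of C]) blast
qed

lemma lip_cont: "continuous_on S (lip_approx kap R n)"
proof -
  obtain C where C: "\<And>r. r \<in> {0..R} \<Longrightarrow> - C \<le> kap r" by (rule kap_lower) blast
  show ?thesis by (rule lip_approx_continuous[OF less_imp_le[OF R] C])
qed

lemma u_restrict: "s \<in> {0..R} \<Longrightarrow> u n s = sine (lip_approx kap R n) R s"
  unfolding u_def by (rule sine_restrict[OF lip_cont, symmetric]) auto

lemma u_cont: "continuous_on {0..R + 1} (u n)"
  unfolding u_def using R by (intro sine_continuous lip_cont) auto

lemma u_pos: "s \<in> {0<..<R} \<Longrightarrow> 0 < u n s"
  using domain by (auto simp: u_restrict gsine_domain_def)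

lemma
  assumes "s \<in> {0..R}"
  shows u_lim: "(\<lambda>n. u n s) \<longlonglongrightarrow> g s" and g_nonneg: "0 \<le> g s" and u_nonneg: "0 \<le> u n s" and u_le: "u n s \<le> u 0 s"
proof -
  obtain C where C: "\<And>r. r \<in> {0..R} \<Longrightarrow> - C \<le> kap r" by (rule kap_lower) blast
  have pos: "\<And>n s. s \<in> {0<..<R} \<Longrightarrow> 0 < sine (lip_approx kap R n) R s"
    using domain by (auto simp: gsine_domain_def)
  note gl = gsine_on_limit[OF R C pos assms]
  show "(\<lambda>n. u n s) \<longlonglongrightarrow> g s" "0 \<le> g s" "0 \<le> u n s" "u n s \<le> u 0 s"
    using gl by (simp_all add: u_restrict[OF assms] g_def)
qed

lemma ball_finite: "emeasure m (cball x r) < \<infinity>"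
  by (rule CD_ball_volume_finite[OF mms supp CD N adm])

lemma subset_ball_fmeasurable:
  assumes "A \<in> sets borel" "A \<subseteq> cball x r"
  shows "A \<in> fmeasurable m"
proof -
  have "emeasure m A \<le> emeasure m (cball x r)" using assms sm by (intro emeasure_mono) auto
  then show ?thesis using ball_finite[of r] assms sm by (intro fmeasurableI) (auto intro: order_le_less_trans)
qed

lemma annulus_fmeasurable: "annulus x a b \<in> fmeasurable m"
  by (rule subset_ball_fmeasurable[of _ b]) (auto simp: annulus_def annulus_borel[unfolded annulus_def])

lemma annulus_emeasure: "emeasure m (annulus x a b) = ennreal (measure m (annulus x a b))"
  using annulus_fmeasurable by (simp add: emeasure_eq_measure2)

lemma v_mono: "p \<le> q \<Longrightarrow> v p \<le> v q"
  unfolding v_def using sm subset_ball_fmeasurable[of "cball x q" q] by (intro measure_mono_fmeasurable) auto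

lemma v_nonneg: "0 \<le> v p"
  by (simp add: v_def)

lemma v_diff: "p \<le> q \<Longrightarrow> measure m (cball x q - cball x p) = v q - v p"
  unfolding v_def using subset_ball_fmeasurable[of "cball x q" q] sm
  by (intro measure_Diff) (auto simp: fmeasurable_def)

text \<open>For points at distance at most \<open>R\<close> from \<open>x\<close> this is the Lipschitz continuity of the approximation. Points
  slightly further away are handled by lower semicontinuity of \<open>kap\<close> at \<open>R\<close>.\<close>

lemma curvature_below_lip_approx:
  assumes \<eta>: "0 < \<eta>"
  shows "\<exists>\<delta>>0. \<forall>p s. 0 \<le> s \<longrightarrow> s \<le> R + \<delta> \<longrightarrow> \<bar>dist x p - s\<bar> \<le> \<delta> \<longrightarrow> (N - 1) * (lip_approx kap R n s - \<eta>) \<le> k p"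
proof -
  obtain C where C: "\<And>r. r \<in> {0..R} \<Longrightarrow> - C \<le> kap r" by (rule kap_lower) blast
  note lip = lip_approx_lipschitz[where n = n, OF less_imp_le[OF R] C]
  have "\<forall>\<^sub>F r in at R within radii x. kap R - \<eta> / 2 < kap r"
    using kap_lsc R_radii \<eta> by (auto simp: lsc_on_def)
  then obtain \<delta>1 where \<delta>1: "\<delta>1 > 0"
    "\<And>r. r \<in> radii x \<Longrightarrow> r \<noteq> R \<Longrightarrow> dist r R < \<delta>1 \<Longrightarrow> kap R - \<eta> / 2 < kap r"
    by (auto simp: eventually_at)
  define \<delta> where "\<delta> = min (\<delta>1 / 3) (\<eta> / (4 * (real n + 1)))"
  have \<delta>: "0 < \<delta>" "2 * \<delta> < \<delta>1" using \<delta>1 \<eta> by (auto simp: \<delta>_def)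
  have "\<delta> * (4 * (real n + 1)) \<le> \<eta>"
    using \<eta> by (subst pos_le_divide_eq[symmetric]) (auto simp: \<delta>_def)
  moreover have "\<delta> * (4 * (real n + 1)) = 2 * (real n * (2 * \<delta>)) + 4 * \<delta>" by (simp add: algebra_simps)
  ultimately have n\<delta>: "real n * (2 * \<delta>) \<le> \<eta> / 2" using \<delta> by linarith
  have "(N - 1) * (lip_approx kap R n s - \<eta>) \<le> k p"
    if s: "0 \<le> s" "s \<le> R + \<delta>" "\<bar>dist x p - s\<bar> \<le> \<delta>" for p s
  proof -
    have "lip_approx kap R n s - \<eta> \<le> kap (dist x p)"
    proof (cases "dist x p \<le> R")
      case True
      then have "lip_approx kap R n (dist x p) \<le> kap (dist x p)" by (intro lip_approx_le[OF _ C]) auto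
      moreover have "\<bar>lip_approx kap R n s - lip_approx kap R n (dist x p)\<bar> \<le> real n * \<bar>s - dist x p\<bar>" by (rule lip)
      moreover have "real n * \<bar>s - dist x p\<bar> \<le> real n * (2 * \<delta>)" using s \<delta> by (intro mult_left_mono) auto
      ultimately show ?thesis using n\<delta> \<eta> by linarith
    next
      case False
      then have "dist (dist x p) R < \<delta>1" using s \<delta> by (auto simp: dist_real_def abs_if split: if_splits)
      then have "kap R - \<eta> / 2 < kap (dist x p)" using False by (intro \<delta>1(2) dist_in_radii) auto
      moreover have "lip_approx kap R n R \<le> kap R" using R by (intro lip_approx_le[OF _ C]) auto
      moreover have "\<bar>lip_approx kap R n s - lip_approx kap R n R\<bar> \<le> real n * \<bar>s - R\<bar>" by (rule lip)
      moreover have "real n * \<bar>s - R\<bar> \<le> real n * (2 * \<delta>)" using s False \<delta> by (intro mult_left_mono) (auto simp: abs_if)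
      ultimately show ?thesis using n\<delta> by linarith
    qed
    then have "(N - 1) * (lip_approx kap R n s - \<eta>) \<le> (N - 1) * kap (dist x p)" using N by (intro mult_left_mono) auto
    then show ?thesis using kap_le[of p] by linarith
  qed
  then show ?thesis using \<delta>(1) by blast
qed

text \<open>The strict inequality on the compact interval \<open>{R1..R2}\<close> survives small changes of the curvature and a small
  enlargement of the interval. It is essential that it is written without division: at
  \<open>\<theta> = R\<close> the sine may vanish.\<close>

lemma perturbed_sine_ratio:
  assumes t: "0 < t" "t < 1" and R12: "0 < R1" "R1 \<le> R2" "R2 \<le> R" and c: "0 \<le> c"
    and cu: "\<And>\<theta>. \<theta> \<in> {R1..R2} \<Longrightarrow> c * u n \<theta> < u n (t * \<theta>)"
  shows "\<exists>\<eta>>0. \<exists>\<delta>>0. \<forall>\<theta>. R1 - \<delta> \<le> \<theta> \<longrightarrow> 0 < \<theta> \<longrightarrow> \<theta> \<le> R2 + \<delta> \<longrightarrow> \<theta> \<le> R + 1 \<longrightarrow>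
    c * sine (\<lambda>s. lip_approx kap R n s - \<eta>) \<theta> \<theta> \<le> sine (\<lambda>s. lip_approx kap R n s - \<eta>) \<theta> (t * \<theta>)"
proof -
  define f0 where "f0 = lip_approx kap R n"
  have T0: "0 \<le> R + 1" using R by simp
  have cf0: "continuous_on {0..R + 1} f0" unfolding f0_def by (rule lip_cont)
  have "compact (f0 ` {0..R + 1})" by (rule compact_continuous_image[OF cf0 compact_Icc])
  then obtain B where B: "\<And>s. s \<in> {0..R + 1} \<Longrightarrow> \<bar>f0 s\<bar> \<le> B"
    using compact_imp_bounded[of "f0 ` {0..R + 1}"] by (force simp: bounded_iff)
  define \<phi> where "\<phi> \<theta> = u n (t * \<theta>) - c * u n \<theta>" for \<theta>
  have tsub: "(\<lambda>\<theta>. t * \<theta>) ` {0..R + 1} \<subseteq> {0..R + 1}"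
    using t mult_left_le_one_le[of _ t] by (force intro: order_trans)
  have c\<phi>: "continuous_on {0..R + 1} \<phi>"
    unfolding \<phi>_def by (intro continuous_intros u_cont continuous_on_compose2[OF u_cont _ tsub])
  have "{R1..R2} \<subseteq> {0..R + 1}" using R12 by auto
  then obtain z where z: "z \<in> {R1..R2}" "\<And>\<theta>. \<theta> \<in> {R1..R2} \<Longrightarrow> \<phi> z \<le> \<phi> \<theta>"
    using continuous_attains_inf[OF compact_Icc _ continuous_on_subset[OF c\<phi>], of R1 R2] R12 by auto
  define \<mu> where "\<mu> = \<phi> z / 2"
  have \<mu>: "0 < \<mu>" using cu[OF z(1)] by (simp add: \<mu>_def \<phi>_def)
  have "uniformly_continuous_on {0..R + 1} \<phi>" by (rule compact_uniformly_continuous[OF c\<phi> compact_Icc])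
  then obtain \<delta>1 where \<delta>1: "\<delta>1 > 0" "\<And>\<theta> \<theta>'. \<theta> \<in> {0..R + 1} \<Longrightarrow> \<theta>' \<in> {0..R + 1} \<Longrightarrow> dist \<theta>' \<theta> < \<delta>1 \<Longrightarrow> dist (\<phi> \<theta>') (\<phi> \<theta>) < \<mu>"
    unfolding uniformly_continuous_on_def using \<mu> by metis
  define M where "M = sine_stability (B + 1) (R + 1)"
  have M0: "0 \<le> M" using R by (simp add: M_def sine_stability_def)
  define \<eta> where "\<eta> = min 1 (\<mu> / ((M + 1) * (1 + c)))"
  have Mc: "0 < (M + 1) * (1 + c)" using M0 c by (intro mult_pos_pos) auto
  have \<eta>: "0 < \<eta>" "\<eta> \<le> 1" using \<mu> Mc by (auto simp: \<eta>_def)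
  have "\<eta> * ((M + 1) * (1 + c)) \<le> \<mu>"
    using Mc by (subst pos_le_divide_eq[symmetric]) (auto simp: \<eta>_def)
  moreover have "\<eta> * M * (1 + c) \<le> \<eta> * (M + 1) * (1 + c)" using \<eta> c by (intro mult_right_mono mult_left_mono) auto
  ultimately have \<eta>M: "\<eta> * M * (1 + c) \<le> \<mu>" by (simp add: mult.assoc)
  define f where "f = (\<lambda>s. f0 s - \<eta>)"
  have cf: "continuous_on {0..R + 1} f" unfolding f_def by (intro continuous_intros cf0)
  have stab: "\<bar>sine f (R + 1) s - u n s\<bar> \<le> \<eta> * M" if "s \<in> {0..R + 1}" for s
    unfolding u_def f0_def[symmetric] M_def
  proof (rule sine_solution_stability[OF sine_is_solution[OF cf T0] sine_is_solution[OF cf0 T0] _ _ _ that])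
    fix s assume "s \<in> {0..R + 1}"
    from B[OF this] show "\<bar>f s\<bar> \<le> B + 1" "\<bar>f0 s\<bar> \<le> B + 1" "\<bar>f s - f0 s\<bar> \<le> \<eta>"
      using \<eta> by (auto simp: f_def)
  qed
  have "c * sine f \<theta> \<theta> \<le> sine f \<theta> (t * \<theta>)"
    if \<theta>: "R1 - \<delta>1 / 2 \<le> \<theta>" "0 < \<theta>" "\<theta> \<le> R2 + \<delta>1 / 2" "\<theta> \<le> R + 1" for \<theta>
  proof -
    have le: "t * \<theta> \<le> \<theta>" using t \<theta> by (intro mult_left_le_one_le) auto
    have nn: "0 \<le> t * \<theta>" using t \<theta> by simp
    have in1: "\<theta> \<in> {0..R + 1}" "t * \<theta> \<in> {0..R + 1}" "\<theta> \<in> {0..\<theta>}" "t * \<theta> \<in> {0..\<theta>}"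
      using order_trans[OF le \<theta>(4)] le nn \<theta> less_imp_le[OF \<theta>(2)] unfolding atLeastAtMost_iff by blast+
    define \<theta>' where "\<theta>' = max R1 (min R2 \<theta>)"
    have "\<theta>' \<in> {R1..R2}" "dist \<theta> \<theta>' < \<delta>1" "\<theta>' \<in> {0..R + 1}"
      using R12 \<theta> \<delta>1(1) by (auto simp: \<theta>'_def dist_real_def)
    then have "\<mu> \<le> \<phi> \<theta>" using z(2)[of \<theta>'] \<delta>1(2)[of \<theta>' \<theta>] in1 by (auto simp: \<mu>_def dist_real_def abs_if split: if_splits)
    then have "\<mu> \<le> u n (t * \<theta>) - c * u n \<theta>" by (simp add: \<phi>_def)
    moreover have "u n (t * \<theta>) \<le> sine f (R + 1) (t * \<theta>) + \<eta> * M" using stab[OF in1(2)] by linarith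
    moreover have "c * sine f (R + 1) \<theta> \<le> c * u n \<theta> + c * (\<eta> * M)"
    proof -
      have "c * sine f (R + 1) \<theta> \<le> c * (u n \<theta> + \<eta> * M)" using stab[OF in1(1)] c by (intro mult_left_mono) auto
      then show ?thesis by (simp only: distrib_left)
    qed
    moreover have "\<eta> * M + c * (\<eta> * M) \<le> \<mu>" using \<eta>M by (simp add: algebra_simps)
    ultimately have "c * sine f (R + 1) \<theta> \<le> sine f (R + 1) (t * \<theta>)" by linarith
    moreover have "sine f \<theta> \<theta> = sine f (R + 1) \<theta>" "sine f \<theta> (t * \<theta>) = sine f (R + 1) (t * \<theta>)"
      using \<theta> in1 by (auto intro!: sine_restrict[OF cf])
    ultimately show ?thesis by simp
  qed
  then show ?thesis
    using \<eta>(1) \<delta>1(1) unfolding f_def f0_def by (intro exI[of _ \<eta>] conjI exI[of _ "\<delta>1 / 2"]) auto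
qed

text \<open>The curvature along the transports is at least \<open>lip_approx kap R n - \<eta>\<close>, and the sine of the latter
  still has ratios at least \<open>c\<close>.\<close>

lemma shell_comparison:
  assumes t: "0 < t" "t < 1" and R12: "0 < R1" "R1 \<le> R2" "R2 \<le> R" and c: "0 \<le> c"
    and cu: "\<And>\<theta>. \<theta> \<in> {R1..R2} \<Longrightarrow> c * u n \<theta> < u n (t * \<theta>)"
  shows "\<exists>\<delta>>0. \<forall>a b. R1 \<le> a \<longrightarrow> a \<le> b \<longrightarrow> b \<le> R2 + \<delta> \<longrightarrow>
    t * c powr (N - 1) * measure m (annulus x a b) \<le> measure m (annulus x (t * a) (t * b))"
proof -
  obtain C where C: "\<And>r. r \<in> {0..R} \<Longrightarrow> - C \<le> kap r" by (rule kap_lower) blast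
  obtain \<eta> \<delta>1 where \<eta>: "0 < \<eta>" and \<delta>1: "0 < \<delta>1"
    and ratio: "\<And>\<theta>. R1 - \<delta>1 \<le> \<theta> \<Longrightarrow> 0 < \<theta> \<Longrightarrow> \<theta> \<le> R2 + \<delta>1 \<Longrightarrow> \<theta> \<le> R + 1 \<Longrightarrow>
      c * sine (\<lambda>s. lip_approx kap R n s - \<eta>) \<theta> \<theta> \<le> sine (\<lambda>s. lip_approx kap R n s - \<eta>) \<theta> (t * \<theta>)"
    using perturbed_sine_ratio[OF t R12 c cu] by blast
  obtain \<delta>2 where \<delta>2: "0 < \<delta>2"
    and low: "\<And>p s. 0 \<le> s \<Longrightarrow> s \<le> R + \<delta>2 \<Longrightarrow> \<bar>dist x p - s\<bar> \<le> \<delta>2 \<Longrightarrow> (N - 1) * (lip_approx kap R n s - \<eta>) \<le> k p"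
    using curvature_below_lip_approx[OF \<eta>] by blast
  define \<delta> where "\<delta> = min (min (\<delta>1 / 2) (\<delta>2 / 2)) (min (1 / 2) (R1 / 2))"
  have \<delta>: "0 < \<delta>" "2 * \<delta> \<le> \<delta>1" "2 * \<delta> \<le> \<delta>2" "2 * \<delta> \<le> 1" "\<delta> < R1"
    using \<delta>1 \<delta>2 R12 by (auto simp: \<delta>_def)
  have "t * c powr (N - 1) * measure m (annulus x a b) \<le> measure m (annulus x (t * a) (t * b))"
    if ab: "R1 \<le> a" "a \<le> b" "b \<le> R2 + \<delta>" for a b
  proof (rule brunn_minkowski_annuli[OF mms supp CD N t \<delta>(1) ab(2), where f = "\<lambda>s. lip_approx kap R n s - \<eta>" and L = "real n"])
    show "emeasure m (cball x (b + 2 * \<delta>)) < \<infinity>" by (rule ball_finite)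
    show "\<bar>lip_approx kap R n s - \<eta> - (lip_approx kap R n r - \<eta>)\<bar> \<le> real n * \<bar>s - r\<bar>" for s r
      using lip_approx_lipschitz[where n = n and s = s and s' = r, OF less_imp_le[OF R] C] by simp
    show "(N - 1) * (lip_approx kap R n s - \<eta>) \<le> k p" if "0 \<le> s" "s \<le> b + \<delta>" "\<bar>dist x p - s\<bar> \<le> \<delta>" for p s
      using that ab R12 \<delta> by (intro low) auto
    show "c * sine (\<lambda>s. lip_approx kap R n s - \<eta>) \<theta> \<theta> \<le> sine (\<lambda>s. lip_approx kap R n s - \<eta>) \<theta> (t * \<theta>)"
      if "\<theta> \<in> {a - \<delta>..b + \<delta>}" "0 < \<theta>" for \<theta>
      using that ab R12 \<delta> by (intro ratio) auto
    show "c \<le> t" if "a \<le> \<delta>" using that ab \<delta> by auto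
  qed (rule c)
  then show ?thesis using \<delta>(1) by blast
qed

text \<open>The density of the model volume. Clamping the argument to \<open>{0..R}\<close> makes it continuous and
  nonnegative on the whole line.\<close>

definition h :: "nat \<Rightarrow> real \<Rightarrow> real" where "h n s = u n (max 0 (min R s)) powr (N - 1)"
definition H :: "nat \<Rightarrow> real \<Rightarrow> real" where "H n w = integral {0..w} (h n)"

lemma h_eq: "s \<in> {0..R} \<Longrightarrow> h n s = u n s powr (N - 1)"
  by (simp add: h_def)

lemma h_cont: "continuous_on S (h n)"
  unfolding h_def
proof (rule continuous_on_powr')
  have "(\<lambda>s. max 0 (min R s)) ` S \<subseteq> {0..R + 1}" using R by auto
  then show "continuous_on S (\<lambda>s. u n (max 0 (min R s)))"
    by (intro continuous_on_compose2[OF u_cont] continuous_intros)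
  have "0 \<le> u n (max 0 (min R s))" for s using R by (intro u_nonneg) auto
  then show "\<forall>s\<in>S. 0 \<le> u n (max 0 (min R s)) \<and> (u n (max 0 (min R s)) = 0 \<longrightarrow> 0 < N - 1)" using N by auto
qed (rule continuous_on_const)

lemma h_nonneg: "0 \<le> h n s"
  by (simp add: h_def)

lemma h_pos: "s \<in> {0<..<R} \<Longrightarrow> 0 < h n s"
  using u_pos[of s n] by (simp add: h_eq)

lemma H_deriv: "s \<in> {0..T} \<Longrightarrow> (H n has_real_derivative h n s) (at s within {0..T})"
  unfolding H_def by (rule integral_has_real_derivative[OF h_cont])

lemma H_cont: "continuous_on {0..T} (H n)"
  using H_deriv by (rule DERIV_continuous_on)

lemma H_zero: "H n 0 = 0"
  by (simp add: H_def)

lemma H_mono: "0 \<le> p \<Longrightarrow> p \<le> q \<Longrightarrow> H n p \<le> H n q"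
  using nonneg_deriv_within_mono[of 0 q "H n" "h n" p q] H_deriv[of _ q n] h_nonneg by auto

lemma H_pos: "0 < p \<Longrightarrow> p \<le> R \<Longrightarrow> 0 < H n p"
proof -
  assume p: "0 < p" "p \<le> R"
  obtain \<xi> where \<xi>: "0 < \<xi>" "\<xi> < p" "H n p - H n 0 = (p - 0) * h n \<xi>"
    by (rule deriv_within_mvt[OF H_deriv, where p = 0 and q = p]) (use p in auto)
  then show "0 < H n p" using h_pos[of \<xi> n] p by (simp add: H_zero)
qed

text \<open>Differences of ball volumes are measures of half-open shells, which are exhausted by closed annuli.\<close>

lemma half_open_shell_comparison:
  assumes t: "0 < t" "t < 1" and pq: "0 < p" "p \<le> q" "q \<le> R" and c: "0 \<le> c"
    and ch: "\<And>\<theta>. \<theta> \<in> {p..q} \<Longrightarrow> c * h n \<theta> < h n (t * \<theta>)"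
  shows "t * c * (v q - v p) \<le> v (t * q) - v (t * p)"
proof (cases "p = q")
  case False
  define c' where "c' = c powr (1 / (N - 1))"
  have c': "0 \<le> c'" "c' powr (N - 1) = c" using c N by (auto simp: c'_def powr_powr)
  have tR: "t * \<theta> \<in> {0..R}" if "\<theta> \<in> {p..q}" for \<theta>
  proof -
    have "t * \<theta> \<le> \<theta>" using t that pq by (intro mult_left_le_one_le) auto
    moreover have "0 \<le> t * \<theta>" "\<theta> \<le> R" using t that pq by auto
    ultimately show ?thesis by auto
  qed
  have "c' * u n \<theta> < u n (t * \<theta>)" if \<theta>: "\<theta> \<in> {p..q}" for \<theta>
  proof (rule ccontr)
    have \<theta>R: "\<theta> \<in> {0..R}" using \<theta> pq by auto
    assume "\<not> c' * u n \<theta> < u n (t * \<theta>)"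
    then have "u n (t * \<theta>) powr (N - 1) \<le> (c' * u n \<theta>) powr (N - 1)"
      using N u_nonneg[OF tR[OF \<theta>]] by (intro powr_mono2) auto
    also have "\<dots> = c * h n \<theta>" using c' u_nonneg[OF \<theta>R] by (simp add: powr_mult h_eq[OF \<theta>R])
    finally show False using ch[OF \<theta>] by (simp add: h_eq[OF tR[OF \<theta>]])
  qed
  then obtain \<delta> where \<delta>: "\<delta> > 0" "\<And>a b. p \<le> a \<Longrightarrow> a \<le> b \<Longrightarrow> b \<le> q + \<delta> \<Longrightarrow>
    t * c' powr (N - 1) * measure m (annulus x a b) \<le> measure m (annulus x (t * a) (t * b))"
    using shell_comparison[OF t pq c'(1), of n] by blast
  define a where "a j = p + (q - p) / real (Suc j)" for j
  have a: "p < a j" "a j \<le> q" for j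
    using False pq by (auto simp: a_def field_simps mult_right_mono)
  have a_dec: "a (Suc j) \<le> a j" for j using pq by (auto simp: a_def intro!: divide_left_mono)
  have a_lim: "a \<longlonglongrightarrow> p + (q - p) * 0" unfolding a_def divide_inverse
    by (intro tendsto_intros LIMSEQ_inverse_real_of_nat)
  have est: "t * c * measure m (annulus x (a j) q) \<le> v (t * q) - v (t * p)" for j
  proof -
    have "t * c * measure m (annulus x (a j) q) \<le> measure m (annulus x (t * a j) (t * q))"
      using \<delta>(2)[of "a j" q] a[of j] \<delta>(1) by (simp add: c'(2))
    also have "\<dots> \<le> measure m (cball x (t * q) - cball x (t * p))"
    proof (rule measure_mono_fmeasurable)
      have "t * p < t * a j" using a[of j] t by simp
      then show "annulus x (t * a j) (t * q) \<subseteq> cball x (t * q) - cball x (t * p)"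
        by (auto simp: annulus_def)
      show "cball x (t * q) - cball x (t * p) \<in> fmeasurable m" by (rule subset_ball_fmeasurable) auto
    qed (simp add: sm)
    also have "\<dots> = v (t * q) - v (t * p)" using t pq by (intro v_diff) auto
    finally show ?thesis .
  qed
  have "(\<lambda>j. measure m (annulus x (a j) q)) \<longlonglongrightarrow> measure m (\<Union>j. annulus x (a j) q)"
  proof (rule Lim_measure_incseq)
    show "incseq (\<lambda>j. annulus x (a j) q)"
      using a_dec by (intro incseq_SucI) (auto simp: annulus_def intro: order_trans)
    have "(\<Union>j. annulus x (a j) q) \<in> fmeasurable m"
      by (rule subset_ball_fmeasurable[of _ q]) (auto simp: annulus_def annulus_borel[unfolded annulus_def])
    then show "emeasure m (\<Union>j. annulus x (a j) q) \<noteq> \<infinity>" using fmeasurableD2 by auto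
  qed (auto simp: sm)
  also have "(\<Union>j. annulus x (a j) q) = cball x q - cball x p"
  proof (intro equalityI subsetI)
    fix y assume "y \<in> (\<Union>j. annulus x (a j) q)"
    then obtain j where "a j \<le> dist x y" "dist x y \<le> q" by (auto simp: annulus_def)
    then show "y \<in> cball x q - cball x p" using a(1)[of j] by auto
  next
    fix y assume y: "y \<in> cball x q - cball x p"
    then have "p + (q - p) * 0 < dist x y" by simp
    then have "\<forall>\<^sub>F j in sequentially. a j < dist x y" by (rule order_tendstoD(2)[OF a_lim])
    then obtain j where "a j < dist x y" by (auto simp: eventually_sequentially)
    then show "y \<in> (\<Union>j. annulus x (a j) q)" using y by (auto simp: annulus_def intro!: exI[of _ j] less_imp_le)
  qed
  also have "measure m (cball x q - cball x p) = v q - v p" using pq by (intro v_diff)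
  finally have "(\<lambda>j. t * c * measure m (annulus x (a j) q)) \<longlonglongrightarrow> t * c * (v q - v p)" by (intro tendsto_intros)
  then show ?thesis using est by (intro LIMSEQ_le_const2) auto
qed simp

lemma volume_slope_comparison:
  assumes "0 < a" "a < r" "r < d" "d < R"
  shows "(v d - v r) * (H n r - H n a) \<le> (v r - v a) * (H n d - H n r)"
proof (rule comparison_multiplicative[OF assms(1-3), where h = "h n"])
  show "(H n has_real_derivative h n s) (at s within {a..d})" if "s \<in> {a..d}" for s
    using that assms by (intro DERIV_subset[OF H_deriv[of s d]]) auto
  show "0 < h n s" if "s \<in> {a..d}" for s using that assms by (intro h_pos) auto
  show "t * c * (v q - v p) \<le> v (t * q) - v (t * p)"
    if "0 \<le> c" "0 < t" "t < 1" "a \<le> t * p" "p \<le> q" "q \<le> d"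
      "\<And>\<theta>. \<theta> \<in> {p..q} \<Longrightarrow> c * h n \<theta> < h n (t * \<theta>)" for c t p q
  proof (rule half_open_shell_comparison[where n = n])
    show "0 < p" using that(2,4) assms(1) by (metis less_le_trans zero_less_mult_pos)
  qed (use that assms in auto)
qed (auto intro: v_mono h_cont)

text \<open>The inequality for the slopes of \<open>v\<close> with respect to \<open>H n\<close>, with \<open>a \<rightarrow> 0\<close>.\<close>

lemma volume_comparison_open:
  assumes "0 < r" "r < d" "d < R"
  shows "v d * H n r \<le> v r * H n d"
proof -
  define a where "a j = r * inverse (real (Suc (Suc j)))" for j
  have a: "0 < a j" "a j < r" for j
  proof -
    have "inverse (real (Suc (Suc j))) < 1" by (simp add: inverse_less_1_iff)
    then show "0 < a j" "a j < r" using assms by (auto simp: a_def)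
  qed
  have "a \<longlonglongrightarrow> r * 0" unfolding a_def
    by (intro tendsto_mult tendsto_const LIMSEQ_Suc[OF LIMSEQ_inverse_real_of_nat])
  then have "(\<lambda>j. H n (a j)) \<longlonglongrightarrow> H n 0"
    using a assms
    by (intro continuous_on_tendsto_compose[OF H_cont[of r]] always_eventually allI) (auto intro: less_imp_le)
  then have "(\<lambda>j. (v d - v r) * (H n r - H n (a j))) \<longlonglongrightarrow> (v d - v r) * (H n r - H n 0)"
    by (intro tendsto_intros)
  then have "(v d - v r) * (H n r - H n 0) \<le> v r * (H n d - H n r)"
  proof (rule LIMSEQ_le_const2)
    have "(v d - v r) * (H n r - H n (a j)) \<le> v r * (H n d - H n r)" for j
    proof -
      have "(v d - v r) * (H n r - H n (a j)) \<le> (v r - v (a j)) * (H n d - H n r)"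
        by (rule volume_slope_comparison) (use a assms in auto)
      also have "\<dots> \<le> v r * (H n d - H n r)"
        using v_nonneg[of "a j"] H_mono[of r d n] assms by (intro mult_right_mono) auto
      finally show ?thesis .
    qed
    then show "\<exists>N. \<forall>j\<ge>N. (v d - v r) * (H n r - H n (a j)) \<le> v r * (H n d - H n r)" by blast
  qed
  then show ?thesis by (simp add: H_zero algebra_simps)
qed


text \<open>Compare with balls of radius slightly smaller than \<open>r\<close>, so that the sphere of radius \<open>r\<close> is included.\<close>

lemma annulus_volume_bound:
  assumes "0 < r" "r \<le> d" "d < R"
  shows "measure m (annulus x r d) * H n r \<le> v r * (H n d - H n r)"
proof -
  define a where "a j = r - r * inverse (real (Suc (Suc j)))" for j
  have a: "0 < a j" "a j < r" for j
  proof -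
    have "inverse (real (Suc (Suc j))) < 1" by (simp add: inverse_less_1_iff)
    then have "r * inverse (real (Suc (Suc j))) < r" using assms by simp
    moreover have "0 < r * inverse (real (Suc (Suc j)))" using assms by simp
    ultimately show "0 < a j" "a j < r" by (auto simp: a_def)
  qed
  have "a \<longlonglongrightarrow> r - r * 0" unfolding a_def
    by (intro tendsto_intros LIMSEQ_Suc[OF LIMSEQ_inverse_real_of_nat])
  then have lim: "(\<lambda>j. H n (a j)) \<longlonglongrightarrow> H n r"
    using a assms
    by (intro continuous_on_tendsto_compose[OF H_cont[of r]] always_eventually allI) (auto intro: less_imp_le)
  have est: "measure m (annulus x r d) * H n (a j) \<le> v r * (H n d - H n (a j))" for j
  proof -
    have "measure m (annulus x r d) \<le> measure m (cball x d - cball x (a j))"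
    proof (rule measure_mono_fmeasurable)
      show "annulus x r d \<subseteq> cball x d - cball x (a j)" using a(2)[of j] by (auto simp: annulus_def)
      show "cball x d - cball x (a j) \<in> fmeasurable m" by (rule subset_ball_fmeasurable) auto
    qed (simp add: sm)
    also have "\<dots> = v d - v (a j)" using a(2)[of j] assms by (intro v_diff) auto
    finally have "measure m (annulus x r d) * H n (a j) \<le> (v d - v (a j)) * H n (a j)"
      using H_pos[of "a j" n] a[of j] assms by (intro mult_right_mono) auto
    also have "\<dots> \<le> v (a j) * (H n d - H n (a j))"
      using volume_comparison_open[of "a j" d n] a[of j] assms by (simp add: algebra_simps)
    also have "\<dots> \<le> v r * (H n d - H n (a j))"
      using v_mono[of "a j" r] H_mono[of "a j" d n] a[of j] assms by (intro mult_right_mono) auto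
    finally show ?thesis .
  qed
  show ?thesis
    by (rule LIMSEQ_le[where X = "\<lambda>j. measure m (annulus x r d) * H n (a j)" and Y = "\<lambda>j. v r * (H n d - H n (a j))"])
      (auto intro!: tendsto_intros lim est)
qed

lemma sphere_null:
  assumes "0 < r" "r < R"
  shows "measure m (annulus x r r) = 0"
proof -
  have "measure m (annulus x r r) * H 0 r \<le> 0" using annulus_volume_bound[of r r 0] assms by simp
  moreover have "0 < H 0 r" using assms by (intro H_pos) auto
  ultimately have "measure m (annulus x r r) \<le> 0" by (simp add: mult_le_0_iff)
  then show ?thesis by (simp add: antisym)
qed

lemma sphere_volume_annulus:
  "sphere_volume m x r = Limsup (at_right 0) (\<lambda>\<delta>. ennreal (measure m (annulus x r (r + \<delta>)) / \<delta>))"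
  unfolding sphere_volume_def
proof (rule Limsup_eq)
  show "\<forall>\<^sub>F \<delta> in at_right 0. emeasure m (cball x (r + \<delta>) - ball x r) / ennreal \<delta> = ennreal (measure m (annulus x r (r + \<delta>)) / \<delta>)"
    using eventually_at_right_less[of "0::real"]
  proof eventually_elim
    case (elim \<delta>)
    have "cball x (r + \<delta>) - ball x r = annulus x r (r + \<delta>)" by (auto simp: annulus_def)
    then show ?case using elim by (simp add: annulus_emeasure divide_ennreal)
  qed
qed

text \<open>By \<open>annulus_volume_bound\<close> the annuli have measure at most proportional to their thickness.\<close>

lemma sphere_volume_finite:
  assumes r: "0 < r" "r < R"
  shows "sphere_volume m x r < \<infinity>"
proof -
  obtain z where z: "\<And>s. s \<in> {0..R} \<Longrightarrow> h 0 s \<le> h 0 z"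
    using continuous_attains_sup[OF compact_Icc _ h_cont, of 0 R 0] R by (metis atLeastAtMost_iff empty_iff less_imp_le order_refl)
  have Hr: "0 < H 0 r" using r by (intro H_pos) auto
  have "\<forall>\<^sub>F \<delta> in at_right 0. \<delta> \<in> {0<..<R - r}" using r by (intro eventually_at_right_real) simp
  then have "\<forall>\<^sub>F \<delta> in at_right 0. ennreal (measure m (annulus x r (r + \<delta>)) / \<delta>) \<le> ennreal (v r * h 0 z / H 0 r)"
  proof eventually_elim
    case (elim \<delta>)
    then have \<delta>: "0 < \<delta>" "r + \<delta> < R" by auto
    obtain \<xi> where \<xi>: "r < \<xi>" "\<xi> < r + \<delta>" "H 0 (r + \<delta>) - H 0 r = (r + \<delta> - r) * h 0 \<xi>"
      by (rule deriv_within_mvt[OF H_deriv, where p = r and q = "r + \<delta>"]) (use \<delta> r in auto)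
    have "measure m (annulus x r (r + \<delta>)) * H 0 r \<le> v r * (H 0 (r + \<delta>) - H 0 r)"
      using \<delta> r by (intro annulus_volume_bound) auto
    also have "\<dots> \<le> v r * (\<delta> * h 0 z)"
      using \<xi> \<delta> r v_nonneg[of r] by (auto intro!: mult_left_mono z)
    finally have "measure m (annulus x r (r + \<delta>)) / \<delta> \<le> v r * h 0 z / H 0 r"
      using \<delta> Hr by (simp add: field_simps)
    then show ?case by (rule ennreal_leI)
  qed
  then have "sphere_volume m x r \<le> ennreal (v r * h 0 z / H 0 r)"
    unfolding sphere_volume_annulus by (rule Limsup_bounded)
  then show ?thesis by (rule order_le_less_trans) simp
qed

text \<open>The sphere of intermediate radius is nonempty, and the support of the measure is the whole space.\<close>

lemma v_strict_mono:
  assumes "0 < p" "p < q" "q < R"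
  shows "v p < v q"
proof -
  have "(p + q) / 2 \<in> radii x" using radii_subset assms by auto
  then have "sphere x ((p + q) / 2) \<noteq> {}" by (simp add: radii_def)
  then obtain y where y: "dist x y = (p + q) / 2" by (metis all_not_in_conv mem_sphere)
  have "open (ball x q - cball x p)" by auto
  moreover have "y \<in> ball x q - cball x p" using y assms by auto
  moreover have "y \<in> msupport m" using supp by simp
  ultimately have "0 < emeasure m (ball x q - cball x p)" by (auto simp: msupport_def)
  also have "\<dots> \<le> emeasure m (cball x q - cball x p)" using sm by (intro emeasure_mono) auto
  also have "\<dots> = ennreal (measure m (cball x q - cball x p))"
    using subset_ball_fmeasurable[of "cball x q - cball x p" q] by (simp add: emeasure_eq_measure2)
  finally show ?thesis using assms by (simp add: v_diff)
qed

text \<open>Compare a thin shell at \<open>r\<close> with the shell of radii \<open>r1\<close> and \<open>d\<close> further out, which has positive measure.\<close>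

lemma sphere_volume_positive:
  assumes r: "0 < r" "r < R"
  shows "0 < sphere_volume m x r"
proof -
  define r1 where "r1 = r + (R - r) / 3"
  define d where "d = r + 2 * (R - r) / 3"
  have rd: "r < r1" "r1 < d" "d < R" using r by (auto simp: r1_def d_def field_simps)
  have "\<exists>z\<in>{r..d}. \<forall>s\<in>{r..d}. h 0 z \<le> h 0 s"
    using rd by (intro continuous_attains_inf h_cont) auto
  then obtain z where z: "z \<in> {r..d}" "\<And>s. s \<in> {r..d} \<Longrightarrow> h 0 z \<le> h 0 s" by blast
  have hz: "0 < h 0 z" using z rd r by (intro h_pos) auto
  have Hd: "0 < H 0 d" using rd r by (intro H_pos) auto
  define K where "K = (v d - v r1) * h 0 z / H 0 d"
  have K: "0 < K" using v_strict_mono[of r1 d] rd r hz Hd by (auto simp: K_def)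
  have "\<forall>\<^sub>F \<delta> in at_right 0. ennreal K \<le> ennreal (measure m (annulus x r (r + \<delta>)) / \<delta>)"
    using eventually_at_right_real[OF diff_gt_0_iff_gt[THEN iffD2, OF rd(1)]]
  proof eventually_elim
    case (elim \<delta>)
    then have \<delta>: "0 < \<delta>" "r + \<delta> < r1" by auto
    obtain \<xi> where \<xi>: "r < \<xi>" "\<xi> < r + \<delta>" "H 0 (r + \<delta>) - H 0 r = (r + \<delta> - r) * h 0 \<xi>"
      by (rule deriv_within_mvt[OF H_deriv, where p = r and q = "r + \<delta>"]) (use \<delta> r in auto)
    have "(v d - v r1) * (\<delta> * h 0 z) \<le> (v d - v (r + \<delta>)) * (H 0 (r + \<delta>) - H 0 r)"
    proof (rule mult_mono)
      show "v d - v r1 \<le> v d - v (r + \<delta>)" using v_mono[of "r + \<delta>" r1] \<delta> by simp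
      show "\<delta> * h 0 z \<le> H 0 (r + \<delta>) - H 0 r" using \<xi> \<delta> rd by (auto intro!: mult_left_mono z)
      show "0 \<le> v d - v (r + \<delta>)" using v_mono[of "r + \<delta>" d] \<delta> rd by simp
    qed (use \<delta> hz in auto)
    also have "\<dots> \<le> (v (r + \<delta>) - v r) * (H 0 d - H 0 (r + \<delta>))"
      using \<delta> rd r by (intro volume_slope_comparison) auto
    also have "\<dots> \<le> measure m (annulus x r (r + \<delta>)) * H 0 d"
    proof (rule mult_mono)
      have "v (r + \<delta>) - v r = measure m (cball x (r + \<delta>) - cball x r)" using \<delta> by (intro v_diff[symmetric]) auto
      also have "\<dots> \<le> measure m (annulus x r (r + \<delta>))"
        using annulus_fmeasurable sm by (intro measure_mono_fmeasurable) (auto simp: annulus_def)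
      finally show "v (r + \<delta>) - v r \<le> measure m (annulus x r (r + \<delta>))" .
      show "H 0 d - H 0 (r + \<delta>) \<le> H 0 d" using H_mono[of 0 "r + \<delta>" 0] \<delta> r by (simp add: H_zero)
      show "0 \<le> H 0 d - H 0 (r + \<delta>)" using H_mono[of "r + \<delta>" d 0] \<delta> r rd by simp
    qed auto
    finally have "K \<le> measure m (annulus x r (r + \<delta>)) / \<delta>"
      using \<delta> Hd by (simp add: K_def field_simps)
    then show ?case by (rule ennreal_leI)
  qed
  then have "ennreal K \<le> sphere_volume m x r"
    unfolding sphere_volume_annulus by (intro le_Limsup) auto
  moreover have "0 < ennreal K" using K by simp
  ultimately show ?thesis by (rule less_le_trans[rotated])
qed

lemma eventually_sine_ratio:
  assumes "r \<in> {0..R}" "c * g R < g r"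
  shows "\<exists>n. c * u n R < u n r"
proof -
  have "(\<lambda>n. u n r - c * u n R) \<longlonglongrightarrow> g r - c * g R"
    using assms R by (intro tendsto_intros u_lim) auto
  then have "\<forall>\<^sub>F n in sequentially. 0 < u n r - c * u n R"
    using assms by (intro order_tendstoD(1)) auto
  then show ?thesis by (auto simp: eventually_sequentially)
qed

text \<open>For a ratio \<open>c\<close> below that of the limit \<open>g\<close>, some \<open>u n\<close> satisfies the same strict inequality. If \<open>g R = 0\<close>,
  every \<open>c\<close> is admitted.\<close>

lemma sphere_shell_comparison:
  assumes r: "0 < r" "r < R" and c: "0 \<le> c" "c * g R < g r"
  shows "\<exists>\<delta>>0. \<forall>\<epsilon>. 0 \<le> \<epsilon> \<longrightarrow> \<epsilon> \<le> \<delta> \<longrightarrow>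
    r / R * c powr (N - 1) * measure m (annulus x R (R + \<epsilon>)) \<le> measure m (annulus x r (r + r / R * \<epsilon>))"
proof -
  define t where "t = r / R"
  have t: "0 < t" "t < 1" "t * R = r" using r R by (auto simp: t_def)
  obtain n where n: "c * u n R < u n r" using eventually_sine_ratio[OF _ c(2)] r by auto
  have "\<exists>\<delta>>0. \<forall>a b. R \<le> a \<longrightarrow> a \<le> b \<longrightarrow> b \<le> R + \<delta> \<longrightarrow>
    t * c powr (N - 1) * measure m (annulus x a b) \<le> measure m (annulus x (t * a) (t * b))"
    by (rule shell_comparison[OF t(1,2) R order_refl order_refl c(1), of n]) (use n t in auto)
  then obtain \<delta> where \<delta>: "\<delta> > 0" "\<And>a b. R \<le> a \<Longrightarrow> a \<le> b \<Longrightarrow> b \<le> R + \<delta> \<Longrightarrow>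
    t * c powr (N - 1) * measure m (annulus x a b) \<le> measure m (annulus x (t * a) (t * b))"
    by blast
  have "t * c powr (N - 1) * measure m (annulus x R (R + \<epsilon>)) \<le> measure m (annulus x r (r + t * \<epsilon>))"
    if "0 \<le> \<epsilon>" "\<epsilon> \<le> \<delta>" for \<epsilon>
    using \<delta>(2)[of R "R + \<epsilon>"] that t by (simp add: distrib_left)
  then show ?thesis using \<delta>(1) unfolding t_def by blast
qed

text \<open>The thickness \<open>\<epsilon>\<close> at \<open>R\<close> corresponds to \<open>t * \<epsilon>\<close> at \<open>r\<close>; this cancels the factor \<open>t\<close> of the
  Brunn-Minkowski inequality.\<close>

lemma sphere_volume_comparison:
  assumes r: "0 < r" "r < R" and c: "0 < c" "c * g R < g r" and y: "sphere_volume m x r < ennreal y"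
  shows "sphere_volume m x R \<le> ennreal (y / c powr (N - 1))"
proof -
  obtain \<delta> where \<delta>: "\<delta> > 0" "\<And>\<epsilon>. 0 \<le> \<epsilon> \<Longrightarrow> \<epsilon> \<le> \<delta> \<Longrightarrow>
    r / R * c powr (N - 1) * measure m (annulus x R (R + \<epsilon>)) \<le> measure m (annulus x r (r + r / R * \<epsilon>))"
    using sphere_shell_comparison[OF r _ c(2)] c(1) by (meson less_imp_le)
  have "\<forall>\<^sub>F \<epsilon> in at_right 0. ennreal (measure m (annulus x r (r + \<epsilon>)) / \<epsilon>) < ennreal y"
    using y unfolding sphere_volume_annulus by (rule Limsup_lessD)
  then obtain b where b: "b > 0" "\<And>\<epsilon>. 0 < \<epsilon> \<Longrightarrow> \<epsilon> < b \<Longrightarrow> ennreal (measure m (annulus x r (r + \<epsilon>)) / \<epsilon>) < ennreal y"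
    by (auto simp: eventually_at_right_field)
  define t where "t = r / R"
  have t: "0 < t" "t < 1" using r R by (auto simp: t_def)
  have "\<forall>\<^sub>F \<epsilon> in at_right 0. \<epsilon> \<in> {0<..<min b \<delta>}" using b(1) \<delta>(1) by (intro eventually_at_right_real) simp
  then have "\<forall>\<^sub>F \<epsilon> in at_right 0. ennreal (measure m (annulus x R (R + \<epsilon>)) / \<epsilon>) \<le> ennreal (y / c powr (N - 1))"
  proof eventually_elim
    case (elim \<epsilon>)
    then have \<epsilon>: "0 < \<epsilon>" "\<epsilon> < b" "\<epsilon> \<le> \<delta>" by auto
    have "t * \<epsilon> \<le> \<epsilon>" using t \<epsilon> by (intro mult_left_le_one_le) auto
    then have "ennreal (measure m (annulus x r (r + t * \<epsilon>)) / (t * \<epsilon>)) < ennreal y" using t \<epsilon> by (intro b order_le_less_trans[OF \<open>t * \<epsilon> \<le> \<epsilon>\<close>]) auto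
    then have "measure m (annulus x r (r + t * \<epsilon>)) / (t * \<epsilon>) < y"
      by (simp add: ennreal_less_iff t \<epsilon> less_imp_le)
    then have "measure m (annulus x r (r + t * \<epsilon>)) \<le> y * (t * \<epsilon>)" using t \<epsilon> by (simp add: pos_divide_less_eq less_imp_le)
    moreover have "t * c powr (N - 1) * measure m (annulus x R (R + \<epsilon>)) \<le> measure m (annulus x r (r + t * \<epsilon>))"
      using \<delta>(2)[of \<epsilon>] \<epsilon> by (simp add: t_def)
    ultimately have "t * (c powr (N - 1) * measure m (annulus x R (R + \<epsilon>))) \<le> t * (y * \<epsilon>)" by (simp add: mult_ac)
    then have "c powr (N - 1) * measure m (annulus x R (R + \<epsilon>)) \<le> y * \<epsilon>" using t by simp
    then show ?case using \<epsilon> c by (intro ennreal_leI) (simp add: field_simps)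
  qed
  then show ?thesis unfolding sphere_volume_annulus by (rule Limsup_bounded)
qed

text \<open>If the sphere of radius \<open>R\<close> has volume \<open>0\<close>, the right hand side is \<open>\<infinity>\<close> because spheres of smaller radius have
  positive volume. Otherwise the admitted ratios \<open>c\<close> are bounded, which excludes \<open>g R = 0\<close>, and the
  supremum of these \<open>c\<close> is \<open>g r / g R\<close>.\<close>

lemma sphere_volume_ratio:
  assumes r: "0 < r" "r < R"
  shows "ennreal (g r powr (N - 1)) / ennreal (g R powr (N - 1)) \<le> sphere_volume m x r / sphere_volume m x R"
proof -
  have gr: "0 < g r" using r by (intro g_pos) auto
  have gR: "0 \<le> g R" using R by (intro g_nonneg) auto
  obtain s where s: "sphere_volume m x r = ennreal s" "0 < s"
    using sphere_volume_finite[OF r] sphere_volume_positive[OF r]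
    by (cases "sphere_volume m x r" rule: ennreal_cases) auto
  have cmp: "sphere_volume m x R \<le> ennreal ((s + e) / c powr (N - 1))" if "0 < c" "c * g R < g r" "0 < e" for c e
    using that s by (intro sphere_volume_comparison[OF r]) (auto intro: ennreal_lessI)
  obtain c0 where c0: "0 < c0" "c0 * g R < g r"
  proof
    show "0 < g r / (2 * (g R + 1))" using gr gR by simp
    have "g r * g R < g r * (2 * (g R + 1))" using gr gR by (intro mult_strict_left_mono) auto
    then show "g r / (2 * (g R + 1)) * g R < g r" using gR by (simp add: pos_divide_less_eq)
  qed
  have "sphere_volume m x R \<noteq> top" using cmp[OF c0, of 1] by (auto simp: top_unique)
  then obtain S where S: "sphere_volume m x R = ennreal S" "0 \<le> S" by (cases "sphere_volume m x R" rule: ennreal_cases) auto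
  show ?thesis
  proof (cases "S = 0")
    case True
    then show ?thesis using S s by (simp add: ennreal_divide_zero)
  next
    case False
    then have S0: "0 < S" using S by simp
    have cS: "c powr (N - 1) * S \<le> s" if c: "0 < c" "c * g R < g r" for c
    proof (rule field_le_epsilon)
      fix e :: real assume e: "0 < e"
      have "S \<le> (s + e) / c powr (N - 1)"
        using cmp[OF c e] S s e by (simp add: ennreal_le_iff2)
          (metis add_pos_pos divide_pos_pos ennreal_le_iff less_imp_le powr_gt_zero S0 c(1) less_irrefl not_le)
      then show "c powr (N - 1) * S \<le> s + e" using c by (simp add: pos_le_divide_eq mult.commute)
    qed
    define c1 where "c1 = (s / S) powr (1 / (N - 1))"
    have c1: "0 < c1" "c1 powr (N - 1) = s / S" using s S0 N by (auto simp: c1_def powr_powr)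
    have le: "c \<le> c1" if "0 < c" "c * g R < g r" for c
    proof (rule ccontr)
      assume "\<not> c \<le> c1"
      then have "c1 powr (N - 1) < c powr (N - 1)" using c1 N by (intro powr_less_mono2) auto
      then show False using cS[OF that] S0 by (simp add: c1 field_simps)
    qed
    have gR0: "0 < g R"
    proof (rule ccontr)
      assume "\<not> 0 < g R"
      then have "g R = 0" using gR by simp
      then show False using le[of "c1 + 1"] c1 gr by simp
    qed
    have "g r / g R \<le> c1"
    proof (rule ccontr)
      assume "\<not> g r / g R \<le> c1"
      then have lt: "c1 < g r / g R" by simp
      then obtain c2 where "c1 < c2" "c2 < g r / g R" using dense by blast
      then show False using le[of c2] c1 gR0 by (simp add: pos_less_divide_eq)
    qed
    then have "(g r / g R) powr (N - 1) \<le> s / S"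
      unfolding c1(2)[symmetric] using gr gR0 N by (intro powr_mono2) auto
    then have "g r powr (N - 1) / g R powr (N - 1) \<le> s / S" using gr gR0 by (simp add: powr_divide)
    then show ?thesis using S S0 s gR0 by (simp add: divide_ennreal ennreal_leI)
  qed
qed

text \<open>Pass to the limit \<open>d \<rightarrow> R\<close>. The volumes converge because the sphere of radius \<open>R\<close> has measure \<open>0\<close>: by
  \<open>sphere_shell_comparison\<close> with thickness \<open>0\<close> it is controlled by the sphere of radius \<open>r\<close>.\<close>

lemma volume_comparison:
  assumes r: "0 < r" "r < R"
  shows "v R * H n r \<le> v r * H n R"
proof -
  have "measure m (annulus x R R) = 0"
  proof -
    have gR: "0 \<le> g R" using R by (intro g_nonneg) auto
    have gr: "0 < g r" using r by (intro g_pos) auto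
    define c where "c = g r / (2 * (g R + 1))"
    have c: "0 < c" using gr gR by (simp add: c_def)
    have "g r * g R < g r * (2 * (g R + 1))" using gr gR by (intro mult_strict_left_mono) auto
    then have "c * g R < g r" using gR by (simp add: c_def pos_divide_less_eq)
    then obtain \<delta> where \<delta>: "\<delta> > 0" "\<And>\<epsilon>. 0 \<le> \<epsilon> \<Longrightarrow> \<epsilon> \<le> \<delta> \<Longrightarrow>
        r / R * c powr (N - 1) * measure m (annulus x R (R + \<epsilon>)) \<le> measure m (annulus x r (r + r / R * \<epsilon>))"
      using sphere_shell_comparison[OF r less_imp_le[OF c]] by blast
    have "r / R * c powr (N - 1) * measure m (annulus x R (R + 0)) \<le> measure m (annulus x r (r + r / R * 0))"
      using \<delta>(1) by (intro \<delta>(2)) auto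
    then have "r / R * c powr (N - 1) * measure m (annulus x R R) \<le> 0" using sphere_null[OF r] by simp
    moreover have "0 < r / R * c powr (N - 1)" using r R c by simp
    ultimately have "measure m (annulus x R R) \<le> 0" by (metis mult_pos_pos not_le)
    then show ?thesis by (simp add: antisym)
  qed
  define d where "d j = R - (R - r) * inverse (real (Suc (Suc j)))" for j
  have d: "r < d j" "d j < R" for j
  proof -
    have "inverse (real (Suc (Suc j))) < 1" by (simp add: inverse_less_1_iff)
    then have "(R - r) * inverse (real (Suc (Suc j))) < R - r" using r by simp
    moreover have "0 < (R - r) * inverse (real (Suc (Suc j)))" using r by simp
    ultimately show "r < d j" "d j < R" by (auto simp: d_def)
  qed
  have d_mono: "d j \<le> d (Suc j)" for j
    unfolding d_def using r by (intro diff_left_mono mult_left_mono le_imp_inverse_le) auto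
  have d_lim: "d \<longlonglongrightarrow> R - (R - r) * 0" unfolding d_def
    by (intro tendsto_intros LIMSEQ_Suc[OF LIMSEQ_inverse_real_of_nat])
  then have "(\<lambda>j. H n (d j)) \<longlonglongrightarrow> H n R"
    using d r R
    by (intro continuous_on_tendsto_compose[OF H_cont[of R]] always_eventually allI)
      (auto intro: less_imp_le less_trans)
  moreover have "(\<lambda>j. v (d j)) \<longlonglongrightarrow> v R"
  proof -
    have "(\<lambda>j. measure m (cball x (d j))) \<longlonglongrightarrow> measure m (\<Union>j. cball x (d j))"
    proof (rule Lim_measure_incseq)
      show "incseq (\<lambda>j. cball x (d j))" by (intro incseq_SucI subset_cball d_mono)
      have "(\<Union>j. cball x (d j)) \<in> fmeasurable m"
      proof (rule subset_ball_fmeasurable[of _ R])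
        show "(\<Union>j. cball x (d j)) \<subseteq> cball x R" by (intro UN_least subset_cball less_imp_le d(2))
      qed auto
      then show "emeasure m (\<Union>j. cball x (d j)) \<noteq> \<infinity>" using fmeasurableD2 by auto
    qed (auto simp: sm)
    also have "(\<Union>j. cball x (d j)) = cball x R - annulus x R R"
    proof (intro equalityI subsetI)
      fix y assume "y \<in> (\<Union>j. cball x (d j))"
      then obtain j where "dist x y \<le> d j" by auto
      then show "y \<in> cball x R - annulus x R R" using d(2)[of j] by (auto simp: annulus_def)
    next
      fix y assume "y \<in> cball x R - annulus x R R"
      then have "dist x y < R - (R - r) * 0" by (auto simp: annulus_def)
      then have "\<forall>\<^sub>F j in sequentially. dist x y < d j" by (rule order_tendstoD(1)[OF d_lim])
      then obtain j where "dist x y < d j" by (auto simp: eventually_sequentially)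
      then show "y \<in> (\<Union>j. cball x (d j))" by (auto intro!: exI[of _ j] less_imp_le)
    qed
    also have "measure m (cball x R - annulus x R R) = v R - measure m (annulus x R R)"
      unfolding v_def using subset_ball_fmeasurable[of "cball x R" R] sm
      by (intro measure_Diff) (auto simp: annulus_def fmeasurable_def annulus_borel[unfolded annulus_def])
    finally show ?thesis by (simp add: v_def \<open>measure m (annulus x R R) = 0\<close>)
  qed
  ultimately have lims: "(\<lambda>j. v (d j) * H n r) \<longlonglongrightarrow> v R * H n r" "(\<lambda>j. v r * H n (d j)) \<longlonglongrightarrow> v r * H n R"
    by (auto intro!: tendsto_intros)
  have "v (d j) * H n r \<le> v r * H n (d j)" for j
    by (rule volume_comparison_open[OF r(1) d])
  then show ?thesis by (intro LIMSEQ_le[OF lims]) auto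
qed

text \<open>Dominated convergence, as \<open>h n \<le> h 0\<close>.\<close>

lemma H_limit:
  assumes w: "0 < w" "w \<le> R"
  shows "(\<lambda>n. ennreal (H n w)) \<longlonglongrightarrow> (\<integral>\<^sup>+ t\<in>{0..w}. ennreal (g t powr (N - 1)) \<partial>lborel)"
proof -
  have hb: "h n \<in> borel_measurable borel" for n using h_cont by (rule borel_measurable_continuous_onI)
  have eq: "(\<integral>\<^sup>+ t\<in>{0..w}. ennreal (h n t) \<partial>lborel) = ennreal (H n w)" for n
  proof (rule nn_integral_has_integral_lebesgue'[OF h_nonneg])
    show "(h n has_integral H n w) {0..w}"
      unfolding H_def by (intro integrable_integral integrable_continuous_real h_cont)
  qed
  have lim: "(\<lambda>n. h n t) \<longlonglongrightarrow> g t powr (N - 1)" if "t \<in> {0..w}" for t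
  proof -
    have t: "t \<in> {0..R}" using that w by auto
    show ?thesis unfolding h_eq[OF t]
      using N u_nonneg[OF t] by (intro tendsto_powr' u_lim[OF t] tendsto_const) auto
  qed
  have "(\<lambda>n. \<integral>\<^sup>+ t. ennreal (h n t) * indicator {0..w} t \<partial>lborel) \<longlonglongrightarrow> (\<integral>\<^sup>+ t. ennreal (g t powr (N - 1)) * indicator {0..w} t \<partial>lborel)"
  proof (rule nn_integral_dominated_convergence[where w = "\<lambda>t. ennreal (h 0 t) * indicator {0..w} t"])
    show "(\<lambda>t. ennreal (h n t) * indicator {0..w} t) \<in> borel_measurable lborel" for n using hb by simp
    have "(\<lambda>t. g t powr (N - 1) * indicator {0..w} t) \<in> borel_measurable borel"
    proof (rule borel_measurable_LIMSEQ_real)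
      show "(\<lambda>n. h n t * indicator {0..w} t) \<longlonglongrightarrow> g t powr (N - 1) * indicator {0..w} t" for t
        using lim[of t] by (cases "t \<in> {0..w}") auto
      show "(\<lambda>t. h n t * indicator {0..w} t) \<in> borel_measurable borel" for n using hb by simp
    qed
    then have "(\<lambda>t. ennreal (g t powr (N - 1) * indicator {0..w} t)) \<in> borel_measurable borel" by measurable
    moreover have "(\<lambda>t. ennreal (g t powr (N - 1) * indicator {0..w} t)) = (\<lambda>t. ennreal (g t powr (N - 1)) * indicator {0..w} t)"
      by (auto split: split_indicator)
    ultimately show "(\<lambda>t. ennreal (g t powr (N - 1)) * indicator {0..w} t) \<in> borel_measurable lborel" by simp
    show "AE t in lborel. ennreal (h n t) * indicator {0..w} t \<le> ennreal (h 0 t) * indicator {0..w} t" for n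
    proof (rule AE_I2)
      fix t
      show "ennreal (h n t) * indicator {0..w} t \<le> ennreal (h 0 t) * indicator {0..w} t"
      proof (cases "t \<in> {0..w}")
        case True
        then have t: "t \<in> {0..R}" using w by auto
        show ?thesis unfolding h_eq[OF t]
          using N u_nonneg[OF t] u_le[OF t] by (intro mult_right_mono ennreal_leI powr_mono2) auto
      qed simp
    qed
    show "AE t in lborel. (\<lambda>n. ennreal (h n t) * indicator {0..w} t) \<longlonglongrightarrow> ennreal (g t powr (N - 1)) * indicator {0..w} t"
    proof (rule AE_I2)
      fix t
      show "(\<lambda>n. ennreal (h n t) * indicator {0..w} t) \<longlonglongrightarrow> ennreal (g t powr (N - 1)) * indicator {0..w} t"
        using lim[of t] by (cases "t \<in> {0..w}") (auto intro: tendsto_ennrealI)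
    qed
  qed (use hb eq in auto)
  then show ?thesis by (simp only: eq)
qed

lemma volume_ratio:
  assumes r: "0 < r" "r < R"
  shows "(\<integral>\<^sup>+ t\<in>{0..r}. ennreal (g t powr (N - 1)) \<partial>lborel) / (\<integral>\<^sup>+ t\<in>{0..R}. ennreal (g t powr (N - 1)) \<partial>lborel)
    \<le> ball_volume m x r / ball_volume m x R"
proof -
  define Ir where "Ir = (\<integral>\<^sup>+ t\<in>{0..r}. ennreal (g t powr (N - 1)) \<partial>lborel)"
  define IR where "IR = (\<integral>\<^sup>+ t\<in>{0..R}. ennreal (g t powr (N - 1)) \<partial>lborel)"
  have lims: "(\<lambda>n. ennreal (H n r)) \<longlonglongrightarrow> Ir" "(\<lambda>n. ennreal (H n R)) \<longlonglongrightarrow> IR"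
    unfolding Ir_def IR_def using r R by (intro H_limit; simp)+
  have bv: "ball_volume m x w = ennreal (v w)" for w
    using ball_finite[of w] by (simp add: ball_volume_def v_def emeasure_eq_ennreal_measure)
  have vpos: "0 < v r"
  proof -
    have "x \<in> msupport m" using supp by simp
    then have "0 < emeasure m (ball x r)" using r by (auto simp: msupport_def)
    also have "\<dots> \<le> emeasure m (cball x r)" using sm by (intro emeasure_mono) auto
    finally show ?thesis using bv[of r] by (simp add: ball_volume_def)
  qed
  then have vR: "0 < v R" using v_mono[of r R] r by simp
  have le: "ennreal (v R) * Ir \<le> ennreal (v r) * IR"
  proof (rule LIMSEQ_le)
    show "(\<lambda>n. ennreal (v R) * ennreal (H n r)) \<longlonglongrightarrow> ennreal (v R) * Ir"
      "(\<lambda>n. ennreal (v r) * ennreal (H n R)) \<longlonglongrightarrow> ennreal (v r) * IR"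
      by (intro ennreal_tendsto_cmult lims; simp)+
    have "ennreal (v R) * ennreal (H n r) \<le> ennreal (v r) * ennreal (H n R)" for n
      using volume_comparison[OF r, of n] v_nonneg by (simp add: ennreal_mult''[symmetric] H_pos r R less_imp_le ennreal_mult[symmetric] ennreal_leI)
    then show "\<exists>M. \<forall>n\<ge>M. ennreal (v R) * ennreal (H n r) \<le> ennreal (v r) * ennreal (H n R)" by blast
  qed
  have fin: "IR \<le> ennreal (H 0 R)" 
  proof (rule LIMSEQ_le_const2[OF lims(2)])
    have "H n R \<le> H 0 R" for n
      unfolding H_def
    proof (rule integral_le)
      fix t assume t: "t \<in> {0..R}"
      show "h n t \<le> h 0 t" unfolding h_eq[OF t]
        using N u_nonneg[OF t] u_le[OF t] by (intro powr_mono2) auto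
    qed (auto intro!: integrable_continuous_real h_cont)
    then show "\<exists>M. \<forall>n\<ge>M. ennreal (H n R) \<le> ennreal (H 0 R)" by (auto intro: ennreal_leI)
  qed
  have IrR: "Ir \<le> IR" unfolding Ir_def IR_def using r by (intro nn_integral_mono) (auto split: split_indicator)
  obtain j where j: "IR = ennreal j" "0 \<le> j" using fin by (cases IR rule: ennreal_cases) (auto simp: top_unique)
  obtain i where i: "Ir = ennreal i" "0 \<le> i" using IrR j by (cases Ir rule: ennreal_cases) (auto simp: top_unique)
  show ?thesis
  proof (cases "j = 0")
    case True
    then have "Ir = 0" using IrR j by simp
    then show ?thesis by (simp flip: Ir_def)
  next
    case False
    then have j0: "0 < j" using j by simp
    have "v R * i \<le> v r * j" using le i j vpos vR by (simp add: ennreal_mult[symmetric])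
    then have "i / j \<le> v r / v R" using j0 vR by (simp add: field_simps)
    then have "ennreal (i / j) \<le> ennreal (v r / v R)" by (rule ennreal_leI)
    then show ?thesis unfolding Ir_def[symmetric] IR_def[symmetric] bv i j
      using j0 i vpos vR by (simp add: divide_ennreal)
  qed
qed

end

theorem theorem5p9:
  fixes m :: "'a::polish_space measure" and k :: "'a \<Rightarrow> real" and N :: real
    and x :: 'a and r R :: real
  assumes "metric_measure_space m"
    and "msupport m = UNIV"
    and "admissible k"
    and "CD m k N"
    and "N > 1"
    and "0 < r" and "r < R" and "ennreal R \<le> model_pi k N x"
  shows "sphere_volume m x r / sphere_volume m x R
           \<ge> ennreal (model_sine k N x r powr (N - 1)) / ennreal (model_sine k N x R powr (N - 1))
       \<and> ball_volume m x r / ball_volume m x R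
           \<ge> (\<integral>\<^sup>+ t\<in>{0..r}. ennreal (model_sine k N x t powr (N - 1)) \<partial>lborel)
             / (\<integral>\<^sup>+ t\<in>{0..R}. ennreal (model_sine k N x t powr (N - 1)) \<partial>lborel)"
proof -
  interpret bishop_gromov m k N x R
    by unfold_locales (use assms in auto)
  have int_eq: "(\<integral>\<^sup>+ t\<in>{0..w}. ennreal (model_sine k N x t powr (N - 1)) \<partial>lborel)
      = (\<integral>\<^sup>+ t\<in>{0..w}. ennreal (g t powr (N - 1)) \<partial>lborel)" if "w \<le> R" for w
    using that by (intro nn_integral_cong) (auto simp: model_sine_eq split: split_indicator)
  have "model_sine k N x r = g r" "model_sine k N x R = g R"
    using assms(6,7) by (auto intro!: model_sine_eq)
  then show ?thesis
    using sphere_volume_ratio[OF assms(6,7)] volume_ratio[OF assms(6,7)] assms(7)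
    by (simp add: int_eq)
qed

end
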